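(* Let $\mathbb{F}$ be an algebraically closed field of characteristic not two, and let $X:V\to V$ be a $1$-fold cross product on an $\mathbb{F}$-vector space $V$ of even dimension $n=2s$. Let $\mathbf{i}\in\mathbb{F}$ with $\mathbf{i}^2=-1$, and $V_\pm=\{v\in V\mid X(v)=\pm\mathbf{i}v\}$. Then, up to equivalence, there is a unique fine grading $\Gamma$ on $(V,X)$; its universal group is $\mathbb{Z}^n$, and it is obtained by fixing bases $\{v_1,\dots,v_s\}$ of $V_+$ and $\{w_1,\dots,w_s\}$ of $V_-$ and setting $\deg(v_i)=\epsilon_i$, $\deg(w_i)=\epsilon_{s+i}$ for $i=1,\dots,s$, where $\epsilon_1,\dots,\epsilon_n$ is the canonical basis of $\mathbb{Z}^n$. The Weyl group $W(\Gamma)$ is $\mathrm{Sym}_s\times\mathrm{Sym}_s$.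
   Context: A $1$-fold cross product on $V$ is a linear map $X:V\to V$ for which there is a nondegenerate symmetric bilinear form $b$ on $V$ with $b(X(v),v)=0$ and $b(X(v),X(v))=b(v,v)$ for all $v\in V$. $\mathrm{Aut}(V,X)$ is the group of linear automorphisms of $V$ commuting with $X$. For an abelian group $G$, a $G$-grading on $(V,X)$ is a vector space decomposition $V=\bigoplus_{g\in G}V_g$ with $X(V_g)\subseteq V_g$ for all $g$. A grading refines another one (possibly by a different abelian group) if each of its homogeneous components is contained in a homogeneous component of the other, properly if some nonzero component is strictly contained; it is fine if it admits no proper refinement. Two gradings (possibly by different groups) are equivalent if some $\varphi\in\mathrm{Aut}(V,X)$ maps each nonzero homogeneous component of the first onto a homogeneous component of the second. The universal group of $\Gamma$ is the finitely generated abelian group $U$ such that the diagonalizable group scheme $\mathbf{Diag}(\Gamma)$ (whose $R$-points are the automorphisms of $(V\otimes_{\mathbb{F}}R,X_R)$ acting as a scalar in $R^\times$ on each homogeneous component) is isomorphic to the diagonalizable group scheme represented by $\mathbb{F}U$. The Weyl group $W(\Gamma)$ is the quotient of the group of elements of $\mathrm{Aut}(V,X)$ permuting the homogeneous components of $\Gamma$ by the subgroup of those that map each homogeneous component to itself. $\mathrm{Sym}_s$ is the symmetric group on $s$ symbols. *)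

theory Defs
  imports
    "HOL-Computational_Algebra.Polynomial"
    "HOL-Algebra.Bij"
    "HOL-Algebra.Sym_Groups"
    "HOL-Algebra.Free_Abelian_Groups"
    "HOL-Algebra.Algebraic_Closure_Type"
begin

(* frees the identifier X *)
no_notation var (\<open>X\<index>\<close>)

text \<open>The vector space \<open>V\<close> is a whole type \<open>'v\<close> with scalar multiplication \<open>sc\<close> over a field that is
  also a type.  Grading groups and commutative algebras, which the definitions quantify over, are
  records with carriers.\<close>

definition bilinear_form ::
  "('f::field \<Rightarrow> 'v::ab_group_add \<Rightarrow> 'v) \<Rightarrow> ('v \<Rightarrow> 'v \<Rightarrow> 'f) \<Rightarrow> bool" where
  "bilinear_form sc \<beta> \<longleftrightarrow>
     (\<forall>u. Vector_Spaces.linear sc (*) (\<lambda>v. \<beta> u v)) \<and>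
     (\<forall>v. Vector_Spaces.linear sc (*) (\<lambda>u. \<beta> u v))"

definition one_fold_cross_product ::
  "('f::field \<Rightarrow> 'v::ab_group_add \<Rightarrow> 'v) \<Rightarrow> ('v \<Rightarrow> 'v) \<Rightarrow> bool" where
  "one_fold_cross_product sc X \<longleftrightarrow>
     Vector_Spaces.linear sc sc X \<and>
     (\<exists>\<beta>. bilinear_form sc \<beta> \<and>
          (\<forall>u v. \<beta> u v = \<beta> v u) \<and>
          (\<forall>u. (\<forall>v. \<beta> u v = 0) \<longrightarrow> u = 0) \<and>
          (\<forall>v. \<beta> (X v) v = 0) \<and>
          (\<forall>v. \<beta> (X v) (X v) = \<beta> v v))"

definition Aut_group ::
  "('f::field \<Rightarrow> 'v::ab_group_add \<Rightarrow> 'v) \<Rightarrow> ('v \<Rightarrow> 'v) \<Rightarrow> ('v \<Rightarrow> 'v) monoid" where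
  "Aut_group sc X = (BijGroup UNIV)
     \<lparr>carrier := {\<phi>. Vector_Spaces.linear sc sc \<phi> \<and> bij \<phi> \<and> (\<forall>v. \<phi> (X v) = X (\<phi> v))}\<rparr>"

subsection \<open>Gradings\<close>

text \<open>A grading by \<open>G\<close> is a function \<open>\<Gamma>\<close> giving the component \<open>\<Gamma> g\<close> of each degree; its values outside
  \<open>carrier G\<close> are irrelevant.\<close>

definition direct_sum_decomposition ::
  "('f::field \<Rightarrow> 'v::ab_group_add \<Rightarrow> 'v) \<Rightarrow> 'i set \<Rightarrow> ('i \<Rightarrow> 'v set) \<Rightarrow> bool" where
  "direct_sum_decomposition sc I W \<longleftrightarrow>
     (\<forall>i\<in>I. Modules.module.subspace sc (W i)) \<and>
     (\<forall>v. \<exists>!f. (\<forall>i\<in>I. f i \<in> W i) \<and> (\<forall>i. i \<notin> I \<longrightarrow> f i = 0) \<and>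
               finite {i. f i \<noteq> 0} \<and> v = (\<Sum>i | f i \<noteq> 0. f i))"

definition grading ::
  "('f::field \<Rightarrow> 'v::ab_group_add \<Rightarrow> 'v) \<Rightarrow> ('v \<Rightarrow> 'v) \<Rightarrow> 'g monoid \<Rightarrow> ('g \<Rightarrow> 'v set) \<Rightarrow> bool" where
  "grading sc X G \<Gamma> \<longleftrightarrow>
     comm_group G \<and> direct_sum_decomposition sc (carrier G) \<Gamma> \<and>
     (\<forall>g\<in>carrier G. X ` \<Gamma> g \<subseteq> \<Gamma> g)"

definition refines ::
  "'h monoid \<Rightarrow> ('h \<Rightarrow> 'v set) \<Rightarrow> 'g monoid \<Rightarrow> ('g \<Rightarrow> 'v set) \<Rightarrow> bool" where
  "refines H \<Delta> G \<Gamma> \<longleftrightarrow> (\<forall>h\<in>carrier H. \<exists>g\<in>carrier G. \<Delta> h \<subseteq> \<Gamma> g)"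

definition properly_refines ::
  "'h monoid \<Rightarrow> ('h \<Rightarrow> 'v::zero set) \<Rightarrow> 'g monoid \<Rightarrow> ('g \<Rightarrow> 'v set) \<Rightarrow> bool" where
  "properly_refines H \<Delta> G \<Gamma> \<longleftrightarrow>
     refines H \<Delta> G \<Gamma> \<and>
     (\<exists>h\<in>carrier H. \<exists>g\<in>carrier G. \<Delta> h \<noteq> {0} \<and> \<Delta> h \<subset> \<Gamma> g)"

text \<open>HOL cannot quantify over types inside a formula, so the type \<open>'h\<close> in which the groups of the
  refining gradings live is a parameter.  On a finite-dimensional space a grading has finitely many
  nonzero components, hence is already a grading by a countable group, so \<open>'h = nat\<close> tests all
  refinements.  For any \<open>'h\<close>, fineness in the usual sense implies \<open>fine_grading TYPE('h)\<close>, so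
  \<open>TYPE(nat)\<close> loses nothing as a hypothesis, and an arbitrary \<open>TYPE('h)\<close> loses nothing as a conclusion.\<close>

definition fine_grading ::
  "'h itself \<Rightarrow> ('f::field \<Rightarrow> 'v::ab_group_add \<Rightarrow> 'v) \<Rightarrow> ('v \<Rightarrow> 'v) \<Rightarrow>
   'g monoid \<Rightarrow> ('g \<Rightarrow> 'v set) \<Rightarrow> bool" where
  "fine_grading _ sc X G \<Gamma> \<longleftrightarrow>
     grading sc X G \<Gamma> \<and>
     \<not> (\<exists>(H :: 'h monoid) \<Delta>. grading sc X H \<Delta> \<and> properly_refines H \<Delta> G \<Gamma>)"

definition equivalent_gradings ::
  "('f::field \<Rightarrow> 'v::ab_group_add \<Rightarrow> 'v) \<Rightarrow> ('v \<Rightarrow> 'v) \<Rightarrow>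
   'g monoid \<Rightarrow> ('g \<Rightarrow> 'v set) \<Rightarrow> 'h monoid \<Rightarrow> ('h \<Rightarrow> 'v set) \<Rightarrow> bool" where
  "equivalent_gradings sc X G \<Gamma> H \<Delta> \<longleftrightarrow>
     (\<exists>\<phi>\<in>carrier (Aut_group sc X).
        \<forall>g\<in>carrier G. \<Gamma> g \<noteq> {0} \<longrightarrow> (\<exists>h\<in>carrier H. \<phi> ` \<Gamma> g = \<Delta> h))"

subsection \<open>The Weyl group\<close>

definition nonzero_components :: "'g monoid \<Rightarrow> ('g \<Rightarrow> 'v::zero set) \<Rightarrow> 'v set set" where
  "nonzero_components G \<Gamma> = {\<Gamma> g | g. g \<in> carrier G \<and> \<Gamma> g \<noteq> {0}}"

definition Aut_grading ::
  "('f::field \<Rightarrow> 'v::ab_group_add \<Rightarrow> 'v) \<Rightarrow> ('v \<Rightarrow> 'v) \<Rightarrow>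
   'g monoid \<Rightarrow> ('g \<Rightarrow> 'v set) \<Rightarrow> ('v \<Rightarrow> 'v) monoid" where
  "Aut_grading sc X G \<Gamma> = (Aut_group sc X)
     \<lparr>carrier := {\<phi> \<in> carrier (Aut_group sc X).
        bij_betw (image \<phi>) (nonzero_components G \<Gamma>) (nonzero_components G \<Gamma>)}\<rparr>"

definition Stab_grading ::
  "('f::field \<Rightarrow> 'v::ab_group_add \<Rightarrow> 'v) \<Rightarrow> ('v \<Rightarrow> 'v) \<Rightarrow>
   'g monoid \<Rightarrow> ('g \<Rightarrow> 'v set) \<Rightarrow> ('v \<Rightarrow> 'v) set" where
  "Stab_grading sc X G \<Gamma> =
     {\<phi> \<in> carrier (Aut_group sc X). \<forall>W\<in>nonzero_components G \<Gamma>. \<phi> ` W = W}"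

definition Weyl_group ::
  "('f::field \<Rightarrow> 'v::ab_group_add \<Rightarrow> 'v) \<Rightarrow> ('v \<Rightarrow> 'v) \<Rightarrow>
   'g monoid \<Rightarrow> ('g \<Rightarrow> 'v set) \<Rightarrow> ('v \<Rightarrow> 'v) set monoid" where
  "Weyl_group sc X G \<Gamma> = Aut_grading sc X G \<Gamma> Mod Stab_grading sc X G \<Gamma>"

subsection \<open>Commutative algebras and the group scheme represented by a group algebra\<close>

text \<open>The library's \<open>algebra\<close> is commutative, associative and unital.\<close>

definition comm_algebra :: "('f::field, 'r) module \<Rightarrow> bool" where
  "comm_algebra A \<longleftrightarrow> algebra (ring_of_type_algebra :: 'f ring) A"

definition alg_homs :: "('f::field, 'r) module \<Rightarrow> ('f, 's) module \<Rightarrow> ('r \<Rightarrow> 's) set" where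
  "alg_homs A A' = {\<phi> \<in> ring_hom A A' \<inter> extensional (carrier A).
     \<forall>c. \<forall>a\<in>carrier A. \<phi> (c \<odot>\<^bsub>A\<^esub> a) = c \<odot>\<^bsub>A'\<^esub> \<phi> a}"

definition group_algebra :: "'u monoid \<Rightarrow> ('f::field, 'u \<Rightarrow>\<^sub>0 'f) module" where
  "group_algebra U = \<lparr>
     carrier = {p. Poly_Mapping.keys p \<subseteq> carrier U},
     monoid.mult = (\<lambda>p q. \<Sum>u\<in>Poly_Mapping.keys p. \<Sum>v\<in>Poly_Mapping.keys q.
        Poly_Mapping.single (u \<otimes>\<^bsub>U\<^esub> v) (Poly_Mapping.lookup p u * Poly_Mapping.lookup q v)),
     one = Poly_Mapping.single \<one>\<^bsub>U\<^esub> 1,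
     ring.zero = 0,
     ring.add = (+),
     module.smult = (\<lambda>c. Poly_Mapping.map (\<lambda>x. c * x))\<rparr>"

text \<open>The group of \<open>A\<close>-points of the scheme represented by the group algebra.  Product and unit are dual to
  the comultiplication \<open>u \<mapsto> u \<otimes> u\<close> and counit \<open>u \<mapsto> 1\<close> for \<open>u\<close> in the group \<open>U\<close>.\<close>

definition group_algebra_points ::
  "'u monoid \<Rightarrow> ('f::field, 'r) module \<Rightarrow> (('u \<Rightarrow>\<^sub>0 'f) \<Rightarrow> 'r) monoid" where
  "group_algebra_points U A = \<lparr>
     carrier = alg_homs (group_algebra U) A,
     monoid.mult = (\<lambda>\<alpha> \<beta>. \<lambda>p\<in>carrier (group_algebra U :: ('f, 'u \<Rightarrow>\<^sub>0 'f) module).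
        \<Oplus>\<^bsub>A\<^esub>u\<in>Poly_Mapping.keys p. Poly_Mapping.lookup p u \<odot>\<^bsub>A\<^esub>
          (\<alpha> (Poly_Mapping.single u 1) \<otimes>\<^bsub>A\<^esub> \<beta> (Poly_Mapping.single u 1))),
     one = (\<lambda>p\<in>carrier (group_algebra U :: ('f, 'u \<Rightarrow>\<^sub>0 'f) module).
        (\<Sum>u\<in>Poly_Mapping.keys p. Poly_Mapping.lookup p u) \<odot>\<^bsub>A\<^esub> \<one>\<^bsub>A\<^esub>)\<rparr>"

subsection \<open>Extension of scalars\<close>

text \<open>The tensor product of \<open>V\<close> with the algebra \<open>A\<close>: the free abelian group on all pairs \<open>(v, a)\<close>, modulo
  biadditivity and balancedness.\<close>

type_synonym ('v, 'r) tensor = "(('v \<times> 'r) \<Rightarrow>\<^sub>0 int) set"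

definition tensor_free :: "('f, 'r) module \<Rightarrow> (('v \<times> 'r) \<Rightarrow>\<^sub>0 int) monoid" where
  "tensor_free A = free_Abelian_group (UNIV \<times> carrier A)"

definition tensor_relations ::
  "('f::field \<Rightarrow> 'v::ab_group_add \<Rightarrow> 'v) \<Rightarrow> ('f, 'r) module \<Rightarrow> (('v \<times> 'r) \<Rightarrow>\<^sub>0 int) set" where
  "tensor_relations sc A =
     {frag_of (v + w, a) - frag_of (v, a) - frag_of (w, a) | v w a. a \<in> carrier A} \<union>
     {frag_of (v, a \<oplus>\<^bsub>A\<^esub> b) - frag_of (v, a) - frag_of (v, b) | v a b.
        a \<in> carrier A \<and> b \<in> carrier A} \<union>
     {frag_of (sc c v, a) - frag_of (v, c \<odot>\<^bsub>A\<^esub> a) | c v a. a \<in> carrier A}"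

definition tensor_kernel ::
  "('f::field \<Rightarrow> 'v::ab_group_add \<Rightarrow> 'v) \<Rightarrow> ('f, 'r) module \<Rightarrow> (('v \<times> 'r) \<Rightarrow>\<^sub>0 int) set" where
  "tensor_kernel sc A = generate (tensor_free A) (tensor_relations sc A)"

definition tensor_group ::
  "('f::field \<Rightarrow> 'v::ab_group_add \<Rightarrow> 'v) \<Rightarrow> ('f, 'r) module \<Rightarrow> ('v, 'r) tensor monoid" where
  "tensor_group sc A = tensor_free A Mod tensor_kernel sc A"

definition pure_tensor ::
  "('f::field \<Rightarrow> 'v::ab_group_add \<Rightarrow> 'v) \<Rightarrow> ('f, 'r) module \<Rightarrow> 'v \<Rightarrow> 'r \<Rightarrow> ('v, 'r) tensor" where
  "pure_tensor sc A v a = tensor_kernel sc A #>\<^bsub>tensor_free A\<^esub> frag_of (v, a)"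

text \<open>The additive map into \<open>tensor_group sc A\<close> sending the pure tensor of \<open>(v, a)\<close> to that of \<open>h (v, a)\<close>,
  for \<open>h\<close> respecting the tensor relations.  All members of the union are then the same coset.\<close>

definition tensor_map ::
  "('f::field \<Rightarrow> 'v::ab_group_add \<Rightarrow> 'v) \<Rightarrow> ('f, 's) module \<Rightarrow>
   ('v \<times> 'r \<Rightarrow> 'v \<times> 's) \<Rightarrow> ('v, 'r) tensor \<Rightarrow> ('v, 's) tensor" where
  "tensor_map sc A h T =
     (\<Union>x\<in>T. tensor_kernel sc A #>\<^bsub>tensor_free A\<^esub> frag_extend (\<lambda>p. frag_of (h p)) x)"

definition tensor_smult ::
  "('f::field \<Rightarrow> 'v::ab_group_add \<Rightarrow> 'v) \<Rightarrow> ('f, 'r) module \<Rightarrow>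
   'r \<Rightarrow> ('v, 'r) tensor \<Rightarrow> ('v, 'r) tensor" where
  "tensor_smult sc A r = tensor_map sc A (\<lambda>(v, a). (v, r \<otimes>\<^bsub>A\<^esub> a))"

definition tensor_endo ::
  "('f::field \<Rightarrow> 'v::ab_group_add \<Rightarrow> 'v) \<Rightarrow> ('f, 'r) module \<Rightarrow>
   ('v \<Rightarrow> 'v) \<Rightarrow> ('v, 'r) tensor \<Rightarrow> ('v, 'r) tensor" where
  "tensor_endo sc A X = tensor_map sc A (\<lambda>(v, a). (X v, a))"

definition tensor_base_change ::
  "('f::field \<Rightarrow> 'v::ab_group_add \<Rightarrow> 'v) \<Rightarrow> ('f, 's) module \<Rightarrow>
   ('r \<Rightarrow> 's) \<Rightarrow> ('v, 'r) tensor \<Rightarrow> ('v, 's) tensor" where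
  "tensor_base_change sc A' \<phi> = tensor_map sc A' (\<lambda>(v, a). (v, \<phi> a))"

definition tensor_subspace ::
  "('f::field \<Rightarrow> 'v::ab_group_add \<Rightarrow> 'v) \<Rightarrow> ('f, 'r) module \<Rightarrow> 'v set \<Rightarrow> ('v, 'r) tensor set" where
  "tensor_subspace sc A W =
     generate (tensor_group sc A) {pure_tensor sc A v a | v a. v \<in> W \<and> a \<in> carrier A}"

subsection \<open>The diagonal group scheme and the universal group\<close>

definition Diag ::
  "('f::field \<Rightarrow> 'v::ab_group_add \<Rightarrow> 'v) \<Rightarrow> ('v \<Rightarrow> 'v) \<Rightarrow> 'g monoid \<Rightarrow> ('g \<Rightarrow> 'v set) \<Rightarrow>
   ('f, 'r) module \<Rightarrow> (('v, 'r) tensor \<Rightarrow> ('v, 'r) tensor) monoid" where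
  "Diag sc X G \<Gamma> A = (AutoGroup (tensor_group sc A))
     \<lparr>carrier := {f \<in> carrier (AutoGroup (tensor_group sc A)).
        (\<forall>r\<in>carrier A. \<forall>t\<in>carrier (tensor_group sc A).
           f (tensor_smult sc A r t) = tensor_smult sc A r (f t)) \<and>
        (\<forall>t\<in>carrier (tensor_group sc A). f (tensor_endo sc A X t) = tensor_endo sc A X (f t)) \<and>
        (\<forall>g\<in>carrier G. \<exists>r\<in>Units A. \<forall>t\<in>tensor_subspace sc A (\<Gamma> g). f t = tensor_smult sc A r t)}\<rparr>"

text \<open>An isomorphism of group functors on the commutative algebras with carrier in the type \<open>'r\<close>.  On the
  left, an algebra homomorphism \<open>\<phi>\<close> from \<open>A\<close> to \<open>A'\<close> takes \<open>f\<close> to its base change \<open>f'\<close>, which is the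
  only \<open>A'\<close>-linear map compatible with \<open>f\<close>, since the image of \<open>tensor_base_change\<close> spans.\<close>

definition Diag_isomorphic ::
  "'r itself \<Rightarrow> ('f::field \<Rightarrow> 'v::ab_group_add \<Rightarrow> 'v) \<Rightarrow> ('v \<Rightarrow> 'v) \<Rightarrow>
   'g monoid \<Rightarrow> ('g \<Rightarrow> 'v set) \<Rightarrow> 'u monoid \<Rightarrow> bool" where
  "Diag_isomorphic _ sc X G \<Gamma> U \<longleftrightarrow>
     (\<exists>\<theta>. (\<forall>A :: ('f, 'r) module. comm_algebra A \<longrightarrow>
             \<theta> A \<in> iso (Diag sc X G \<Gamma> A) (group_algebra_points U A)) \<and>
          (\<forall>(A :: ('f, 'r) module) (A' :: ('f, 'r) module) \<phi>.
             comm_algebra A \<and> comm_algebra A' \<and> \<phi> \<in> alg_homs A A' \<longrightarrow>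
             (\<forall>f\<in>carrier (Diag sc X G \<Gamma> A). \<exists>f'\<in>carrier (Diag sc X G \<Gamma> A').
                (\<forall>t\<in>carrier (tensor_group sc A).
                   f' (tensor_base_change sc A' \<phi> t) = tensor_base_change sc A' \<phi> (f t)) \<and>
                \<theta> A' f' =
                  compose (carrier (group_algebra U :: ('f, 'u \<Rightarrow>\<^sub>0 'f) module)) \<phi> (\<theta> A f))))"

text \<open>The type parameter again makes up for the missing quantification over types: the statement for
  all \<open>'r\<close> covers all commutative algebras.\<close>

definition universal_group ::
  "'r itself \<Rightarrow> ('f::field \<Rightarrow> 'v::ab_group_add \<Rightarrow> 'v) \<Rightarrow> ('v \<Rightarrow> 'v) \<Rightarrow>
   'g monoid \<Rightarrow> ('g \<Rightarrow> 'v set) \<Rightarrow> 'u monoid \<Rightarrow> bool" where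
  "universal_group R sc X G \<Gamma> U \<longleftrightarrow>
     comm_group U \<and> (\<exists>S\<subseteq>carrier U. finite S \<and> generate U S = carrier U) \<and>
     Diag_isomorphic R sc X G \<Gamma> U"

subsection \<open>The grading defined by a pair of bases\<close>

definition indexed_basis ::
  "('f::field \<Rightarrow> 'v::ab_group_add \<Rightarrow> 'v) \<Rightarrow> nat \<Rightarrow> (nat \<Rightarrow> 'v) \<Rightarrow> 'v set \<Rightarrow> bool" where
  "indexed_basis sc s v W \<longleftrightarrow>
     inj_on v {1..s} \<and> \<not> Modules.module.dependent sc (v ` {1..s}) \<and>
     Modules.module.span sc (v ` {1..s}) = W"

text \<open>The grading by \<open>free_Abelian_group {1..2 * s}\<close>, with canonical basis \<open>frag_of 1, \<dots>, frag_of (2 * s)\<close>,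
  in which \<open>v j\<close> has degree \<open>frag_of j\<close> and \<open>w j\<close> has degree \<open>frag_of (s + j)\<close>.\<close>

definition bases_grading ::
  "('f::field \<Rightarrow> 'v::ab_group_add \<Rightarrow> 'v) \<Rightarrow> nat \<Rightarrow> (nat \<Rightarrow> 'v) \<Rightarrow> (nat \<Rightarrow> 'v) \<Rightarrow>
   (nat \<Rightarrow>\<^sub>0 int) \<Rightarrow> 'v set" where
  "bases_grading sc s v w g = Modules.module.span sc
     ({v j | j. j \<in> {1..s} \<and> frag_of j = g} \<union> {w j | j. j \<in> {1..s} \<and> frag_of (s + j) = g})"

end

(*
The form makes X skew and an isometry, so X^2 = -1 and V is the direct sum of the eigenspaces V+ and
V- for i and -i.  Both are totally isotropic, so the form pairs them perfectly and each has
dimension s.  Every homogeneous component is X-invariant, hence the sum of its intersections with V+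
and V-; so V has a basis of homogeneous eigenvectors, and the lines it spans form a grading which
refines the given one.  A fine grading is therefore a decomposition into eigenlines, s in V+ and s
in V-.  Automorphisms of (V, X) are the linear automorphisms preserving V+ and V-: they act
transitively on pairs of bases, and the induced permutations of the 2s lines are those preserving
the two blocks.  Over an algebra A, a diagonal automorphism is an arbitrary family of 2s units of A;
such families are also the characters of Z^(2s) with values in A, that is, the A-points of the
scheme represented by the group algebra of Z^(2s).
*)

theory Submission
  imports Defs
begin

section \<open>Gradings by lines\<close>

text \<open>Because \<open>X\<close> is unary, the group law of the grading group puts no condition
  on the components: a grading is a decomposition into \<open>X\<close>-invariant subspaces together
  with labels from some abelian group. Eigenlines may therefore be labelled at will, no relation
  among their degrees is forced, and the universal group comes out free. The same freedom meets the
  demand that a refinement tested by \<open>fine_grading TYPE(nat)\<close> be graded by a group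
  inside \<open>nat\<close>: any abelian group structure on \<open>nat\<close> will do, and
  \<open>xor\<close> supplies one. The universal group is defined through group functors, so an
  isomorphism for each algebra is not enough; the isomorphisms must commute with base change. Both
  functors are compared with the concrete functor of families of units, where base change applies
  the algebra homomorphism to each entry. A diagonal map is determined by its values on the tensors
  of basis vectors with elements of \<open>A\<close>, and a point by its values on the canonical
  basis of the free group, so naturality needs checking only there.\<close>

locale finite_indexed_basis = vector_space sc
  for sc :: "'f::field \<Rightarrow> 'v::ab_group_add \<Rightarrow> 'v" +
  fixes n :: nat and u :: "nat \<Rightarrow> 'v"
  assumes basis: "indexed_basis sc n u UNIV"
begin

definition coord :: "nat \<Rightarrow> 'v \<Rightarrow> 'f" where
  "coord j v = representation (u ` {1..n}) v (u j)"

lemma inj_u: "inj_on u {1..n}"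
  and independent_u: "independent (u ` {1..n})"
  and span_u: "span (u ` {1..n}) = UNIV"
  using basis unfolding indexed_basis_def by auto

lemma coord_add [simp]: "coord j (v + w) = coord j v + coord j w"
  and coord_scale [simp]: "coord j (sc c v) = c * coord j v"
  and coord_zero [simp]: "coord j 0 = 0"
  unfolding coord_def
  using independent_u span_u
  by (simp_all add: representation_add representation_scale representation_zero)

lemma coord_u [simp]: "k \<in> {1..n} \<Longrightarrow> j \<in> {1..n} \<Longrightarrow> coord j (u k) = (if j = k then 1 else 0)"
  unfolding coord_def
  by (subst representation_basis[OF independent_u]) (auto simp: inj_on_eq_iff[OF inj_u])

lemma expand: "v = (\<Sum>j\<in>{1..n}. sc (coord j v) (u j))"
proof -
  have "v = (\<Sum>b\<in>u ` {1..n}. sc (representation (u ` {1..n}) v b) b)"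
    using sum_representation_eq[OF independent_u, of v "u ` {1..n}"] span_u by simp
  also have "\<dots> = (\<Sum>j\<in>{1..n}. sc (coord j v) (u j))"
    by (subst sum.reindex[OF inj_u]) (simp add: coord_def)
  finally show ?thesis .
qed

lemma coord_sum [simp]: "coord j (\<Sum>k\<in>K. h k) = (\<Sum>k\<in>K. coord j (h k))"
  by (induction K rule: infinite_finite_induct) auto

lemma u_nonzero: "j \<in> {1..n} \<Longrightarrow> u j \<noteq> 0"
  using coord_u[of j j] by (metis coord_zero zero_neq_one)

lemma linear_eqI:
  assumes "Vector_Spaces.linear sc sc f" "Vector_Spaces.linear sc sc g" "\<And>j. j \<in> {1..n} \<Longrightarrow> f (u j) = g (u j)"
  shows "f v = g v"
proof -
  interpret f: Vector_Spaces.linear sc sc f by fact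
  interpret g: Vector_Spaces.linear sc sc g by fact
  show ?thesis
    by (subst (1 2) expand[of v]) (simp add: f.sum g.sum f.scale g.scale assms(3))
qed

definition extend_linearly :: "(nat \<Rightarrow> 'v) \<Rightarrow> 'v \<Rightarrow> 'v" where
  "extend_linearly y v = (\<Sum>j\<in>{1..n}. sc (coord j v) (y j))"

lemma linear_extend_linearly: "Vector_Spaces.linear sc sc (extend_linearly y)"
  by unfold_locales
     (simp_all add: extend_linearly_def scale_left_distrib sum.distrib scale_sum_right)

lemma extend_linearly_u [simp]: "j \<in> {1..n} \<Longrightarrow> extend_linearly y (u j) = y j"
proof -
  assume "j \<in> {1..n}"
  then have "extend_linearly y (u j) = (\<Sum>k\<in>{1..n}. if k = j then y k else 0)"
    unfolding extend_linearly_def by (intro sum.cong) auto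
  with \<open>j \<in> {1..n}\<close> show ?thesis by simp
qed

lemma span_lineE:
  assumes "v \<in> span {u j}" obtains c where "v = sc c (u j)"
  using assms by (auto simp: span_singleton)

text \<open>The inverse is the extension in the opposite direction, from \<open>y\<close> to
  \<open>u\<close>; both composites fix a basis.\<close>

lemma bij_extend_linearly:
  assumes "indexed_basis sc n y UNIV"
  shows "bij (extend_linearly y)"
proof -
  interpret y: finite_indexed_basis sc n y by unfold_locales fact
  have "(y.extend_linearly u \<circ> extend_linearly y) v = id v" for v
    by (rule linear_eqI[OF Vector_Spaces.linear_compose[OF linear_extend_linearly y.linear_extend_linearly] linear_id])
      simp
  moreover have "(extend_linearly y \<circ> y.extend_linearly u) v = id v" for v
    by (rule y.linear_eqI[OF Vector_Spaces.linear_compose[OF y.linear_extend_linearly linear_extend_linearly] linear_id])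
      simp
  ultimately show ?thesis by (intro o_bij[of "y.extend_linearly u"] ext)
qed

lemma coord_span_eq_0:
  assumes "w \<in> span {u j |j. j \<in> {1..n} \<and> P j}" "k \<in> {1..n}" "\<not> P k"
  shows "coord k w = 0"
  using assms(1)
proof (induction rule: span_induct)
  case base
  show ?case by (auto simp: subspace_def)
next
  case (step x)
  with assms(2,3) show ?case by auto
qed

text \<open>The degree map \<open>d\<close> may take the same value on several basis vectors. This
  generality serves \<open>fine_equivalent_bases_grading\<close>, where \<open>d\<close> consists of
  the degrees of homogeneous vectors in an unknown grading.\<close>

lemma direct_sum_span_degree:
  assumes "d ` {1..n} \<subseteq> I"
  shows "direct_sum_decomposition sc I (\<lambda>g. span {u j |j. j \<in> {1..n} \<and> d j = g})" (is "direct_sum_decomposition sc I ?W")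
  unfolding direct_sum_decomposition_def
proof (intro conjI allI ballI)
  show "subspace (?W g)" for g by simp
  fix v
  define f where "f g = (\<Sum>k\<in>{1..n}. if d k = g then sc (coord k v) (u k) else 0)" for g
  have supp: "{g. f g \<noteq> 0} \<subseteq> d ` {1..n}"
  proof -
    have "f g = 0" if "g \<notin> d ` {1..n}" for g
      unfolding f_def using that by (intro sum.neutral) auto
    then show ?thesis by blast
  qed
  show "\<exists>!f. (\<forall>g\<in>I. f g \<in> ?W g) \<and> (\<forall>g. g \<notin> I \<longrightarrow> f g = 0) \<and>
               finite {g. f g \<noteq> 0} \<and> v = (\<Sum>g | f g \<noteq> 0. f g)"
  proof (rule ex1I[of _ f], intro conjI allI ballI impI)
    show "f g \<in> ?W g" for g
      unfolding f_def by (intro span_sum) (auto intro: span_scale span_base span_zero)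
    show "f g = 0" if "g \<notin> I" for g using that assms supp by blast
    show "finite {g. f g \<noteq> 0}" using finite_subset[OF supp] by simp
    have "(\<Sum>g | f g \<noteq> 0. f g) = (\<Sum>g\<in>d ` {1..n}. f g)"
      using supp by (intro sum.mono_neutral_left) auto
    also have "\<dots> = (\<Sum>k\<in>{1..n}. \<Sum>g\<in>d ` {1..n}. if d k = g then sc (coord k v) (u k) else 0)"
      unfolding f_def by (rule sum.swap)
    also have "\<dots> = (\<Sum>k\<in>{1..n}. sc (coord k v) (u k))" by (intro sum.cong) auto
    also have "\<dots> = v" by (rule expand[symmetric])
    finally show "v = (\<Sum>g | f g \<noteq> 0. f g)" ..
  next
    fix f' assume f': "(\<forall>g\<in>I. f' g \<in> ?W g) \<and> (\<forall>g. g \<notin> I \<longrightarrow> f' g = 0) \<and>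
               finite {g. f' g \<noteq> 0} \<and> v = (\<Sum>g | f' g \<noteq> 0. f' g)"
    \<comment> \<open>Outside \<open>I\<close> the component is zero, so membership holds for every
      label and \<open>I\<close> drops out of the argument below.\<close>
    then have mem: "f' g \<in> ?W g" for g by (cases "g \<in> I") (auto simp: span_zero)
    have off: "coord k (f' g) = 0" if "k \<in> {1..n}" "d k \<noteq> g" for k g
      using coord_span_eq_0[OF mem that(1)] that(2) by simp
    \<comment> \<open>Only the component of label \<open>d k\<close> can contribute to the
      \<open>k\<close>-th coordinate, so the coordinates of \<open>v\<close> determine every
      component.\<close>
    have "coord k v = coord k (f' (d k))" if "k \<in> {1..n}" for k
    proof -
      have "coord k v = (\<Sum>g | f' g \<noteq> 0. coord k (f' g))" using f' by (metis coord_sum)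
      also have "\<dots> = (\<Sum>g | f' g \<noteq> 0. if g = d k then coord k (f' g) else 0)"
        using off[OF that] by (intro sum.cong) auto
      also have "\<dots> = coord k (f' (d k))" using f' by auto
      finally show ?thesis .
    qed
    then have "f' g = f g" for g
      unfolding f_def by (subst expand[of "f' g"]) (auto intro!: sum.cong simp: off)
    then show "f' = f" by auto
  qed
qed

end

section \<open>Decompositions into lines spanned by eigenvectors\<close>

locale eigenbasis = finite_indexed_basis sc n u
  for sc :: "'f::field \<Rightarrow> 'v::ab_group_add \<Rightarrow> 'v" and n :: nat and u :: "nat \<Rightarrow> 'v" +
  fixes X :: "'v \<Rightarrow> 'v" and c :: "nat \<Rightarrow> 'f"
  assumes linear_X: "Vector_Spaces.linear sc sc X"
    and eigenvector: "j \<in> {1..n} \<Longrightarrow> X (u j) = sc (c j) (u j)"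
begin

abbreviation lines_grading :: "(nat \<Rightarrow> 'g) \<Rightarrow> 'g \<Rightarrow> 'v set" where
  "lines_grading d g \<equiv> span {u j |j. j \<in> {1..n} \<and> d j = g}"

lemma grading_lines:
  assumes "comm_group G" "d ` {1..n} \<subseteq> carrier G"
  shows "grading sc X G (lines_grading d)"
proof -
  interpret X: Vector_Spaces.linear sc sc X by (fact linear_X)
  have "X v \<in> lines_grading d g" if "v \<in> lines_grading d g" for v g
    using that
  proof (induction rule: span_induct)
    case base
    show ?case by (auto simp: subspace_def X.add X.scale X.zero span_add span_scale span_zero)
  next
    case (step x)
    then obtain j where "x = u j" "j \<in> {1..n}" by blast
    with step show ?case by (simp add: eigenvector span_scale span_base)
  qed
  then show ?thesis
    using assms direct_sum_span_degree[OF assms(2)] by (auto simp: grading_def)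
qed

lemma lines_grading_degree:
  assumes "inj_on d {1..n}" "j \<in> {1..n}"
  shows "lines_grading d (d j) = span {u j}"
  using assms by (intro arg_cong[of _ _ span]) (auto dest: inj_onD)

lemma lines_grading_empty:
  assumes "g \<notin> d ` {1..n}"
  shows "lines_grading d g = {0}"
proof -
  have "{u j |j. j \<in> {1..n} \<and> d j = g} = {}" using assms by auto
  then show ?thesis by (simp only: span_empty)
qed

lemma line_nonzero: "j \<in> {1..n} \<Longrightarrow> span {u j} \<noteq> {0}"
  using u_nonzero[of j] span_base[of "u j" "{u j}"] by auto

lemma nonzero_components_lines:
  assumes "inj_on d {1..n}" "d ` {1..n} \<subseteq> carrier G"
  shows "nonzero_components G (lines_grading d) = (\<lambda>j. span {u j}) ` {1..n}"
proof -
  have "lines_grading d g \<in> (\<lambda>j. span {u j}) ` {1..n}" if "lines_grading d g \<noteq> {0}" for g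
    using that lines_grading_empty[of g d] lines_grading_degree[OF assms(1)] by blast
  moreover have "\<exists>g. span {u j} = lines_grading d g \<and> g \<in> carrier G \<and> lines_grading d g \<noteq> {0}" if "j \<in> {1..n}" for j
    using imageI[OF that, of d] assms(2) line_nonzero[OF that] lines_grading_degree[OF assms(1) that]
    by (intro exI[of _ "d j"]) (simp only: subset_eq, blast)
  ultimately show ?thesis unfolding nonzero_components_def by auto
qed

lemma subspace_of_line:
  assumes "subspace S" "S \<subset> span {x}"
  shows "S = {0}"
proof (rule ccontr)
  assume "S \<noteq> {0}"
  then obtain y where y: "y \<in> S" "y \<noteq> 0" using assms(1) subspace_0 by blast
  then obtain a where a: "y = sc a x" using assms(2) by (auto simp: span_singleton)
  with y(2) have "x = sc (inverse a) y" by auto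
  with y(1) assms(1) have "x \<in> S" by (metis subspace_scale)
  then have "span {x} \<subseteq> S" using assms(1) by (simp add: span_minimal)
  with assms(2) show False by blast
qed

text \<open>A properly refining component would be a nonzero proper subspace of a line or of the
  zero space. Nothing about the refining group enters, so its type \<open>'h\<close> stays
  arbitrary.\<close>

lemma fine_lines:
  assumes "comm_group G" "d ` {1..n} \<subseteq> carrier G" "inj_on d {1..n}"
  shows "fine_grading TYPE('h) sc X G (lines_grading d)"
  unfolding fine_grading_def
proof (intro conjI notI)
  show "grading sc X G (lines_grading d)" using assms grading_lines by blast
  assume "\<exists>(H :: 'h monoid) \<Delta>. grading sc X H \<Delta> \<and> properly_refines H \<Delta> G (lines_grading d)"
  then obtain H :: "'h monoid" and \<Delta> h g where *: "grading sc X H \<Delta>" "h \<in> carrier H"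
    "\<Delta> h \<noteq> {0}" "\<Delta> h \<subset> lines_grading d g"
    unfolding properly_refines_def by blast
  then have S: "subspace (\<Delta> h)" by (auto simp: grading_def direct_sum_decomposition_def)
  show False
  proof (cases "g \<in> d ` {1..n}")
    case True
    then obtain j where "j \<in> {1..n}" "g = d j" by blast
    with *(4) lines_grading_degree[OF assms(3)] have "\<Delta> h \<subset> span {u j}" by simp
    with subspace_of_line[OF S] *(3) show ?thesis by blast
  next
    case False
    with *(4) lines_grading_empty[OF False] have "\<Delta> h \<subset> {0}" by simp
    with subspace_0[OF S] show ?thesis by blast
  qed
qed

end

section \<open>Eigenspaces of a cross product\<close>

text \<open>The basis of V+ occupies the indices up to \<open>s\<close> and that of V- the indices
  from \<open>s + 1\<close> to \<open>2 * s\<close>, in step with the degrees in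
  \<open>bases_grading\<close>.\<close>

definition merge_bases :: "nat \<Rightarrow> (nat \<Rightarrow> 'v) \<Rightarrow> (nat \<Rightarrow> 'v) \<Rightarrow> nat \<Rightarrow> 'v" where
  "merge_bases s v w j = (if j \<le> s then v j else w (j - s))"

text \<open>Brings the grading of the theorem into the form \<open>lines_grading frag_of\<close>, so
  that the lemmas on eigenlines apply to it.\<close>

lemma bases_grading_eq_lines:
  "bases_grading sc s v w g =
     Modules.module.span sc {merge_bases s v w j |j. j \<in> {1..2 * s} \<and> frag_of j = g}"
proof -
  have "{v j |j. j \<in> {1..s} \<and> frag_of j = g} \<union> {w j |j. j \<in> {1..s} \<and> frag_of (s + j) = g} =
    {merge_bases s v w j |j. j \<in> {1..2 * s} \<and> frag_of j = g}" (is "?L = ?R")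
  proof
    show "?L \<subseteq> ?R"
    proof
      fix x assume "x \<in> ?L"
      then consider j where "x = v j" "j \<in> {1..s}" "frag_of j = g"
        | j where "x = w j" "j \<in> {1..s}" "frag_of (s + j) = g" by blast
      then show "x \<in> ?R"
      proof cases
        case (1 j)
        then have "x = merge_bases s v w j \<and> j \<in> {1..2 * s} \<and> frag_of j = g" by (auto simp: merge_bases_def)
        then show ?thesis by blast
      next
        case (2 j)
        then have "x = merge_bases s v w (s + j) \<and> s + j \<in> {1..2 * s} \<and> frag_of (s + j) = g"
          by (auto simp: merge_bases_def)
        then show ?thesis by blast
      qed
    qed
    show "?R \<subseteq> ?L"
    proof
      fix x assume "x \<in> ?R"
      then obtain j where j: "x = merge_bases s v w j" "j \<in> {1..2 * s}" "frag_of j = g" by blast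
      show "x \<in> ?L"
      proof (cases "j \<le> s")
        case True
        with j show ?thesis by (auto simp: merge_bases_def)
      next
        case False
        with j have "x = w (j - s) \<and> j - s \<in> {1..s} \<and> frag_of (s + (j - s)) = g"
          by (auto simp: merge_bases_def)
        then show ?thesis by blast
      qed
    qed
  qed
  then show ?thesis by (simp add: bases_grading_def)
qed

locale cross_product_space = finite_dimensional_vector_space sc B
  for sc :: "'f::field \<Rightarrow> 'v::ab_group_add \<Rightarrow> 'v" and B :: "'v set" +
  fixes X :: "'v \<Rightarrow> 'v" and s :: nat and i :: 'f
  assumes char_not_two: "CHAR('f) \<noteq> 2"
    and dim_UNIV_eq: "dim UNIV = 2 * s"
    and cross_product: "one_fold_cross_product sc X"
    and square_i: "i ^ 2 = - 1"
begin

definition eigenspace :: "'f \<Rightarrow> 'v set" where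
  "eigenspace c = {x. X x = sc c x}"

lemma two_nonzero: "(2::'f) \<noteq> 0"
proof
  assume "(2::'f) = 0"
  then have "of_nat 2 = (0::'f)" by simp
  \<comment> \<open>A divisor of 2 is 1 or 2, and characteristic 1 would make 1 equal to 0.\<close>
  then have "CHAR('f) dvd 2" by (simp only: of_nat_eq_0_iff_char_dvd)
  then have "CHAR('f) \<le> 2" "CHAR('f) \<noteq> 0" using dvd_imp_le[of "CHAR('f)" 2] by (auto intro!: Nat.gr0I)
  moreover have "CHAR('f) \<noteq> 1" using of_nat_CHAR[where 'a = 'f] by (metis of_nat_1 zero_neq_one)
  ultimately show False using char_not_two by linarith
qed

lemma neg_eq_imp_zero: "x = - x \<Longrightarrow> x = (0::'f)"
proof -
  assume "x = - x"
  then have "2 * x = 0" by (metis add.right_inverse mult_2)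
  then show ?thesis using two_nonzero by simp
qed

lemma i_times_i: "i * i = - 1"
  using square_i by (simp add: power2_eq_square)

lemma i_nonzero: "i \<noteq> 0"
  using i_times_i by auto

lemma i_neq_minus_i: "i \<noteq> - i"
  using neg_eq_imp_zero i_nonzero by blast

lemma linear_X: "Vector_Spaces.linear sc sc X"
  using cross_product by (simp add: one_fold_cross_product_def)

sublocale X: Vector_Spaces.linear sc sc X by (fact linear_X)

text \<open>The cross product only asserts that some form exists; choosing one here lets all later
  lemmas speak of the same form.\<close>

definition form :: "'v \<Rightarrow> 'v \<Rightarrow> 'f" where
  "form = (SOME \<beta>. bilinear_form sc \<beta> \<and> (\<forall>u v. \<beta> u v = \<beta> v u) \<and>
          (\<forall>u. (\<forall>v. \<beta> u v = 0) \<longrightarrow> u = 0) \<and> (\<forall>v. \<beta> (X v) v = 0) \<and>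
          (\<forall>v. \<beta> (X v) (X v) = \<beta> v v))"

lemma form_props:
  "bilinear_form sc form \<and> (\<forall>u v. form u v = form v u) \<and>
          (\<forall>u. (\<forall>v. form u v = 0) \<longrightarrow> u = 0) \<and> (\<forall>v. form (X v) v = 0) \<and>
          (\<forall>v. form (X v) (X v) = form v v)"
  using conjunct2[OF cross_product[unfolded one_fold_cross_product_def]]
  unfolding form_def by (rule someI_ex)

lemma form_add: "form (x + y) z = form x z + form y z" "form z (x + y) = form z x + form z y"
  and form_scale: "form (sc c x) z = c * form x z" "form z (sc c x) = c * form z x"
  using form_props by (simp_all add: bilinear_form_def Vector_Spaces.linear_iff)

lemma form_sym: "form x y = form y x"
  using form_props by blast

lemma form_nondegenerate: "(\<And>y. form x y = 0) \<Longrightarrow> x = 0"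
  using form_props by blast

text \<open>Polarization of \<open>form (X v) v = 0\<close> at \<open>v = x + y\<close>.\<close>

lemma form_X_skew: "form (X x) y = - form x (X y)"
proof -
  have "form (X (x + y)) (x + y) = 0" "form (X x) x = 0" "form (X y) y = 0"
    using form_props by blast+
  then have "form (X x) y + form (X y) x = 0" by (simp add: X.add form_add add.commute)
  then show ?thesis by (simp add: form_sym[of "X y"] eq_neg_iff_add_eq_0)
qed

text \<open>Polarization of the isometry condition; the mixed term appears twice, so 2 has to be
  cancelled.\<close>

lemma form_X_X: "form (X x) (X y) = form x y"
proof -
  have *: "form (X z) (X z) = form z z" for z using form_props by blast
  have "form (X x) (X x) + form (X x) (X y) + (form (X x) (X y) + form (X y) (X y)) =
      form x x + form x y + (form x y + form y y)"
    using *[of "x + y"] by (simp only: X.add form_add form_sym[of "X y" "X x"] form_sym[of y x])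
  then have "2 * form (X x) (X y) = 2 * form x y"
    unfolding mult_2 by (simp add: * algebra_simps)
  then show ?thesis using two_nonzero by simp
qed

text \<open>Skewness followed by the isometry property gives
  \<open>form (X (X x)) y = - form x y\<close> for every \<open>y\<close>, and nondegeneracy removes
  the form.\<close>

lemma X_X: "X (X x) = - x"
proof -
  have "form (X (X x) + x) y = 0" for y
    by (simp add: form_add form_X_skew[of "X x"] form_X_X)
  then show ?thesis using form_nondegenerate by (simp add: eq_neg_iff_add_eq_0)
qed

lemma subspace_eigenspace: "subspace (eigenspace c)"
  unfolding eigenspace_def by (auto simp: subspace_def X.add X.scale X.zero scale_right_distrib mult.commute)

lemma span_eigenspace: "span (eigenspace c) = eigenspace c"
  using subspace_eigenspace by (rule span_eq_iff[THEN iffD2])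

lemma eigenspaces_Int: "eigenspace i \<inter> eigenspace (- i) = {0}"
proof -
  have "x = 0" if "X x = sc i x" "X x = sc (- i) x" for x
  proof -
    have "sc (i - - i) x = 0" using that by (simp only: scale_left_diff_distrib) simp
    then show ?thesis using i_neq_minus_i by (simp only: scale_eq_0_iff) auto
  qed
  then show ?thesis by (auto simp: eigenspace_def X.zero)
qed

text \<open>The operators (1 - \<open>i\<close> X)/2 and (1 + \<open>i\<close> X)/2 are the
  projections onto the two eigenspaces.\<close>

lemma eigenspaces_sum:
  obtains y z where "y \<in> eigenspace i" "z \<in> eigenspace (- i)" "x = y + z"
proof
  show "x = sc (1/2) (x - sc i (X x)) + sc (1/2) (x + sc i (X x))"
    using two_nonzero by (simp add: scale_right_distrib[symmetric]) (simp add: scale_left_distrib[symmetric] scale_right_distrib flip: mult_2)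
  show "sc (1/2) (x - sc i (X x)) \<in> eigenspace i"
    by (simp add: eigenspace_def X.scale X.diff X_X scale_right_diff_distrib scale_right_distrib i_times_i algebra_simps)
  show "sc (1/2) (x + sc i (X x)) \<in> eigenspace (- i)"
    by (simp add: eigenspace_def X.scale X.add X_X scale_right_diff_distrib scale_right_distrib i_times_i algebra_simps)
qed

text \<open>Applying \<open>X\<close> to both arguments leaves the form unchanged and also
  multiplies it by \<open>c ^ 2 = - 1\<close>, so the value equals its own negative.\<close>

lemma eigenspace_isotropic:
  assumes "c ^ 2 = - 1" "x \<in> eigenspace c" "y \<in> eigenspace c"
  shows "form x y = 0"
proof -
  have "form x y = c * (c * form x y)"
    using form_X_X[of x y] assms(2,3) by (simp add: eigenspace_def form_scale)
  also have "\<dots> = - form x y" using assms(1) by (simp add: mult.assoc[symmetric] power2_eq_square)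
  finally show ?thesis by (rule neg_eq_imp_zero)
qed

text \<open>The form identifies each eigenspace with a subspace of the dual of the other one.\<close>

lemma dim_eigenspace_le:
  assumes "c = i \<or> c = - i"
  shows "dim (eigenspace c) \<le> dim (eigenspace (- c))"
proof -
  have c2: "c ^ 2 = - 1" using assms square_i by auto
  obtain F where F: "F \<subseteq> eigenspace (- c)" "independent F" "eigenspace (- c) \<subseteq> span F"
    by (rule basis_exists)
  have finF: "finite F" using F(2) by (rule finiteI_independent)
  \<comment> \<open>\<open>T\<close> records the functional \<open>form v\<close> on the opposite
    eigenspace by using its values on the basis \<open>F\<close> as coefficients. A linear map
    between the two eigenspaces thus stands in for the map to the dual space.\<close>
  define T where "T v = (\<Sum>f\<in>F. sc (form v f) f)" for v
  have linT: "Vector_Spaces.linear sc sc T"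
    unfolding Vector_Spaces.linear_iff
    by (auto simp: T_def form_add form_scale scale_left_distrib sum.distrib scale_sum_right vector_space_axioms)
  interpret T: Vector_Spaces.linear sc sc T by fact
  interpret finite_dimensional_vector_space_pair_1 sc B sc ..
  have "inj_on T (eigenspace c)"
  proof (subst T.inj_on_iff_eq_0[OF subspace_eigenspace], intro ballI impI)
    fix v assume v: "v \<in> eigenspace c" "T v = 0"
    have 1: "form v f = 0" if "f \<in> F" for f
      using independentD[OF F(2) finF order_refl _ that, of "form v"] v(2) unfolding T_def by blast
    have 2: "form v y = 0" if "y \<in> eigenspace (- c)" for y
    proof -
      have "y \<in> span F" using that F(3) by blast
      then show ?thesis
      proof (induction rule: span_induct)
        case base
        have "form v 0 = 0" using form_scale(2)[of v 0 0] by simp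
        then show ?case by (auto simp: subspace_def form_add form_scale)
      qed (rule 1)
    qed
    \<comment> \<open>\<open>v\<close> is orthogonal to the opposite eigenspace because
      \<open>T v = 0\<close>, and to its own eigenspace by isotropy, hence to everything.\<close>
    have "form v x = 0" for x
    proof -
      obtain y z where "y \<in> eigenspace c" "z \<in> eigenspace (- c)" "x = y + z"
        using eigenspaces_sum[of x] assms by (metis add.commute minus_minus)
      then show ?thesis using 2 eigenspace_isotropic[OF c2 v(1)] by (simp add: form_add)
    qed
    then show "v = 0" by (rule form_nondegenerate)
  qed
  moreover have "T ` eigenspace c \<subseteq> eigenspace (- c)"
  proof (clarify)
    fix v show "T v \<in> eigenspace (- c)"
      unfolding T_def using F(1) by (intro subspace_sum[OF subspace_eigenspace] subspace_scale[OF subspace_eigenspace]) auto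
  qed
  ultimately show ?thesis
    using dim_subset[of "T ` eigenspace c" "eigenspace (- c)"]
      dim_image_eq[OF linT, of "eigenspace c", unfolded span_eigenspace] by linarith
qed

text \<open>The inequality for both eigenvalues makes the two dimensions equal, and they add up to
  \<open>2 * s\<close>.\<close>

lemma dim_eigenspace:
  assumes "c = i \<or> c = - i"
  shows "dim (eigenspace c) = s"
proof -
  have "{x + y |x y. x \<in> eigenspace i \<and> y \<in> eigenspace (- i)} = UNIV"
    using eigenspaces_sum by (auto intro!: set_eqI) metis
  moreover have "dim ({0} :: 'v set) = 0" by simp
  ultimately have "dim (eigenspace i) + dim (eigenspace (- i)) = 2 * s"
    using dim_sums_Int[OF subspace_eigenspace[of i] subspace_eigenspace[of "- i"]]
    by (simp only: eigenspaces_Int dim_UNIV_eq)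
  with dim_eigenspace_le[of i] dim_eigenspace_le[of "- i"] assms show ?thesis by auto
qed

text \<open>The basis is drawn from a prescribed spanning set \<open>S\<close>. Taking for
  \<open>S\<close> the homogeneous eigenvectors of a grading yields homogeneous bases in
  \<open>homogeneous_eigenbasis\<close>.\<close>

lemma indexed_basis_eigenspace:
  assumes c: "c = i \<or> c = - i" and spanning: "S \<subseteq> eigenspace c" "eigenspace c \<subseteq> span S"
  obtains v where "indexed_basis sc s v (eigenspace c)" "v ` {1..s} \<subseteq> S"
proof -
  obtain F where F: "F \<subseteq> S" "independent F" "S \<subseteq> span F"
    by (rule maximal_independent_subset)
  have "eigenspace c \<subseteq> span F" using spanning(2) span_minimal[OF F(3) subspace_span] by blast
  moreover have "span F \<subseteq> eigenspace c" using F(1) spanning(1) subspace_eigenspace by (intro span_minimal) auto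
  ultimately have span_F: "span F = eigenspace c" by blast
  have "finite F" using F(2) by (rule finiteI_independent)
  moreover have "card F = s"
    using dim_eigenspace[OF c] dim_eq_card[of F "eigenspace c", unfolded span_eigenspace, OF span_F F(2)]
    by linarith
  ultimately obtain v where "bij_betw v {1..s} F" using ex_bij_betw_nat_finite_1 by blast
  then have "inj_on v {1..s}" "v ` {1..s} = F" by (auto simp: bij_betw_def)
  then show thesis using that[of v] F span_F by (simp add: indexed_basis_def)
qed

lemma exists_indexed_basis_eigenspace:
  assumes "c = i \<or> c = - i"
  shows "\<exists>v. indexed_basis sc s v (eigenspace c)"
  using indexed_basis_eigenspace[OF assms order_refl span_superset] by blast

lemma indexed_basis_merge:
  assumes v: "indexed_basis sc s v (eigenspace i)" and w: "indexed_basis sc s w (eigenspace (- i))"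
  shows "indexed_basis sc (2 * s) (merge_bases s v w) UNIV"
proof -
  let ?u = "merge_bases s v w" and ?J = "{1..2 * s}"
  have vu: "v ` {1..s} \<subseteq> ?u ` ?J"
    by (intro image_subsetI image_eqI) (auto simp: merge_bases_def)
  have wu: "w ` {1..s} \<subseteq> ?u ` ?J"
  proof (intro image_subsetI)
    fix j assume "j \<in> {1..s}"
    then have "w j = ?u (s + j)" "s + j \<in> ?J" by (auto simp: merge_bases_def)
    then show "w j \<in> ?u ` ?J" by blast
  qed
  have "x \<in> span (?u ` ?J)" for x
  proof -
    obtain y z where "y \<in> eigenspace i" "z \<in> eigenspace (- i)" "x = y + z" by (rule eigenspaces_sum)
    moreover have "eigenspace i \<subseteq> span (?u ` ?J)" "eigenspace (- i) \<subseteq> span (?u ` ?J)"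
      using span_mono[OF vu] span_mono[OF wu] v w by (simp_all add: indexed_basis_def)
    ultimately show ?thesis by (auto intro: span_add)
  qed
  then have span_u: "span (?u ` ?J) = UNIV" by blast
  \<comment> \<open>A spanning set needs at least \<open>2 * s\<close> elements and the image has at
    most that many; equality gives both injectivity and independence.\<close>
  have "2 * s \<le> card (?u ` ?J)" using dim_le_card[of UNIV "?u ` ?J"] span_u dim_UNIV_eq by simp
  then have card_u: "card (?u ` ?J) = card ?J" using card_image_le[of ?J ?u] by simp
  then have "inj_on ?u ?J" by (intro eq_card_imp_inj_on) auto
  moreover have "independent (?u ` ?J)"
    using card_le_dim_spanning[of "?u ` ?J" UNIV] span_u card_u dim_UNIV_eq by simp
  ultimately show ?thesis using span_u by (simp add: indexed_basis_def)
qed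

definition eigenvalue :: "nat \<Rightarrow> 'f" where
  "eigenvalue j = (if j \<le> s then i else - i)"

lemma eigenbasis_merge:
  assumes v: "indexed_basis sc s v (eigenspace i)" and w: "indexed_basis sc s w (eigenspace (- i))"
  shows "eigenbasis sc (2 * s) (merge_bases s v w) X eigenvalue"
proof unfold_locales
  show "indexed_basis sc (2 * s) (merge_bases s v w) UNIV" by (rule indexed_basis_merge[OF v w])
  fix j assume j: "j \<in> {1..2 * s}"
  show "X (merge_bases s v w j) = sc (eigenvalue j) (merge_bases s v w j)"
  proof (cases "j \<le> s")
    case True
    with j have "v j \<in> span (v ` {1..s})" by (intro span_base) auto
    with True v show ?thesis by (simp add: indexed_basis_def merge_bases_def eigenvalue_def eigenspace_def)
  next
    case False
    with j have "w (j - s) \<in> span (w ` {1..s})" by (intro span_base imageI) auto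
    with False w show ?thesis by (simp add: indexed_basis_def merge_bases_def eigenvalue_def eigenspace_def)
  qed
qed

end

section \<open>Fine gradings\<close>

text \<open>The condition under the unique existence in \<open>direct_sum_decomposition\<close>,
  named so that uniqueness can be applied to explicit families.\<close>

definition decomposes :: "'i set \<Rightarrow> ('i \<Rightarrow> 'v set) \<Rightarrow> ('i \<Rightarrow> 'v) \<Rightarrow> 'v::ab_group_add \<Rightarrow> bool" where
  "decomposes I W f v \<longleftrightarrow> (\<forall>i\<in>I. f i \<in> W i) \<and> (\<forall>i. i \<notin> I \<longrightarrow> f i = 0) \<and>
     finite {i. f i \<noteq> 0} \<and> v = (\<Sum>i | f i \<noteq> 0. f i)"

context vector_space
begin

lemma direct_sum_decomposes:
  "direct_sum_decomposition scale I W \<longleftrightarrow>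
     (\<forall>i\<in>I. subspace (W i)) \<and> (\<forall>v. \<exists>!f. decomposes I W f v)"
  by (simp add: direct_sum_decomposition_def decomposes_def)

lemma decomposes_image:
  assumes "decomposes I W f v" "Vector_Spaces.linear scale scale T" "\<And>i. i \<in> I \<Longrightarrow> T ` W i \<subseteq> W i"
  shows "decomposes I W (\<lambda>i. T (f i)) (T v)"
proof -
  interpret T: Vector_Spaces.linear scale scale T by fact
  \<comment> \<open>\<open>T\<close> may kill components, so the sum over the old support has to be
    cut down to the new one.\<close>
  have sub: "{i. T (f i) \<noteq> 0} \<subseteq> {i. f i \<noteq> 0}" using T.zero by auto
  have fin: "finite {i. f i \<noteq> 0}" using assms(1) by (simp add: decomposes_def)
  have "T v = (\<Sum>i | f i \<noteq> 0. T (f i))" using assms(1) by (simp add: decomposes_def flip: T.sum)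
  also have "\<dots> = (\<Sum>i | T (f i) \<noteq> 0. T (f i))" by (rule sum.mono_neutral_right[OF fin sub]) auto
  finally have "T v = (\<Sum>i | T (f i) \<noteq> 0. T (f i))" .
  moreover have "T (f i) \<in> W i" if "i \<in> I" for i
    using assms(1) assms(3)[OF that] that unfolding decomposes_def by blast
  moreover have "T (f i) = 0" if "i \<notin> I" for i
    using assms(1) that T.zero by (simp add: decomposes_def)
  moreover have "finite {i. T (f i) \<noteq> 0}" using finite_subset[OF sub fin] .
  ultimately show ?thesis by (simp only: decomposes_def) blast
qed

lemma decomposes_single:
  assumes "i \<in> I" "v \<in> W i" "\<And>j. j \<in> I \<Longrightarrow> 0 \<in> W j"
  shows "decomposes I W (\<lambda>j. if j = i then v else 0) v"
proof -
  have "{j. (if j = i then v else 0) \<noteq> 0} = (if v = 0 then {} else {i})" by auto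
  then show ?thesis using assms by (auto simp: decomposes_def)
qed

text \<open>Decompose \<open>v\<close> in \<open>W' i\<close> along \<open>W\<close>. This is also a
  decomposition along \<open>W'\<close>, and so is \<open>v\<close> on its own in degree
  \<open>i\<close>; by uniqueness they agree, so \<open>v\<close> is its own component in
  \<open>W i\<close>.\<close>

lemma direct_sum_eqI:
  assumes "direct_sum_decomposition scale I W" "direct_sum_decomposition scale I W'"
    and le: "\<And>i. i \<in> I \<Longrightarrow> W i \<subseteq> W' i" and i: "i \<in> I"
  shows "W i = W' i"
proof
  show "W' i \<subseteq> W i"
  proof
    fix v assume v: "v \<in> W' i"
    obtain f where f: "decomposes I W f v" using assms(1) unfolding direct_sum_decomposes by blast
    then have "decomposes I W' f v" using le by (auto simp: decomposes_def)
    moreover have "decomposes I W' (\<lambda>j. if j = i then v else 0) v"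
      using i v assms(2) by (intro decomposes_single) (auto simp: direct_sum_decomposes subspace_0)
    ultimately have "f = (\<lambda>j. if j = i then v else 0)"
      using assms(2) unfolding direct_sum_decomposes by blast
    then have "f i = v" by simp
    moreover have "f i \<in> W i" using f i by (simp add: decomposes_def)
    ultimately show "v \<in> W i" by simp
  qed
qed (rule le[OF i])

end

text \<open>Provides an abelian group structure on all of \<open>nat\<close>, so that any natural
  numbers can serve as degrees; every element is its own inverse.\<close>

lemma comm_group_xor: "comm_group \<lparr>carrier = UNIV, monoid.mult = (xor :: nat \<Rightarrow> nat \<Rightarrow> nat), one = 0\<rparr>" (is "comm_group ?G")
proof (rule comm_groupI)
  show "\<exists>y\<in>carrier ?G. y \<otimes>\<^bsub>?G\<^esub> x = \<one>\<^bsub>?G\<^esub>" for x by (auto intro!: exI[of _ x])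
qed (auto simp: xor.assoc xor.commute xor.left_commute)

section \<open>Eigenlines refining an arbitrary grading\<close>

context cross_product_space
begin

text \<open>Let \<open>f\<close> be the family of components of an eigenvector \<open>v\<close>.
  Since each homogeneous component of the grading is \<open>X\<close>-invariant,
  \<open>X (f g)\<close> and \<open>sc c (f g)\<close> are both the components of
  \<open>X v = sc c v\<close>, hence equal: the components of an eigenvector are
  eigenvectors.\<close>

lemma eigenspace_spanned_by_homogeneous:
  assumes "grading sc X G \<Delta>"
  shows "eigenspace c \<subseteq> span (\<Union>g\<in>carrier G. \<Delta> g \<inter> eigenspace c)"
proof
  fix v assume v: "v \<in> eigenspace c"
  have ds: "direct_sum_decomposition sc (carrier G) \<Delta>"
    and X\<Delta>: "\<And>g. g \<in> carrier G \<Longrightarrow> X ` \<Delta> g \<subseteq> \<Delta> g"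
    using assms by (auto simp: grading_def)
  then obtain f where f: "decomposes (carrier G) \<Delta> f v" unfolding direct_sum_decomposes by blast
  have "decomposes (carrier G) \<Delta> (\<lambda>g. X (f g)) (X v)"
    by (rule decomposes_image[OF f linear_X X\<Delta>])
  moreover have "decomposes (carrier G) \<Delta> (\<lambda>g. sc c (f g)) (sc c v)"
    using ds by (intro decomposes_image[OF f linear_scale_self]) (auto simp: direct_sum_decomposes subspace_scale)
  ultimately have "(\<lambda>g. X (f g)) = (\<lambda>g. sc c (f g))"
    using ds v unfolding direct_sum_decomposes eigenspace_def by auto
  then have "f g \<in> eigenspace c" for g by (auto simp: eigenspace_def dest: fun_cong)
  then have "f g \<in> span (\<Union>g\<in>carrier G. \<Delta> g \<inter> eigenspace c)" for g
    using f span_zero by (cases "g \<in> carrier G") (auto simp: decomposes_def intro!: span_base)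
  moreover have "v = (\<Sum>g | f g \<noteq> 0. f g)" using f by (simp add: decomposes_def)
  ultimately show "v \<in> span (\<Union>g\<in>carrier G. \<Delta> g \<inter> eigenspace c)"
    by (metis (no_types, lifting) span_sum)
qed

lemma homogeneous_eigenbasis:
  assumes "grading sc X G \<Delta>"
  obtains v w \<gamma> where "indexed_basis sc s v (eigenspace i)" "indexed_basis sc s w (eigenspace (- i))"
    "\<gamma> ` {1..2 * s} \<subseteq> carrier G" "\<And>j. j \<in> {1..2 * s} \<Longrightarrow> merge_bases s v w j \<in> \<Delta> (\<gamma> j)"
proof -
  obtain v where v: "indexed_basis sc s v (eigenspace i)"
      "v ` {1..s} \<subseteq> (\<Union>g\<in>carrier G. \<Delta> g \<inter> eigenspace i)"
    by (rule indexed_basis_eigenspace[OF _ _ eigenspace_spanned_by_homogeneous[OF assms, of i]]) auto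
  obtain w where w: "indexed_basis sc s w (eigenspace (- i))"
      "w ` {1..s} \<subseteq> (\<Union>g\<in>carrier G. \<Delta> g \<inter> eigenspace (- i))"
    by (rule indexed_basis_eigenspace[OF _ _ eigenspace_spanned_by_homogeneous[OF assms, of "- i"]]) auto
  have "\<exists>g\<in>carrier G. merge_bases s v w j \<in> \<Delta> g" if "j \<in> {1..2 * s}" for j
  proof (cases "j \<le> s")
    case True
    with that have "v j \<in> v ` {1..s}" by (intro imageI) auto
    with v(2) True show ?thesis unfolding merge_bases_def by auto
  next
    case False
    with that have "w (j - s) \<in> w ` {1..s}" by (intro imageI) auto
    with w(2) False show ?thesis unfolding merge_bases_def by auto
  qed
  then obtain \<gamma> where "\<forall>j\<in>{1..2 * s}. \<gamma> j \<in> carrier G \<and> merge_bases s v w j \<in> \<Delta> (\<gamma> j)" by metis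
  then show thesis using that[OF v(1) w(1), of \<gamma>] by blast
qed

text \<open>The lines of a homogeneous eigenbasis \<open>u'\<close> refine \<Delta>, so fineness
  reduces each component containing a basis vector to a line. The linear map carrying
  \<open>u'\<close> to \<open>u\<close> is then the equivalence.\<close>

lemma fine_equivalent_bases_grading:
  assumes fine: "fine_grading TYPE(nat) sc X G \<Delta>"
    and v: "indexed_basis sc s v (eigenspace i)" and w: "indexed_basis sc s w (eigenspace (- i))"
  shows "equivalent_gradings sc X G \<Delta> (free_Abelian_group {1..2 * s}) (bases_grading sc s v w)"
proof -
  have gr: "grading sc X G \<Delta>" using fine by (simp add: fine_grading_def)
  then have sub: "subspace (\<Delta> g)" if "g \<in> carrier G" for g
    using that by (simp add: grading_def direct_sum_decomposes)
  obtain v' w' \<gamma> where v': "indexed_basis sc s v' (eigenspace i)" and w': "indexed_basis sc s w' (eigenspace (- i))"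
    and \<gamma>: "\<gamma> ` {1..2 * s} \<subseteq> carrier G" "\<And>j. j \<in> {1..2 * s} \<Longrightarrow> merge_bases s v' w' j \<in> \<Delta> (\<gamma> j)"
    using homogeneous_eigenbasis[OF gr] by blast
  define u' where "u' = merge_bases s v' w'"
  define u where "u = merge_bases s v w"
  interpret u': eigenbasis sc "2 * s" u' X eigenvalue unfolding u'_def by (rule eigenbasis_merge[OF v' w'])
  interpret u: eigenbasis sc "2 * s" u X eigenvalue unfolding u_def by (rule eigenbasis_merge[OF v w])
  have \<gamma>': "u' j \<in> \<Delta> (\<gamma> j)" "\<gamma> j \<in> carrier G" if "j \<in> {1..2 * s}" for j
    using \<gamma> that by (auto simp: u'_def)
  have span_le: "span {u' j} \<subseteq> \<Delta> (\<gamma> j)" if "j \<in> {1..2 * s}" for j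
    using \<gamma>'[OF that] sub by (intro span_minimal) auto
  \<comment> \<open>The line of \<open>u' j\<close> gets its index \<open>j\<close> as degree, which
    keeps distinct lines in distinct degrees.\<close>
  define H :: "nat monoid" where "H = \<lparr>carrier = UNIV, monoid.mult = xor, one = 0\<rparr>"
  have id_line: "u'.lines_grading id j = span {u' j}" if "j \<in> {1..2 * s}" for j
    using u'.lines_grading_degree[of id j] that by simp
  have "grading sc X H (u'.lines_grading id)"
    using comm_group_xor by (intro u'.grading_lines) (auto simp: H_def)
  moreover have "refines H (u'.lines_grading id) G \<Delta>"
    unfolding refines_def
  proof
    fix h
    show "\<exists>g\<in>carrier G. u'.lines_grading id h \<subseteq> \<Delta> g"
    proof (cases "h \<in> {1..2 * s}")
      case True
      then have "u'.lines_grading id h \<subseteq> \<Delta> (\<gamma> h)" by (simp only: id_line span_le)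
      with \<gamma>'(2)[OF True] show ?thesis by blast
    next
      case False
      \<comment> \<open>The remaining labels carry the zero space, which lies in every component,
        for instance in that of the unit of \<open>G\<close>.\<close>
      then have "u'.lines_grading id h = {0}" by (intro u'.lines_grading_empty) simp
      moreover have "\<one>\<^bsub>G\<^esub> \<in> carrier G" using gr by (auto simp: grading_def intro: comm_groupE(2))
      ultimately show ?thesis using subspace_0[OF sub] by (intro bexI[of _ "\<one>\<^bsub>G\<^esub>"]) simp_all
    qed
  qed
  ultimately have not_proper: "\<not> (\<exists>h\<in>carrier H. \<exists>g\<in>carrier G. u'.lines_grading id h \<noteq> {0} \<and> u'.lines_grading id h \<subset> \<Delta> g)"
    using fine unfolding fine_grading_def properly_refines_def by blast
  \<comment> \<open>A nonzero line inside \<open>\<Delta> (\<gamma> j)\<close> that is not strictly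
    inside must be all of it.\<close>
  have line: "\<Delta> (\<gamma> j) = span {u' j}" if "j \<in> {1..2 * s}" for j
  proof -
    have "j \<in> carrier H" by (simp add: H_def)
    with not_proper \<gamma>'(2)[OF that] have "\<not> (span {u' j} \<noteq> {0} \<and> span {u' j} \<subset> \<Delta> (\<gamma> j))"
      unfolding id_line[OF that, symmetric] by blast
    with span_le[OF that] u'.line_nonzero[OF that] show ?thesis by blast
  qed
  \<comment> \<open>The spans of the vectors of \<open>u'\<close> of each degree already decompose
    the whole space, so no component of \<Delta> can be larger. In particular every nonzero
    component has a degree of the form \<open>\<gamma> j\<close>.\<close>
  have comp: "\<Delta> g = u'.lines_grading \<gamma> g" if "g \<in> carrier G" for g
  proof (rule direct_sum_eqI[symmetric, OF u'.direct_sum_span_degree[OF \<gamma>(1)]])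
    show "direct_sum_decomposition sc (carrier G) \<Delta>" using gr by (simp add: grading_def)
    show "u'.lines_grading \<gamma> h \<subseteq> \<Delta> h" if "h \<in> carrier G" for h
      using \<gamma>' by (intro span_minimal sub[OF that]) auto
  qed (rule that)
  define \<phi> where "\<phi> = u'.extend_linearly u"
  interpret \<phi>: Vector_Spaces.linear sc sc \<phi> unfolding \<phi>_def by (rule u'.linear_extend_linearly)
  \<comment> \<open>\<open>u' j\<close> and \<open>u j\<close> have the same eigenvalue for each
    \<open>j\<close>, since both families list the basis of V+ before that of V-.\<close>
  have "(\<phi> \<circ> X) x = (X \<circ> \<phi>) x" for x
    by (rule u'.linear_eqI[OF Vector_Spaces.linear_compose[OF linear_X \<phi>.linear_axioms]
          Vector_Spaces.linear_compose[OF \<phi>.linear_axioms linear_X]])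
      (simp add: u'.eigenvector u.eigenvector \<phi>.scale, simp add: \<phi>_def u.eigenvector)
  moreover have "bij \<phi>" unfolding \<phi>_def by (rule u'.bij_extend_linearly[OF u.basis])
  ultimately have "\<phi> \<in> carrier (Aut_group sc X)" by (simp add: Aut_group_def \<phi>.linear_axioms)
  moreover have "\<exists>h\<in>carrier (free_Abelian_group {1..2 * s}). \<phi> ` \<Delta> g = bases_grading sc s v w h"
    if g: "g \<in> carrier G" "\<Delta> g \<noteq> {0}" for g
  proof -
    obtain j where j: "j \<in> {1..2 * s}" "g = \<gamma> j"
      using g(2) u'.lines_grading_empty[of g \<gamma>] unfolding comp[OF g(1)] by blast
    have "\<phi> ` \<Delta> g = span {u j}"
      using j by (simp add: line flip: \<phi>.span_image) (simp add: \<phi>_def)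
    also have "\<dots> = bases_grading sc s v w (frag_of j)"
      unfolding bases_grading_eq_lines
      using u.lines_grading_degree[of frag_of j] j(1) by (simp add: u_def inj_on_def frag_of_eq)
    finally show ?thesis using j(1) by (intro bexI[of _ "frag_of j"]) auto
  qed
  ultimately show ?thesis unfolding equivalent_gradings_def by blast
qed

lemma fine_bases_grading:
  assumes v: "indexed_basis sc s v (eigenspace i)" and w: "indexed_basis sc s w (eigenspace (- i))"
  shows "fine_grading TYPE('h) sc X (free_Abelian_group {1..2 * s}) (bases_grading sc s v w)"
proof -
  interpret u: eigenbasis sc "2 * s" "merge_bases s v w" X eigenvalue by (rule eigenbasis_merge[OF v w])
  show ?thesis
    unfolding bases_grading_eq_lines[abs_def]
    by (intro u.fine_lines abelian_free_Abelian_group) (auto simp: inj_on_def frag_of_eq)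
qed

end

section \<open>The Weyl group\<close>

lemma BijGroup_UNIV_mult: "bij f \<Longrightarrow> bij g \<Longrightarrow> f \<otimes>\<^bsub>BijGroup UNIV\<^esub> g = f \<circ> g"
  by (simp add: BijGroup_def Bij_def compose_def o_def restrict_UNIV)

lemma (in vector_space) linear_inv:
  assumes "Vector_Spaces.linear scale scale \<phi>" "bij \<phi>"
  shows "Vector_Spaces.linear scale scale (inv' \<phi>)"
proof -
  interpret \<phi>: Vector_Spaces.linear scale scale \<phi> by fact
  have "inj \<phi>" "surj \<phi>" using assms(2) by (auto simp: bij_def)
  then have "inv' \<phi> (x + y) = inv' \<phi> x + inv' \<phi> y" "inv' \<phi> (scale c x) = scale c (inv' \<phi> x)" for x y c
    by (auto intro!: inv_f_eq simp: \<phi>.add \<phi>.scale surj_f_inv_f)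
  then show ?thesis using vector_space_axioms by (simp add: Vector_Spaces.linear_iff)
qed

lemma group_Aut_grading:
  assumes "vector_space sc"
  shows "group (Aut_grading sc X G \<Gamma>)"
proof -
  interpret vector_space sc by fact
  define C where "C = nonzero_components G \<Gamma>"
  define H where "H = {\<phi>. Vector_Spaces.linear sc sc \<phi> \<and> bij \<phi> \<and> (\<forall>v. \<phi> (X v) = X (\<phi> v)) \<and> bij_betw (image \<phi>) C C}"
  have "subgroup H (BijGroup UNIV)"
  proof (rule group.subgroupI[OF group_BijGroup])
    show "H \<subseteq> carrier (BijGroup UNIV)" by (auto simp: H_def BijGroup_def Bij_def)
    have "image id = (id :: 'a set \<Rightarrow> 'a set)" by (auto simp: fun_eq_iff)
    then have "id \<in> H" using linear_id bij_betw_id[of C] by (simp add: H_def)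
    then show "H \<noteq> {}" by blast
    show "f \<otimes>\<^bsub>BijGroup UNIV\<^esub> g \<in> H" if "f \<in> H" "g \<in> H" for f g
    proof -
      have "image (f \<circ> g) = image f \<circ> image g" by (auto simp: fun_eq_iff)
      then have "bij_betw (image (f \<circ> g)) C C"
        using that bij_betw_trans[of "image g" C C "image f" C] by (simp add: H_def)
      then show ?thesis
        using that Vector_Spaces.linear_compose[of sc sc g sc f] by (simp add: H_def BijGroup_UNIV_mult bij_comp)
    qed
    show "inv\<^bsub>BijGroup UNIV\<^esub> f \<in> H" if "f \<in> H" for f
    proof -
      have f: "bij f" "Vector_Spaces.linear sc sc f" "\<And>v. f (X v) = X (f v)" "bij_betw (image f) C C"
        using that by (auto simp: H_def)
      have "inv\<^bsub>BijGroup UNIV\<^esub> f = inv' f" using f(1) by (subst inv_BijGroup) (auto simp: Bij_def)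
      moreover have "inv' f (X v) = X (inv' f v)" for v
        using f by (metis bij_inv_eq_iff)
      moreover have "bij_betw (image (inv' f)) C C"
      proof (rule bij_betw_byWitness[where f' = "image f"])
        show "\<forall>W\<in>C. f ` inv' f ` W = W" "\<forall>W\<in>C. inv' f ` f ` W = W"
          using f(1) by (simp_all add: image_f_inv_f image_inv_f_f bij_def)
        show "image f ` C \<subseteq> C" using f(4) by (simp add: bij_betw_def)
        \<comment> \<open>Surjectivity of \<open>image f\<close> on \<open>C\<close> exhibits each
          component as the image of another one, to which the inverse carries it back.\<close>
        show "image (inv' f) ` C \<subseteq> C"
        proof
          fix W assume "W \<in> image (inv' f) ` C"
          then obtain W' where "W' \<in> C" "W = inv' f ` W'" by blast
          moreover then obtain W'' where "W'' \<in> C" "W' = f ` W''" using f(4) unfolding bij_betw_def by blast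
          ultimately show "W \<in> C" using f(1) by (simp add: image_inv_f_f bij_def)
        qed
      qed
      ultimately show ?thesis using f linear_inv[OF f(2,1)] by (simp add: H_def bij_imp_bij_inv)
    qed
  qed
  moreover have "Aut_grading sc X G \<Gamma> = (BijGroup UNIV)\<lparr>carrier := H\<rparr>"
    by (auto simp: Aut_grading_def Aut_group_def H_def C_def)
  ultimately show ?thesis by (simp add: subgroup.subgroup_is_group group_BijGroup)
qed

section \<open>Permutations of the eigenlines preserving two blocks of indices\<close>

locale two_eigenvalue_basis = eigenbasis sc "2 * s" u X "\<lambda>j. if j \<le> s then a else b"
  for sc :: "'f::field \<Rightarrow> 'v::ab_group_add \<Rightarrow> 'v" and s :: nat and u :: "nat \<Rightarrow> 'v"
    and X :: "'v \<Rightarrow> 'v" and a b :: 'f +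
  assumes distinct: "a \<noteq> b"
begin

lemma line_inj:
  assumes "span {u j} = span {u k}" "j \<in> {1..2 * s}" "k \<in> {1..2 * s}"
  shows "j = k"
proof -
  have "u j \<in> span {u k}" using assms(1) span_base[of "u j" "{u j}"] by simp
  then obtain c where "u j = sc c (u k)" by (rule span_lineE)
  then have "coord j (u j) = c * coord j (u k)" by (simp only: coord_scale)
  with assms(2,3) show ?thesis by (simp split: if_splits)
qed

text \<open>The action of Sym_s \<times> Sym_s on the indices of the merged basis.\<close>

definition block_perm :: "(nat \<Rightarrow> nat) \<times> (nat \<Rightarrow> nat) \<Rightarrow> nat \<Rightarrow> nat" where
  "block_perm pq j = (if j \<le> s then fst pq j else s + snd pq (j - s))"

abbreviation block_perms :: "((nat \<Rightarrow> nat) \<times> (nat \<Rightarrow> nat)) monoid" where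
  "block_perms \<equiv> sym_group s \<times>\<times> sym_group s"

lemma block_perm_low:
  assumes "pq \<in> carrier block_perms" "j \<in> {1..2 * s}" "j \<le> s"
  shows "block_perm pq j \<in> {1..s}"
proof -
  have "fst pq permutes {1..s}" using assms(1) by (auto simp: DirProd_def sym_group_def)
  moreover have "j \<in> {1..s}" using assms by simp
  ultimately have "fst pq j \<in> {1..s}" by (simp only: permutes_in_image)
  then show ?thesis using assms(3) by (simp add: block_perm_def)
qed

lemma block_perm_high:
  assumes "pq \<in> carrier block_perms" "j \<in> {1..2 * s}" "\<not> j \<le> s"
  shows "block_perm pq j \<in> {s<..2 * s}"
proof -
  have "snd pq permutes {1..s}" using assms(1) by (auto simp: DirProd_def sym_group_def)
  moreover have "j - s \<in> {1..s}" using assms by auto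
  ultimately have "snd pq (j - s) \<in> {1..s}" by (simp only: permutes_in_image)
  then show ?thesis using assms(3) by (simp add: block_perm_def)
qed

lemma block_perm_in: "pq \<in> carrier block_perms \<Longrightarrow> j \<in> {1..2 * s} \<Longrightarrow> block_perm pq j \<in> {1..2 * s}"
  using block_perm_low[of pq j] block_perm_high[of pq j] by (cases "j \<le> s") auto

lemma block_perm_le: "pq \<in> carrier block_perms \<Longrightarrow> j \<in> {1..2 * s} \<Longrightarrow> block_perm pq j \<le> s \<longleftrightarrow> j \<le> s"
  using block_perm_low[of pq j] block_perm_high[of pq j] by (cases "j \<le> s") auto

lemma block_perm_mult:
  assumes "pq \<in> carrier block_perms" "pq' \<in> carrier block_perms" "j \<in> {1..2 * s}"
  shows "block_perm (pq \<otimes>\<^bsub>block_perms\<^esub> pq') j = block_perm pq (block_perm pq' j)"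
  using block_perm_le[OF assms(2,3)]
  by (cases pq; cases pq') (auto simp: block_perm_def DirProd_def sym_group_def split: if_splits)

text \<open>Elements of \<open>sym_group s\<close> are functions on all of \<open>nat\<close> that
  are the identity outside \<open>{1..s}\<close>, so the action on the indices determines both of
  them everywhere.\<close>

lemma block_perm_eqI:
  assumes "pq \<in> carrier block_perms" "pq' \<in> carrier block_perms"
    and eq: "\<And>j. j \<in> {1..2 * s} \<Longrightarrow> block_perm pq j = block_perm pq' j"
  shows "pq = pq'"
proof (rule prod_eqI)
  have perm: "fst pq permutes {1..s}" "fst pq' permutes {1..s}" "snd pq permutes {1..s}" "snd pq' permutes {1..s}"
    using assms(1,2) by (auto simp: DirProd_def sym_group_def)
  show "fst pq = fst pq'"
  proof
    fix j show "fst pq j = fst pq' j"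
    proof (cases "j \<in> {1..s}")
      case True
      then show ?thesis using eq[of j] by (simp add: block_perm_def)
    qed (simp only: perm[THEN permutes_not_in] not_False_eq_True)
  qed
  show "snd pq = snd pq'"
  proof
    fix j show "snd pq j = snd pq' j"
    proof (cases "j \<in> {1..s}")
      case True
      then show ?thesis using eq[of "s + j"] by (simp add: block_perm_def)
    qed (simp only: perm[THEN permutes_not_in] not_False_eq_True)
  qed
qed

lemma block_perm_exists:
  assumes inj: "inj_on \<sigma> {1..2 * s}" and in_J: "\<sigma> ` {1..2 * s} \<subseteq> {1..2 * s}"
    and le: "\<And>j. j \<in> {1..2 * s} \<Longrightarrow> \<sigma> j \<le> s \<longleftrightarrow> j \<le> s"
  obtains pq where "pq \<in> carrier block_perms" "\<And>j. j \<in> {1..2 * s} \<Longrightarrow> block_perm pq j = \<sigma> j"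
proof -
  \<comment> \<open>Being the identity outside \<open>{1..s}\<close> is what \<open>permutes\<close>
    demands. The subtraction in \<open>q\<close> is exact, because \<sigma> keeps the upper block
    above \<open>s\<close>.\<close>
  define p where "p j = (if j \<in> {1..s} then \<sigma> j else j)" for j
  define q where "q j = (if j \<in> {1..s} then \<sigma> (s + j) - s else j)" for j
  have \<sigma>: "\<sigma> j \<in> {1..2 * s}" if "j \<in> {1..2 * s}" for j using in_J that by blast
  have low: "\<sigma> j \<in> {1..s}" if "j \<in> {1..s}" for j
    using \<sigma>[of j] le[of j] that by auto
  have high: "\<sigma> (s + j) \<in> {s + 1..2 * s}" if "j \<in> {1..s}" for j
    using \<sigma>[of "s + j"] le[of "s + j"] that by auto
  have "inj_on p {1..s}"
  proof (rule inj_onI)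
    fix x y assume "x \<in> {1..s}" "y \<in> {1..s}" "p x = p y"
    then show "x = y" using inj_onD[OF inj, of x y] by (simp add: p_def)
  qed
  moreover have "p ` {1..s} \<subseteq> {1..s}" using low by (auto simp: p_def)
  ultimately have "p ` {1..s} = {1..s}" by (intro endo_inj_surj) auto
  with \<open>inj_on p {1..s}\<close> have "p permutes {1..s}" by (intro bij_imp_permutes) (auto simp: bij_betw_def p_def)
  moreover have "inj_on q {1..s}"
  proof (rule inj_onI)
    fix x y assume xy: "x \<in> {1..s}" "y \<in> {1..s}" "q x = q y"
    then have "\<sigma> (s + x) - s = \<sigma> (s + y) - s" by (simp add: q_def)
    with high[OF xy(1)] high[OF xy(2)] have "\<sigma> (s + x) = \<sigma> (s + y)" by auto
    then show "x = y" using inj_onD[OF inj, of "s + x" "s + y"] xy by simp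
  qed
  moreover have "q ` {1..s} \<subseteq> {1..s}"
  proof (intro image_subsetI)
    fix j assume "j \<in> {1..s}"
    with high[OF this] show "q j \<in> {1..s}" by (auto simp: q_def)
  qed
  ultimately have "p permutes {1..s}" "q permutes {1..s}"
    using endo_inj_surj[of "{1..s}" q] by (auto intro!: bij_imp_permutes simp: bij_betw_def q_def)
  then have "(p, q) \<in> carrier block_perms" by (simp add: DirProd_def sym_group_def)
  moreover have "block_perm (p, q) j = \<sigma> j" if j: "j \<in> {1..2 * s}" for j
  proof (cases "j \<le> s")
    case True
    with j show ?thesis by (simp add: block_perm_def p_def)
  next
    case False
    with j have "j - s \<in> {1..s}" "s + (j - s) = j" by auto
    with high[of "j - s"] False show ?thesis by (simp add: block_perm_def q_def)
  qed
  ultimately show thesis by (rule that)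
qed

definition permutes_lines :: "('v \<Rightarrow> 'v) \<Rightarrow> (nat \<Rightarrow> nat) \<times> (nat \<Rightarrow> nat) \<Rightarrow> bool" where
  "permutes_lines \<phi> pq \<longleftrightarrow>
     pq \<in> carrier block_perms \<and> (\<forall>j\<in>{1..2 * s}. \<phi> ` span {u j} = span {u (block_perm pq j)})"

text \<open>The described pair is unique if it exists, because distinct indices give distinct lines
  (\<open>line_inj\<close>).\<close>

definition line_perm :: "('v \<Rightarrow> 'v) \<Rightarrow> (nat \<Rightarrow> nat) \<times> (nat \<Rightarrow> nat)" where
  "line_perm \<phi> = (THE pq. permutes_lines \<phi> pq)"

lemma line_perm_eqI:
  assumes "permutes_lines \<phi> pq" shows "line_perm \<phi> = pq"
  unfolding line_perm_def
proof (rule the_equality[of "permutes_lines \<phi>", OF assms])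
  fix pq' assume pq': "permutes_lines \<phi> pq'"
  show "pq' = pq"
  proof (rule block_perm_eqI)
    fix j assume "j \<in> {1..2 * s}"
    then show "block_perm pq' j = block_perm pq j"
      using assms pq' by (intro line_inj block_perm_in) (auto simp: permutes_lines_def)
  qed (use assms pq' in \<open>auto simp: permutes_lines_def\<close>)
qed

text \<open>A map commuting with \<open>X\<close> keeps the eigenvalue of each line it moves; as
  \<open>a\<close> differs from \<open>b\<close>, the induced permutation of indices respects the
  two blocks.\<close>

lemma Aut_permutes_lines:
  assumes \<phi>: "Vector_Spaces.linear sc sc \<phi>" "bij \<phi>" "\<And>v. \<phi> (X v) = X (\<phi> v)"
    and lines: "\<And>j. j \<in> {1..2 * s} \<Longrightarrow> \<phi> ` span {u j} \<in> (\<lambda>k. span {u k}) ` {1..2 * s}"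
  obtains pq where "permutes_lines \<phi> pq"
proof -
  interpret \<phi>: Vector_Spaces.linear sc sc \<phi> by (fact \<phi>)
  interpret X: Vector_Spaces.linear sc sc X by (fact linear_X)
  have "\<forall>j\<in>{1..2 * s}. \<exists>k. k \<in> {1..2 * s} \<and> \<phi> ` span {u j} = span {u k}" using lines by blast
  then obtain \<sigma> where \<sigma>: "\<And>j. j \<in> {1..2 * s} \<Longrightarrow> \<sigma> j \<in> {1..2 * s} \<and> \<phi> ` span {u j} = span {u (\<sigma> j)}"
    unfolding bchoice_iff by blast
  have "inj_on \<sigma> {1..2 * s}"
  proof (rule inj_onI)
    fix j k assume jk: "j \<in> {1..2 * s}" "k \<in> {1..2 * s}" "\<sigma> j = \<sigma> k"
    then have "\<phi> ` span {u j} = \<phi> ` span {u k}" using \<sigma> by simp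
    then have "span {u j} = span {u k}" using \<phi>(2) by (simp add: inj_image_eq_iff bij_def)
    with jk show "j = k" by (intro line_inj)
  qed
  moreover have "\<sigma> ` {1..2 * s} \<subseteq> {1..2 * s}" using \<sigma> by blast
  moreover have "\<sigma> j \<le> s \<longleftrightarrow> j \<le> s" if j: "j \<in> {1..2 * s}" for j
  proof -
    let ?c = "\<lambda>j. if j \<le> s then a else b"
    have "\<phi> (u j) \<in> span {u (\<sigma> j)}" using \<sigma>[OF j] span_base[of "u j" "{u j}"] by blast
    then obtain c where c: "\<phi> (u j) = sc c (u (\<sigma> j))" by (rule span_lineE)
    have "inj \<phi>" using \<phi>(2) by (simp add: bij_def)
    then have "\<phi> (u j) \<noteq> 0" using u_nonzero[OF j] by (metis \<phi>.zero injD)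
    have "sc (?c (\<sigma> j)) (\<phi> (u j)) = X (\<phi> (u j))"
      using \<sigma>[OF j] by (simp add: c X.scale eigenvector mult.commute)
    also have "\<dots> = sc (?c j) (\<phi> (u j))" unfolding \<phi>(3)[symmetric] eigenvector[OF j] \<phi>.scale ..
    finally have "?c (\<sigma> j) = ?c j" using \<open>\<phi> (u j) \<noteq> 0\<close> by (simp only: scale_cancel_right) simp
    then show ?thesis using distinct by (auto split: if_splits)
  qed
  ultimately obtain pq where "pq \<in> carrier block_perms" "\<And>j. j \<in> {1..2 * s} \<Longrightarrow> block_perm pq j = \<sigma> j"
    using block_perm_exists[of \<sigma>] by blast
  with \<sigma> show thesis by (intro that[of pq]) (simp add: permutes_lines_def)
qed

text \<open>Permuting basis vectors of equal eigenvalue commutes with \<open>X\<close>. This gives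
  surjectivity of \<open>line_perm\<close>.\<close>

lemma extend_linearly_permutes_lines:
  assumes pq: "pq \<in> carrier block_perms"
  shows "\<exists>\<phi>. \<phi> \<in> carrier (Aut_group sc X) \<and> permutes_lines \<phi> pq"
proof -
  define \<phi> where "\<phi> = extend_linearly (\<lambda>j. u (block_perm pq j))"
  interpret \<phi>: Vector_Spaces.linear sc sc \<phi> unfolding \<phi>_def by (rule linear_extend_linearly)
  have "inj_on (block_perm pq) {1..2 * s}"
  proof (rule inj_onI)
    fix x y assume xy: "x \<in> {1..2 * s}" "y \<in> {1..2 * s}" "block_perm pq x = block_perm pq y"
    have perm: "inj (fst pq)" "inj (snd pq)"
      using pq by (auto simp: DirProd_def sym_group_def intro: permutes_inj)
    have "x \<le> s \<longleftrightarrow> y \<le> s" using block_perm_le[OF pq] xy by metis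
    with xy perm show "x = y" by (auto simp: block_perm_def inj_eq split: if_splits)
  qed
  then have bij: "bij_betw (block_perm pq) {1..2 * s} {1..2 * s}"
    using endo_inj_surj[of "{1..2 * s}" "block_perm pq"] block_perm_in[OF pq]
    by (simp add: bij_betw_def image_subset_iff)
  then have im: "(\<lambda>j. u (block_perm pq j)) ` {1..2 * s} = u ` {1..2 * s}"
    by (metis bij_betw_imp_surj_on image_image)
  have "inj_on (\<lambda>j. u (block_perm pq j)) {1..2 * s}"
    using comp_inj_on[of "block_perm pq" "{1..2 * s}" u] bij inj_u by (simp add: bij_betw_def o_def)
  then have "indexed_basis sc (2 * s) (\<lambda>j. u (block_perm pq j)) UNIV"
    using basis unfolding indexed_basis_def im by blast
  then have "bij \<phi>" unfolding \<phi>_def by (rule bij_extend_linearly)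
  moreover have "(\<phi> \<circ> X) x = (X \<circ> \<phi>) x" for x
  proof (rule linear_eqI[OF Vector_Spaces.linear_compose[OF linear_X \<phi>.linear_axioms]
          Vector_Spaces.linear_compose[OF \<phi>.linear_axioms linear_X]])
    fix j assume j: "j \<in> {1..2 * s}"
    then show "(\<phi> \<circ> X) (u j) = (X \<circ> \<phi>) (u j)"
      using eigenvector[OF block_perm_in[OF pq j]] block_perm_le[OF pq j]
      by (simp add: eigenvector \<phi>.scale) (simp add: \<phi>_def)
  qed
  ultimately have "\<phi> \<in> carrier (Aut_group sc X)" by (simp add: Aut_group_def \<phi>.linear_axioms)
  moreover have "\<phi> ` span {u j} = span {u (block_perm pq j)}" if "j \<in> {1..2 * s}" for j
    using that by (simp flip: \<phi>.span_image) (simp add: \<phi>_def)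
  ultimately show ?thesis using pq unfolding permutes_lines_def by blast
qed

text \<open>First isomorphism theorem for \<open>line_perm\<close>: it is onto Sym_s \<times> Sym_s,
  and its kernel consists of the automorphisms that fix every line.\<close>

lemma Weyl_group_lines:
  assumes d: "inj_on d {1..2 * s}" "d ` {1..2 * s} \<subseteq> carrier G"
  shows "Weyl_group sc X G (lines_grading d) \<cong> sym_group s \<times>\<times> sym_group s"
proof -
  define C where "C = (\<lambda>j. span {u j}) ` {1..2 * s}"
  let ?A = "Aut_grading sc X G (lines_grading d)"
  have C: "nonzero_components G (lines_grading d) = C"
    unfolding C_def by (rule nonzero_components_lines[OF d])
  have carrier_A: "carrier ?A = {\<phi> \<in> carrier (Aut_group sc X). bij_betw (image \<phi>) C C}"
    unfolding Aut_grading_def C by simp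
  have mult_A: "\<phi> \<otimes>\<^bsub>?A\<^esub> \<psi> = \<phi> \<circ> \<psi>" if "\<phi> \<in> carrier ?A" "\<psi> \<in> carrier ?A" for \<phi> \<psi>
    using that unfolding carrier_A by (simp add: Aut_grading_def Aut_group_def BijGroup_UNIV_mult)
  have perm: "permutes_lines \<phi> (line_perm \<phi>)" if \<phi>: "\<phi> \<in> carrier ?A" for \<phi>
  proof -
    obtain pq where "permutes_lines \<phi> pq"
    proof (rule Aut_permutes_lines[of \<phi>])
      show "\<phi> ` span {u j} \<in> (\<lambda>k. span {u k}) ` {1..2 * s}" if "j \<in> {1..2 * s}" for j
        using that \<phi> unfolding carrier_A C_def by (auto dest!: bij_betw_apply)
    next
      show "Vector_Spaces.linear sc sc \<phi>" "bij \<phi>" "\<phi> (X v) = X (\<phi> v)" for v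
        using \<phi> unfolding carrier_A by (auto simp: Aut_group_def)
    qed
    then show ?thesis using line_perm_eqI by metis
  qed
  interpret A: group ?A by (rule group_Aut_grading[OF vector_space_axioms])
  interpret S: group block_perms by (intro DirProd_group sym_group_is_group)
  interpret group_hom ?A block_perms line_perm
  proof (unfold_locales, rule homI)
    show "line_perm \<phi> \<in> carrier block_perms" if "\<phi> \<in> carrier ?A" for \<phi>
      using perm[OF that] by (simp add: permutes_lines_def)
    show "line_perm (\<phi> \<otimes>\<^bsub>?A\<^esub> \<psi>) = line_perm \<phi> \<otimes>\<^bsub>block_perms\<^esub> line_perm \<psi>"
      if \<phi>: "\<phi> \<in> carrier ?A" and \<psi>: "\<psi> \<in> carrier ?A" for \<phi> \<psi>
    proof (rule line_perm_eqI, unfold permutes_lines_def, intro conjI ballI)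
      have in_S: "line_perm \<phi> \<in> carrier block_perms" "line_perm \<psi> \<in> carrier block_perms"
        using perm \<phi> \<psi> by (auto simp: permutes_lines_def)
      then show "line_perm \<phi> \<otimes>\<^bsub>block_perms\<^esub> line_perm \<psi> \<in> carrier block_perms" by (rule S.m_closed)
      fix j assume j: "j \<in> {1..2 * s}"
      show "(\<phi> \<otimes>\<^bsub>?A\<^esub> \<psi>) ` span {u j} = span {u (block_perm (line_perm \<phi> \<otimes>\<^bsub>block_perms\<^esub> line_perm \<psi>) j)}"
        using perm[OF \<phi>] perm[OF \<psi>] j block_perm_in[OF in_S(2) j]
        unfolding mult_A[OF \<phi> \<psi>] block_perm_mult[OF in_S j] image_comp[symmetric] permutes_lines_def by metis
    qed
  qed
  have "line_perm ` carrier ?A = carrier block_perms"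
  proof
    show "carrier block_perms \<subseteq> line_perm ` carrier ?A"
    proof
      fix pq assume pq: "pq \<in> carrier block_perms"
      then obtain \<phi> where \<phi>: "\<phi> \<in> carrier (Aut_group sc X)" "permutes_lines \<phi> pq"
        using extend_linearly_permutes_lines by blast
      \<comment> \<open>The map induced on the finite set of lines is injective, hence a bijection,
        as membership in \<open>Aut_grading\<close> requires.\<close>
      have "image \<phi> ` C \<subseteq> C" using \<phi>(2) block_perm_in[OF pq] by (auto simp: C_def permutes_lines_def)
      moreover have "inj_on (image \<phi>) C"
        using \<phi>(1) by (auto simp: Aut_group_def inj_on_def bij_def inj_image_eq_iff)
      moreover have "finite C" by (simp add: C_def)
      ultimately have "bij_betw (image \<phi>) C C" using endo_inj_surj[of C "image \<phi>"] by (simp add: bij_betw_def)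
      with \<phi>(1) have "\<phi> \<in> carrier ?A" unfolding carrier_A by simp
      with line_perm_eqI[OF \<phi>(2)] show "pq \<in> line_perm ` carrier ?A" by blast
    qed
  qed (rule image_subsetI, rule hom_closed)
  then have "?A Mod kernel ?A block_perms line_perm \<cong> block_perms" by (rule FactGroup_iso)
  moreover have "kernel ?A block_perms line_perm = Stab_grading sc X G (lines_grading d)"
  proof -
    have one: "\<one>\<^bsub>block_perms\<^esub> = (id, id)" by (simp add: DirProd_def sym_group_def)
    have block_id: "block_perm (id, id) j = j" if "j \<in> {1..2 * s}" for j by (simp add: block_perm_def)
    have "\<phi> ` W = W" if "\<phi> \<in> carrier ?A" "line_perm \<phi> = (id, id)" "W \<in> C" for \<phi> W
      using perm[OF that(1)] that(2,3) block_id by (auto simp: permutes_lines_def C_def)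
    moreover have "\<phi> \<in> carrier ?A \<and> line_perm \<phi> = (id, id)"
      if "\<phi> \<in> carrier (Aut_group sc X)" "\<forall>W\<in>C. \<phi> ` W = W" for \<phi>
    proof
      \<comment> \<open>On \<open>C\<close> the map \<open>image \<phi>\<close> agrees with the
        identity, so stabilizing every line already puts \<phi> into
        \<open>Aut_grading\<close>.\<close>
      have "bij_betw (image \<phi>) C C \<longleftrightarrow> bij_betw id C C" using that(2) by (intro bij_betw_cong) simp
      with that(1) show "\<phi> \<in> carrier ?A" unfolding carrier_A by simp
      have "permutes_lines \<phi> (id, id)"
        using that(2) S.one_closed unfolding one by (simp add: permutes_lines_def C_def block_id)
      then show "line_perm \<phi> = (id, id)" by (rule line_perm_eqI)
    qed
    moreover have "carrier ?A \<subseteq> carrier (Aut_group sc X)" unfolding carrier_A by blast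
    ultimately show ?thesis
      unfolding kernel_def Stab_grading_def C one by (intro equalityI subsetI CollectI conjI ballI) auto
  qed
  ultimately show ?thesis by (simp add: Weyl_group_def)
qed

end

section \<open>Points of the group algebra scheme\<close>

locale comm_algebra_type =
  fixes A :: "('f::field, 'r) module" (structure)
  assumes comm_algebra: "comm_algebra A"
begin

sublocale algebra "ring_of_type_algebra :: 'f ring" A
  using comm_algebra by (simp add: comm_algebra_def)

text \<open>This and the following lemmas trade the operations of the record
  \<open>ring_of_type_algebra\<close> for those of the type \<open>'f\<close>.\<close>

lemma smult_in [simp]: "a \<in> carrier A \<Longrightarrow> c \<odot> a \<in> carrier A"
  using smult_closed[of c a] by (simp add: ring_of_type_algebra_def)

lemma smult_add_left: "a \<in> carrier A \<Longrightarrow> (c + d) \<odot> a = c \<odot> a \<oplus> d \<odot> a"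
  using smult_l_distr[of c d a] by (simp add: ring_of_type_algebra_def)

lemma smult_add_right: "a \<in> carrier A \<Longrightarrow> b \<in> carrier A \<Longrightarrow> c \<odot> (a \<oplus> b) = c \<odot> a \<oplus> c \<odot> b"
  using smult_r_distr[of c a b] by (simp add: ring_of_type_algebra_def)

lemma smult_smult: "a \<in> carrier A \<Longrightarrow> (c * d) \<odot> a = c \<odot> (d \<odot> a)"
  using smult_assoc1[of c d a] by (simp add: ring_of_type_algebra_def)

lemma smult_1 [simp]: "a \<in> carrier A \<Longrightarrow> 1 \<odot> a = a"
  using smult_one[of a] by (simp add: ring_of_type_algebra_def)

lemma smult_0 [simp]: "a \<in> carrier A \<Longrightarrow> 0 \<odot> a = \<zero>"
  using smult_l_null[of a] by (simp add: ring_of_type_algebra_def)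

lemma smult_zero [simp]: "c \<odot> \<zero> = \<zero>"
  using smult_r_null[of c] by (simp add: ring_of_type_algebra_def)

lemma smult_mult_left: "a \<in> carrier A \<Longrightarrow> b \<in> carrier A \<Longrightarrow> (c \<odot> a) \<otimes> b = c \<odot> (a \<otimes> b)"
  using smult_assoc2[of c a b] by (simp add: ring_of_type_algebra_def)

lemma smult_mult_right: "a \<in> carrier A \<Longrightarrow> b \<in> carrier A \<Longrightarrow> a \<otimes> (c \<odot> b) = c \<odot> (a \<otimes> b)"
  using smult_mult_left[of b a c] by (simp add: m_comm)

lemma smult_left_commute: "a \<in> carrier A \<Longrightarrow> c \<odot> (d \<odot> a) = d \<odot> (c \<odot> a)"
  using smult_smult[of a c d] smult_smult[of a d c] by (simp add: mult.commute)

lemma smult_finsum: "finite S \<Longrightarrow> f \<in> S \<rightarrow> carrier A \<Longrightarrow> c \<odot> finsum A f S = finsum A (\<lambda>x. c \<odot> f x) S"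
  using finsum_smult_ldistr[of S c f] by (simp add: ring_of_type_algebra_def)

end

lemma lookup_smult_map: "Poly_Mapping.lookup (Poly_Mapping.map (\<lambda>x. c * x) p) u = c * Poly_Mapping.lookup p u"
  for c :: "'f::field"
  by (simp add: Poly_Mapping.map.rep_eq when_def)

lemma poly_mapping_expand:
  "p = (\<Sum>u\<in>Poly_Mapping.keys p. Poly_Mapping.single u (Poly_Mapping.lookup p u))"
  by (rule poly_mapping_eqI) (simp add: lookup_sum lookup_single when_def in_keys_iff)

locale group_algebra_point = comm_algebra_type A + U: comm_group U
  for A :: "('f::field, 'r) module" (structure) and U :: "'u monoid"
begin

abbreviation FU :: "('f, 'u \<Rightarrow>\<^sub>0 'f) module" where "FU \<equiv> group_algebra U"

lemma carrier_FU: "carrier FU = {p. Poly_Mapping.keys p \<subseteq> carrier U}"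
  and add_FU: "p \<oplus>\<^bsub>FU\<^esub> q = p + q"
  and one_FU: "\<one>\<^bsub>FU\<^esub> = Poly_Mapping.single \<one>\<^bsub>U\<^esub> 1"
  and smult_FU: "c \<odot>\<^bsub>FU\<^esub> p = Poly_Mapping.map (\<lambda>x. c * x) p"
  and mult_FU: "p \<otimes>\<^bsub>FU\<^esub> q = (\<Sum>u\<in>Poly_Mapping.keys p. \<Sum>v\<in>Poly_Mapping.keys q.
        Poly_Mapping.single (u \<otimes>\<^bsub>U\<^esub> v) (Poly_Mapping.lookup p u * Poly_Mapping.lookup q v))"
  by (simp_all add: group_algebra_def)

lemma single_FU: "u \<in> carrier U \<Longrightarrow> Poly_Mapping.single u c \<in> carrier FU"
  by (simp add: carrier_FU)

lemma smult_single: "c \<odot>\<^bsub>FU\<^esub> Poly_Mapping.single u d = Poly_Mapping.single u (c * d)"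
  unfolding smult_FU by (rule poly_mapping_eqI) (simp add: lookup_smult_map lookup_single when_def)

lemma mult_single:
  "Poly_Mapping.single u c \<otimes>\<^bsub>FU\<^esub> Poly_Mapping.single v d = Poly_Mapping.single (u \<otimes>\<^bsub>U\<^esub> v) (c * d)"
  unfolding mult_FU by (cases "c = 0"; cases "d = 0") auto

text \<open>The linear extension of a character \<open>h\<close> to the group algebra, restricted to
  the carrier so that equality of points is equality of functions.\<close>

definition eval_hom :: "('u \<Rightarrow> 'r) \<Rightarrow> ('u \<Rightarrow>\<^sub>0 'f) \<Rightarrow> 'r" where
  "eval_hom h = (\<lambda>p\<in>carrier FU. \<Oplus>u\<in>Poly_Mapping.keys p. Poly_Mapping.lookup p u \<odot> h u)"

text \<open>Coefficients of a sum may cancel, so \<open>p\<close>, \<open>q\<close> and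
  \<open>p + q\<close> have different supports; a common finite index set makes the three sums
  comparable.\<close>

lemma eval_hom_superset:
  assumes h: "h \<in> carrier U \<rightarrow> carrier A"
    and S: "finite S" "Poly_Mapping.keys p \<subseteq> S" "S \<subseteq> carrier U"
  shows "eval_hom h p = (\<Oplus>u\<in>S. Poly_Mapping.lookup p u \<odot> h u)"
proof -
  have "p \<in> carrier FU" using S by (simp add: carrier_FU)
  then have "eval_hom h p = (\<Oplus>u\<in>Poly_Mapping.keys p. Poly_Mapping.lookup p u \<odot> h u)"
    by (simp add: eval_hom_def)
  also have "\<dots> = (\<Oplus>u\<in>S. Poly_Mapping.lookup p u \<odot> h u)"
    by (rule add.finprod_mono_neutral_cong_left) (use S h in \<open>auto simp: in_keys_iff Pi_iff\<close>)
  finally show ?thesis .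
qed

lemma eval_hom_closed [simp]:
  "h \<in> carrier U \<rightarrow> carrier A \<Longrightarrow> p \<in> carrier FU \<Longrightarrow> eval_hom h p \<in> carrier A"
  unfolding eval_hom_def by (auto simp: carrier_FU Pi_iff intro!: finsum_closed)

lemma eval_hom_single:
  assumes "h \<in> carrier U \<rightarrow> carrier A" "u \<in> carrier U"
  shows "eval_hom h (Poly_Mapping.single u c) = c \<odot> h u"
  using assms eval_hom_superset[of h "{u}" "Poly_Mapping.single u c"]
  by (auto simp: Pi_iff)

lemma eval_hom_zero: "h \<in> carrier U \<rightarrow> carrier A \<Longrightarrow> eval_hom h 0 = \<zero>"
  using eval_hom_superset[of h "{}" 0] by simp

lemma eval_hom_add:
  assumes h: "h \<in> carrier U \<rightarrow> carrier A" and p: "p \<in> carrier FU" and q: "q \<in> carrier FU"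
  shows "eval_hom h (p + q) = eval_hom h p \<oplus> eval_hom h q"
proof -
  let ?S = "Poly_Mapping.keys p \<union> Poly_Mapping.keys q"
  have S: "finite ?S" "?S \<subseteq> carrier U" using p q by (auto simp: carrier_FU)
  then have hS: "h u \<in> carrier A" if "u \<in> ?S" for u using h that by blast
  have "eval_hom h (p + q) = (\<Oplus>u\<in>?S. Poly_Mapping.lookup (p + q) u \<odot> h u)"
    using S keys_add[of p q] by (intro eval_hom_superset[OF h]) auto
  also have "\<dots> = (\<Oplus>u\<in>?S. Poly_Mapping.lookup p u \<odot> h u \<oplus> Poly_Mapping.lookup q u \<odot> h u)"
    using hS by (intro finsum_cong') (auto simp: lookup_add smult_add_left)
  also have "\<dots> = (\<Oplus>u\<in>?S. Poly_Mapping.lookup p u \<odot> h u) \<oplus> (\<Oplus>u\<in>?S. Poly_Mapping.lookup q u \<odot> h u)"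
    using hS by (intro finsum_addf) auto
  also have "\<dots> = eval_hom h p \<oplus> eval_hom h q"
    using S eval_hom_superset[OF h S(1) _ S(2), of p] eval_hom_superset[OF h S(1) _ S(2), of q] by simp
  finally show ?thesis .
qed

lemma sum_in_FU: "(\<And>x. x \<in> S \<Longrightarrow> f x \<in> carrier FU) \<Longrightarrow> sum f S \<in> carrier FU"
proof (induction S rule: infinite_finite_induct)
  case (insert x S)
  then show ?case using keys_add[of "f x" "sum f S"] by (auto simp: carrier_FU)
qed (auto simp: carrier_FU)

text \<open>Formulated for any additive map, since it serves both \<open>eval_hom\<close> and an
  arbitrary point of the scheme.\<close>

lemma additive_sum:
  assumes "\<alpha> \<in> carrier FU \<rightarrow> carrier A" "\<alpha> 0 = \<zero>"
    "\<And>p q. p \<in> carrier FU \<Longrightarrow> q \<in> carrier FU \<Longrightarrow> \<alpha> (p + q) = \<alpha> p \<oplus> \<alpha> q"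
    and S: "finite S" "\<And>x. x \<in> S \<Longrightarrow> f x \<in> carrier FU"
  shows "\<alpha> (sum f S) = (\<Oplus>x\<in>S. \<alpha> (f x))"
  using S
proof (induction S rule: finite_induct)
  case (insert x S)
  then have "\<alpha> (sum f (insert x S)) = \<alpha> (f x) \<oplus> (\<Oplus>y\<in>S. \<alpha> (f y))"
    by (simp add: assms(3) sum_in_FU)
  also have "\<dots> = (\<Oplus>y\<in>insert x S. \<alpha> (f y))"
    using insert assms(1) by (intro finsum_insert[symmetric]) auto
  finally show ?case .
qed (simp add: assms(2))

lemma eval_hom_smult:
  assumes h: "h \<in> carrier U \<rightarrow> carrier A" and p: "p \<in> carrier FU"
  shows "eval_hom h (c \<odot>\<^bsub>FU\<^esub> p) = c \<odot> eval_hom h p"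
proof -
  have S: "Poly_Mapping.keys p \<subseteq> carrier U" using p by (simp add: carrier_FU)
  then have hS: "h u \<in> carrier A" if "u \<in> Poly_Mapping.keys p" for u using h that by blast
  have "eval_hom h (c \<odot>\<^bsub>FU\<^esub> p) = (\<Oplus>u\<in>Poly_Mapping.keys p. (c * Poly_Mapping.lookup p u) \<odot> h u)"
    using S by (subst eval_hom_superset[OF h, of "Poly_Mapping.keys p"])
      (auto simp: smult_FU lookup_smult_map in_keys_iff)
  also have "\<dots> = (\<Oplus>u\<in>Poly_Mapping.keys p. c \<odot> (Poly_Mapping.lookup p u \<odot> h u))"
    using hS by (intro finsum_cong') (auto simp: smult_smult)
  also have "\<dots> = c \<odot> (\<Oplus>u\<in>Poly_Mapping.keys p. Poly_Mapping.lookup p u \<odot> h u)"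
    using hS by (intro smult_finsum[symmetric]) auto
  also have "\<dots> = c \<odot> eval_hom h p" using p by (simp add: eval_hom_def)
  finally show ?thesis .
qed

text \<open>Both sides expand to a double sum over pairs of support elements, where multiplicativity
  of \<open>h\<close> applies term by term.\<close>

lemma eval_hom_mult:
  assumes h: "h \<in> carrier U \<rightarrow> carrier A"
    and hm: "\<And>u v. u \<in> carrier U \<Longrightarrow> v \<in> carrier U \<Longrightarrow> h (u \<otimes>\<^bsub>U\<^esub> v) = h u \<otimes> h v"
    and p: "p \<in> carrier FU" and q: "q \<in> carrier FU"
  shows "eval_hom h (p \<otimes>\<^bsub>FU\<^esub> q) = eval_hom h p \<otimes> eval_hom h q"
proof -
  let ?P = "Poly_Mapping.keys p" and ?Q = "Poly_Mapping.keys q"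
  let ?p = "Poly_Mapping.lookup p" and ?q = "Poly_Mapping.lookup q"
  have S: "?P \<subseteq> carrier U" "?Q \<subseteq> carrier U" using p q by (auto simp: carrier_FU)
  then have hP: "h u \<in> carrier A" if "u \<in> ?P" for u using h that by blast
  have hQ: "h u \<in> carrier A" if "u \<in> ?Q" for u using h S that by blast
  have in_FU: "Poly_Mapping.single (u \<otimes>\<^bsub>U\<^esub> v) c \<in> carrier FU" if "u \<in> ?P" "v \<in> ?Q" for u v c
    using that S by (intro single_FU U.m_closed) auto
  note additive = additive_sum[of "eval_hom h", OF _ eval_hom_zero[OF h] eval_hom_add[OF h]]
  have "eval_hom h (p \<otimes>\<^bsub>FU\<^esub> q) = (\<Oplus>u\<in>?P. \<Oplus>v\<in>?Q. eval_hom h (Poly_Mapping.single (u \<otimes>\<^bsub>U\<^esub> v) (?p u * ?q v)))"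
    unfolding mult_FU using h in_FU
    by (subst additive) (auto intro!: sum_in_FU finsum_cong' additive finsum_closed)
  also have "\<dots> = (\<Oplus>u\<in>?P. \<Oplus>v\<in>?Q. (?p u \<odot> h u) \<otimes> (?q v \<odot> h v))"
  proof (intro finsum_cong' refl)
    fix u v assume uv: "u \<in> ?P" "v \<in> ?Q"
    have uv': "u \<in> carrier U" "v \<in> carrier U" using uv S by auto
    show "eval_hom h (Poly_Mapping.single (u \<otimes>\<^bsub>U\<^esub> v) (?p u * ?q v)) = (?p u \<odot> h u) \<otimes> (?q v \<odot> h v)"
      using uv' hP[OF uv(1)] hQ[OF uv(2)]
      by (simp add: eval_hom_single[OF h] hm smult_mult_left smult_mult_right smult_smult smult_left_commute[of _ "?p u"])
  qed (use hP hQ in \<open>auto intro!: finsum_closed\<close>)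
  also have "\<dots> = (\<Oplus>u\<in>?P. (?p u \<odot> h u) \<otimes> (\<Oplus>v\<in>?Q. ?q v \<odot> h v))"
    using hP hQ by (intro finsum_cong' refl finsum_rdistr[symmetric]) (auto intro!: finsum_closed)
  also have "\<dots> = (\<Oplus>u\<in>?P. ?p u \<odot> h u) \<otimes> (\<Oplus>v\<in>?Q. ?q v \<odot> h v)"
    using hP hQ by (intro finsum_ldistr[symmetric]) (auto intro!: finsum_closed)
  also have "\<dots> = eval_hom h p \<otimes> eval_hom h q" using p q by (simp add: eval_hom_def)
  finally show ?thesis .
qed

lemma eval_hom_in_points:
  assumes h: "h \<in> hom U (units_of A)"
  shows "eval_hom h \<in> carrier (group_algebra_points U A)"
proof -
  have hU: "h u \<in> Units A" if "u \<in> carrier U" for u using h that by (auto simp: hom_def units_of_carrier)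
  then have hA: "h \<in> carrier U \<rightarrow> carrier A" by auto
  have hm: "h (u \<otimes>\<^bsub>U\<^esub> v) = h u \<otimes> h v" if "u \<in> carrier U" "v \<in> carrier U" for u v
    using h that by (simp add: hom_def units_of_mult)
  have "h \<one>\<^bsub>U\<^esub> = \<one>"
    using hom_one[OF h U.is_group units_group] by (simp add: units_of_one)
  then show ?thesis
    using hA by (auto simp: group_algebra_points_def alg_homs_def ring_hom_def one_FU eval_hom_single
      add_FU eval_hom_add eval_hom_mult[OF hA hm] eval_hom_smult) (auto simp: eval_hom_def)
qed

lemma point_props:
  assumes "\<alpha> \<in> carrier (group_algebra_points U A)"
  shows "\<alpha> \<in> carrier FU \<rightarrow> carrier A" "\<alpha> \<in> extensional (carrier FU)"
    "p \<in> carrier FU \<Longrightarrow> q \<in> carrier FU \<Longrightarrow> \<alpha> (p + q) = \<alpha> p \<oplus> \<alpha> q"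
    "p \<in> carrier FU \<Longrightarrow> q \<in> carrier FU \<Longrightarrow> \<alpha> (p \<otimes>\<^bsub>FU\<^esub> q) = \<alpha> p \<otimes> \<alpha> q"
    "\<alpha> (Poly_Mapping.single \<one>\<^bsub>U\<^esub> 1) = \<one>"
    "p \<in> carrier FU \<Longrightarrow> \<alpha> (c \<odot>\<^bsub>FU\<^esub> p) = c \<odot> \<alpha> p"
  using assms by (auto simp: group_algebra_points_def alg_homs_def ring_hom_def one_FU add_FU)

text \<open>An element of \<open>U\<close> is invertible in the group algebra, its inverse being the
  inverse in \<open>U\<close>, so a point sends it to a unit.\<close>

lemma point_restrict_hom:
  assumes \<alpha>: "\<alpha> \<in> carrier (group_algebra_points U A)"
  shows "(\<lambda>u. \<alpha> (Poly_Mapping.single u 1)) \<in> hom U (units_of A)"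
proof (rule homI)
  have mult: "\<alpha> (Poly_Mapping.single u 1) \<otimes> \<alpha> (Poly_Mapping.single v 1) = \<alpha> (Poly_Mapping.single (u \<otimes>\<^bsub>U\<^esub> v) 1)"
    if "u \<in> carrier U" "v \<in> carrier U" for u v
    using that point_props(4)[OF \<alpha>, of "Poly_Mapping.single u 1" "Poly_Mapping.single v 1"]
    by (simp add: single_FU mult_single)
  then show "\<alpha> (Poly_Mapping.single (u \<otimes>\<^bsub>U\<^esub> v) 1) =
      \<alpha> (Poly_Mapping.single u 1) \<otimes>\<^bsub>units_of A\<^esub> \<alpha> (Poly_Mapping.single v 1)"
    if "u \<in> carrier U" "v \<in> carrier U" for u v
    using that by (simp add: units_of_mult)
  show "\<alpha> (Poly_Mapping.single u 1) \<in> carrier (units_of A)" if u: "u \<in> carrier U" for u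
  proof -
    have "\<alpha> (Poly_Mapping.single u 1) \<in> carrier A" "\<alpha> (Poly_Mapping.single (inv\<^bsub>U\<^esub> u) 1) \<in> carrier A"
      using point_props(1)[OF \<alpha>] u by (auto intro: single_FU)
    then show ?thesis
      using mult[of u "inv\<^bsub>U\<^esub> u"] mult[of "inv\<^bsub>U\<^esub> u" u] u
      by (auto simp: units_of_carrier Units_def point_props(5)[OF \<alpha>])
  qed
qed

text \<open>The elements of \<open>U\<close> span the group algebra, so a point is the linear
  extension of its own character.\<close>

lemma eval_hom_point:
  assumes \<alpha>: "\<alpha> \<in> carrier (group_algebra_points U A)"
  shows "eval_hom (\<lambda>u. \<alpha> (Poly_Mapping.single u 1)) = \<alpha>"
proof (rule extensionalityI)
  show "\<alpha> \<in> extensional (carrier FU)" by (rule point_props(2)[OF \<alpha>])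
  show "eval_hom (\<lambda>u. \<alpha> (Poly_Mapping.single u 1)) \<in> extensional (carrier FU)" by (simp add: eval_hom_def)
  fix p assume p: "p \<in> carrier FU"
  then have in_FU: "Poly_Mapping.single u c \<in> carrier FU" if "u \<in> Poly_Mapping.keys p" for u c
    using that by (intro single_FU) (auto simp: carrier_FU)
  \<comment> \<open>Preservation of zero comes from additivity, by cancelling in
    \<open>A\<close>.\<close>
  have "\<alpha> 0 \<oplus> \<alpha> 0 = \<alpha> 0" using point_props(3)[OF \<alpha>, of 0 0] by (simp add: carrier_FU)
  moreover have "\<alpha> 0 \<in> carrier A" using point_props(1)[OF \<alpha>] by (auto simp: carrier_FU)
  ultimately have zero: "\<alpha> 0 = \<zero>" by (metis add.l_cancel_one)
  have "\<alpha> p = \<alpha> (\<Sum>u\<in>Poly_Mapping.keys p. Poly_Mapping.single u (Poly_Mapping.lookup p u))"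
    by (rule arg_cong[OF poly_mapping_expand])
  also have "\<dots> = (\<Oplus>u\<in>Poly_Mapping.keys p. \<alpha> (Poly_Mapping.single u (Poly_Mapping.lookup p u)))"
    by (rule additive_sum[of \<alpha>, OF point_props(1)[OF \<alpha>] zero point_props(3)[OF \<alpha>]]) (auto intro: in_FU)
  also have "\<dots> = (\<Oplus>u\<in>Poly_Mapping.keys p. Poly_Mapping.lookup p u \<odot> \<alpha> (Poly_Mapping.single u 1))"
  proof (intro finsum_cong' refl)
    fix u assume u: "u \<in> Poly_Mapping.keys p"
    show "\<alpha> (Poly_Mapping.single u (Poly_Mapping.lookup p u)) = Poly_Mapping.lookup p u \<odot> \<alpha> (Poly_Mapping.single u 1)"
      using point_props(6)[OF \<alpha> in_FU[OF u, of 1], of "Poly_Mapping.lookup p u"] by (simp add: smult_single)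
  qed (use point_props(1)[OF \<alpha>] in_FU in \<open>auto simp: Pi_iff\<close>)
  finally show "eval_hom (\<lambda>u. \<alpha> (Poly_Mapping.single u 1)) p = \<alpha> p" using p by (simp add: eval_hom_def)
qed

lemma eval_hom_cong:
  assumes "\<And>u. u \<in> carrier U \<Longrightarrow> h u = h' u" "h \<in> carrier U \<rightarrow> carrier A"
  shows "eval_hom h = eval_hom h'"
proof (rule ext)
  fix p
  show "eval_hom h p = eval_hom h' p"
  proof (cases "p \<in> carrier FU")
    case True
    have "h' \<in> carrier U \<rightarrow> carrier A" using assms by (metis Pi_cong)
    with True assms show ?thesis
      unfolding eval_hom_def carrier_FU by (auto intro!: finsum_cong' simp: Pi_iff)
  qed (simp add: eval_hom_def)
qed

text \<open>The comultiplication duplicates each element of \<open>U\<close>, so the product of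
  points corresponds to the pointwise product of characters.\<close>

lemma mult_points:
  assumes h: "h \<in> carrier U \<rightarrow> carrier A" and h': "h' \<in> carrier U \<rightarrow> carrier A"
  shows "eval_hom h \<otimes>\<^bsub>group_algebra_points U A\<^esub> eval_hom h' = eval_hom (\<lambda>u. h u \<otimes> h' u)"
proof (rule extensionalityI[of _ "carrier FU"])
  fix p assume p: "p \<in> carrier FU"
  then have S: "u \<in> carrier U" if "u \<in> Poly_Mapping.keys p" for u using that by (auto simp: carrier_FU)
  then have hS: "h u \<in> carrier A" "h' u \<in> carrier A" if "u \<in> Poly_Mapping.keys p" for u
    using that h h' by auto
  have "(\<Oplus>u\<in>Poly_Mapping.keys p. Poly_Mapping.lookup p u \<odot>
      (eval_hom h (Poly_Mapping.single u 1) \<otimes> eval_hom h' (Poly_Mapping.single u 1))) =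
    (\<Oplus>u\<in>Poly_Mapping.keys p. Poly_Mapping.lookup p u \<odot> (h u \<otimes> h' u))"
    using S hS by (intro finsum_cong') (auto simp: eval_hom_single[OF h] eval_hom_single[OF h'])
  then show "(eval_hom h \<otimes>\<^bsub>group_algebra_points U A\<^esub> eval_hom h') p = eval_hom (\<lambda>u. h u \<otimes> h' u) p"
    using p by (simp add: group_algebra_points_def eval_hom_def[of "\<lambda>u. h u \<otimes> h' u"])
qed (simp_all add: group_algebra_points_def eval_hom_def)

end

lemma hom_free_Abelian_group_eqI:
  assumes h: "h \<in> hom (free_Abelian_group S) G" "h' \<in> hom (free_Abelian_group S) G" and "group G"
    and eq: "\<And>x. x \<in> S \<Longrightarrow> h (frag_of x) = h' (frag_of x)"
    and x: "x \<in> carrier (free_Abelian_group S)"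
  shows "h x = h' x"
proof -
  interpret h: group_hom "free_Abelian_group S" G h using h(1) \<open>group G\<close> by (simp add: group_hom_def group_hom_axioms_def)
  interpret h': group_hom "free_Abelian_group S" G h' using h(2) \<open>group G\<close> by (simp add: group_hom_def group_hom_axioms_def)
  have "Poly_Mapping.keys x \<subseteq> S" using x by simp
  then show ?thesis
  proof (rule free_Abelian_group_induct)
    show "h 0 = h' 0" using h.hom_one h'.hom_one by simp
  next
    fix x y :: "'a \<Rightarrow>\<^sub>0 int" assume *: "Poly_Mapping.keys x \<subseteq> S" "Poly_Mapping.keys y \<subseteq> S" "h x = h' x" "h y = h' y"
    then have x': "x \<in> carrier (free_Abelian_group S)" and y': "y \<in> carrier (free_Abelian_group S)" by simp_all
    \<comment> \<open>The induction on the free abelian group steps through differences, so the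
      group law has to be written with an inverse.\<close>
    have "x - y = x \<otimes>\<^bsub>free_Abelian_group S\<^esub> inv\<^bsub>free_Abelian_group S\<^esub> y" using * by simp
    moreover have "h (x \<otimes>\<^bsub>free_Abelian_group S\<^esub> inv\<^bsub>free_Abelian_group S\<^esub> y) = h x \<otimes>\<^bsub>G\<^esub> inv\<^bsub>G\<^esub> h y"
      using h.hom_mult[OF x' h.G.inv_closed[OF y']] h.hom_inv[OF y'] by metis
    moreover have "h' (x \<otimes>\<^bsub>free_Abelian_group S\<^esub> inv\<^bsub>free_Abelian_group S\<^esub> y) = h' x \<otimes>\<^bsub>G\<^esub> inv\<^bsub>G\<^esub> h' y"
      using h'.hom_mult[OF x' h.G.inv_closed[OF y']] h'.hom_inv[OF y'] by metis
    ultimately show "h (x - y) = h' (x - y)" using * by metis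
  qed (rule eq)
qed

section \<open>Points of the group algebra of a free abelian group as families of units\<close>

context comm_algebra_type
begin

abbreviation unit_families :: "'i set \<Rightarrow> ('i \<Rightarrow> 'r) monoid" where
  "unit_families J \<equiv> product_group J (\<lambda>_. units_of A)"

abbreviation torus_points :: "'i set \<Rightarrow> ((('i \<Rightarrow>\<^sub>0 int) \<Rightarrow>\<^sub>0 'f) \<Rightarrow> 'r) monoid" where
  "torus_points J \<equiv> group_algebra_points (free_Abelian_group J) A"

text \<open>Freeness determines this homomorphism on the carrier; its values elsewhere are arbitrary
  and never enter \<open>eval_hom\<close>.\<close>

definition character :: "'i set \<Rightarrow> ('i \<Rightarrow> 'r) \<Rightarrow> ('i \<Rightarrow>\<^sub>0 int) \<Rightarrow> 'r" where
  "character J r = (SOME h. h \<in> hom (free_Abelian_group J) (units_of A) \<and> (\<forall>j\<in>J. h (frag_of j) = r j))"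

lemma
  assumes "r \<in> carrier (unit_families J)"
  shows character_hom: "character J r \<in> hom (free_Abelian_group J) (units_of A)"
    and character_frag_of: "j \<in> J \<Longrightarrow> character J r (frag_of j) = r j"
proof -
  have "r ` J \<subseteq> carrier (units_of A)" using assms by auto
  then obtain h where "h \<in> hom (free_Abelian_group J) (units_of A)" "\<And>x. x \<in> J \<Longrightarrow> h (frag_of x) = r x"
    by (rule comm_group.free_Abelian_group_universal[OF units_comm_group]) blast
  then have "\<exists>h. h \<in> hom (free_Abelian_group J) (units_of A) \<and> (\<forall>j\<in>J. h (frag_of j) = r j)" by blast
  then have *: "character J r \<in> hom (free_Abelian_group J) (units_of A) \<and> (\<forall>j\<in>J. character J r (frag_of j) = r j)"
    unfolding character_def by (rule someI_ex)
  show "character J r \<in> hom (free_Abelian_group J) (units_of A)" using * by blast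
  show "character J r (frag_of j) = r j" if "j \<in> J" using * that by blast
qed

definition torus_point :: "'i set \<Rightarrow> ('i \<Rightarrow> 'r) \<Rightarrow> (('i \<Rightarrow>\<^sub>0 int) \<Rightarrow>\<^sub>0 'f) \<Rightarrow> 'r" where
  "torus_point J r = group_algebra_point.eval_hom A (free_Abelian_group J) (character J r)"

lemma group_algebra_point: "group_algebra_point A (free_Abelian_group J)"
  by (intro group_algebra_point.intro comm_algebra_type_axioms abelian_free_Abelian_group)

lemma hom_units_funcset: "h \<in> hom U (units_of A) \<Longrightarrow> h \<in> carrier U \<rightarrow> carrier A"
  by (auto simp: hom_def units_of_carrier Pi_iff)

lemma torus_point_in: "r \<in> carrier (unit_families J) \<Longrightarrow> torus_point J r \<in> carrier (torus_points J)"
  unfolding torus_point_def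
  by (intro group_algebra_point.eval_hom_in_points[OF group_algebra_point] character_hom)

lemma torus_point_frag_of:
  assumes r: "r \<in> carrier (unit_families J)" and j: "j \<in> J"
  shows "torus_point J r (Poly_Mapping.single (frag_of j) 1) = r j"
proof -
  interpret group_algebra_point A "free_Abelian_group J" by (rule group_algebra_point)
  have "r j \<in> carrier A" using r j by (auto simp: units_of_carrier)
  then show ?thesis
    using j character_frag_of[OF r j] eval_hom_single[OF hom_units_funcset[OF character_hom[OF r]]]
    by (simp add: torus_point_def)
qed

text \<open>A point is determined by its character, and a character of the free abelian group by its
  values on the canonical basis.\<close>

lemma torus_point_unique:
  assumes r: "r \<in> carrier (unit_families J)" and \<alpha>: "\<alpha> \<in> carrier (torus_points J)"
    and eq: "\<And>j. j \<in> J \<Longrightarrow> \<alpha> (Poly_Mapping.single (frag_of j) 1) = r j"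
  shows "\<alpha> = torus_point J r"
proof -
  interpret group_algebra_point A "free_Abelian_group J" by (rule group_algebra_point)
  have hom: "(\<lambda>u. \<alpha> (Poly_Mapping.single u 1)) \<in> hom (free_Abelian_group J) (units_of A)"
    by (rule point_restrict_hom[OF \<alpha>])
  have "eval_hom (\<lambda>u. \<alpha> (Poly_Mapping.single u 1)) = eval_hom (character J r)"
  proof (rule eval_hom_cong)
    show "\<alpha> (Poly_Mapping.single u 1) = character J r u" if "u \<in> carrier (free_Abelian_group J)" for u
      by (rule hom_free_Abelian_group_eqI[OF hom character_hom[OF r] units_group _ that])
        (simp add: eq character_frag_of[OF r])
  qed (rule hom_units_funcset[OF hom])
  then show ?thesis by (simp add: torus_point_def eval_hom_point[OF \<alpha>])
qed

text \<open>Products are compared as characters on the canonical basis, and the inverse map reads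
  off the values of a point there.\<close>

lemma torus_point_iso: "torus_point J \<in> iso (unit_families J) (torus_points J)"
proof (intro isoI homI)
  interpret group_algebra_point A "free_Abelian_group J" by (rule group_algebra_point)
  show "torus_point J r \<in> carrier (torus_points J)" if "r \<in> carrier (unit_families J)" for r
    by (rule torus_point_in[OF that])
  show "torus_point J (r \<otimes>\<^bsub>unit_families J\<^esub> r') = torus_point J r \<otimes>\<^bsub>torus_points J\<^esub> torus_point J r'"
    if r: "r \<in> carrier (unit_families J)" and r': "r' \<in> carrier (unit_families J)" for r r'
  proof -
    interpret units: comm_group "units_of A" by (rule units_comm_group)
    have rr': "r \<otimes>\<^bsub>unit_families J\<^esub> r' \<in> carrier (unit_families J)"
      using group.is_monoid[OF product_group[of J "\<lambda>_. units_of A"]] units_group r r'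
      by (intro monoid.m_closed) auto
    have "(\<lambda>u. character J r u \<otimes> character J r' u) \<in> hom (free_Abelian_group J) (units_of A)"
      using units.hom_group_mult[OF character_hom[OF r] character_hom[OF r']] by (simp add: units_of_mult)
    note hom = this
    have "eval_hom (character J (r \<otimes>\<^bsub>unit_families J\<^esub> r')) = eval_hom (\<lambda>u. character J r u \<otimes> character J r' u)"
    proof (rule eval_hom_cong)
      show "character J (r \<otimes>\<^bsub>unit_families J\<^esub> r') u = character J r u \<otimes> character J r' u"
        if "u \<in> carrier (free_Abelian_group J)" for u
        by (rule hom_free_Abelian_group_eqI[OF character_hom[OF rr'] hom units_group _ that])
          (use character_frag_of[OF rr'] in \<open>simp add: character_frag_of[OF r] character_frag_of[OF r'] units_of_mult\<close>)
    qed (rule hom_units_funcset[OF character_hom[OF rr']])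
    then show ?thesis
      using mult_points[OF hom_units_funcset[OF character_hom[OF r]] hom_units_funcset[OF character_hom[OF r']]]
      by (simp add: torus_point_def)
  qed
  show "bij_betw (torus_point J) (carrier (unit_families J)) (carrier (torus_points J))"
  proof (rule bij_betwI')
    fix r r' assume r: "r \<in> carrier (unit_families J)" and r': "r' \<in> carrier (unit_families J)"
    show "torus_point J r = torus_point J r' \<longleftrightarrow> r = r'"
    proof
      assume "torus_point J r = torus_point J r'"
      then have "r j = r' j" if "j \<in> J" for j
        using torus_point_frag_of[OF r that] torus_point_frag_of[OF r' that] by simp
      with r r' show "r = r'" by (intro PiE_ext[of r J "\<lambda>_. carrier (units_of A)" r']) simp_all
    qed simp
  next
    fix \<alpha> assume \<alpha>: "\<alpha> \<in> carrier (torus_points J)"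
    define r where "r = (\<lambda>j\<in>J. \<alpha> (Poly_Mapping.single (frag_of j) 1))"
    have "r \<in> carrier (unit_families J)"
      using hom_in_carrier[OF point_restrict_hom[OF \<alpha>]] by (auto simp: r_def)
    moreover from this have "\<alpha> = torus_point J r" by (rule torus_point_unique[OF _ \<alpha>]) (simp add: r_def)
    ultimately show "\<exists>r\<in>carrier (unit_families J). \<alpha> = torus_point J r" by blast
  qed (rule torus_point_in)
qed

end

section \<open>Extension of scalars\<close>

lemma hom_generate_eqI:
  assumes "group G" "group H" "f \<in> hom G H" "g \<in> hom G H" "S \<subseteq> carrier G"
    and eq: "\<And>x. x \<in> S \<Longrightarrow> f x = g x" and "x \<in> generate G S"
  shows "f x = g x"
proof -
  interpret f: group_hom G H f using assms by (simp add: group_hom_def group_hom_axioms_def)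
  interpret g: group_hom G H g using assms by (simp add: group_hom_def group_hom_axioms_def)
  show ?thesis
    using assms(7)
  proof induction
    case (inv x)
    then have "x \<in> carrier G" using assms(5) by blast
    with inv show ?case by (simp add: eq)
  next
    case (eng x y)
    then have "x \<in> carrier G" "y \<in> carrier G" using f.G.generate_in_carrier[OF assms(5)] by blast+
    with eng show ?case by simp
  qed (simp_all add: eq)
qed

text \<open>The shape that the two additivity relations of the tensor product take in the target of
  \<open>tensor_universal\<close>, once the value at a sum is replaced by its two factors.\<close>

lemma commutator_trivial:
  assumes "comm_group G" "x \<in> carrier G" "y \<in> carrier G"
  shows "x \<otimes>\<^bsub>G\<^esub> y \<otimes>\<^bsub>G\<^esub> inv\<^bsub>G\<^esub> x \<otimes>\<^bsub>G\<^esub> inv\<^bsub>G\<^esub> y = \<one>\<^bsub>G\<^esub>"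
proof -
  interpret comm_group G by fact
  show ?thesis using assms(2,3) r_inv[of "x \<otimes>\<^bsub>G\<^esub> y"] by (simp add: inv_mult m_assoc)
qed

locale scalar_extension = comm_algebra_type A
  for A :: "('f::field, 'r) module" (structure) +
  fixes sc :: "'f \<Rightarrow> 'v::ab_group_add \<Rightarrow> 'v"
  assumes vector_space: "vector_space sc"
begin

abbreviation "F \<equiv> tensor_free A :: (('v \<times> 'r) \<Rightarrow>\<^sub>0 int) monoid"
abbreviation "K \<equiv> tensor_kernel sc A"
abbreviation "VA \<equiv> tensor_group sc A"
abbreviation "pure \<equiv> pure_tensor sc A"

sublocale F: comm_group F
  unfolding tensor_free_def by (rule abelian_free_Abelian_group)

lemma frag_of_F: "a \<in> carrier A \<Longrightarrow> frag_of (v, a) \<in> carrier F"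
  by (simp add: tensor_free_def)

lemma mult_F [simp]: "x \<otimes>\<^bsub>F\<^esub> y = x + y"
  and one_F [simp]: "\<one>\<^bsub>F\<^esub> = 0"
  by (simp_all add: tensor_free_def)

lemma diff_F: "x \<in> carrier F \<Longrightarrow> y \<in> carrier F \<Longrightarrow> x - y = x \<otimes>\<^bsub>F\<^esub> inv\<^bsub>F\<^esub> y"
  by (simp add: tensor_free_def)

lemma diff_in_F: "x \<in> carrier F \<Longrightarrow> y \<in> carrier F \<Longrightarrow> x - y \<in> carrier F"
  using F.m_closed[OF _ F.inv_closed] by (simp only: diff_F)

lemma relations_in_F: "tensor_relations sc A \<subseteq> carrier F"
  by (auto simp: tensor_relations_def intro!: diff_in_F frag_of_F a_closed)

lemma subgroup_K: "subgroup K F"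
  unfolding tensor_kernel_def by (rule F.generate_is_subgroup[OF relations_in_F])

lemma normal_K: "K \<lhd> F"
  using subgroup_K by (rule F.subgroup_imp_normal)

sublocale VA: comm_group VA
  unfolding tensor_group_def by (rule F.abelian_FactGroup[OF subgroup_K])

lemma comm_group_VA: "comm_group VA" ..

lemma carrier_VA: "carrier VA = (\<lambda>x. K #>\<^bsub>F\<^esub> x) ` carrier F"
  by (auto simp: tensor_group_def FactGroup_def RCOSETS_def)

lemma mult_VA: "x \<in> carrier F \<Longrightarrow> y \<in> carrier F \<Longrightarrow> (K #>\<^bsub>F\<^esub> x) \<otimes>\<^bsub>VA\<^esub> (K #>\<^bsub>F\<^esub> y) = K #>\<^bsub>F\<^esub> (x + y)"
  using normal.rcos_sum[OF normal_K, of x y] by (simp add: tensor_group_def FactGroup_def)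

lemma quotient_hom: "(\<lambda>x. K #>\<^bsub>F\<^esub> x) \<in> hom F VA"
  by (rule homI) (auto simp: carrier_VA mult_VA)

lemma pure_in [simp]: "a \<in> carrier A \<Longrightarrow> pure v a \<in> carrier VA"
  by (auto simp: pure_tensor_def carrier_VA intro: frag_of_F)

lemma coset_eqI:
  assumes "x - y \<in> tensor_relations sc A" "x \<in> carrier F" "y \<in> carrier F"
  shows "K #>\<^bsub>F\<^esub> x = K #>\<^bsub>F\<^esub> y"
proof -
  have "x - y \<in> K" using assms(1) unfolding tensor_kernel_def by (rule generate.incl)
  then have "x \<otimes>\<^bsub>F\<^esub> inv\<^bsub>F\<^esub> y \<in> K" using assms by (simp only: diff_F)
  then have "x \<in> K #>\<^bsub>F\<^esub> y" using subgroup.rcos_module_rev[OF subgroup_K F.is_group assms(3,2)] by simp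
  then show ?thesis by (rule F.repr_independence[OF _ assms(3) subgroup_K, symmetric])
qed

lemma pure_add_left:
  assumes "a \<in> carrier A" shows "pure (v + w) a = pure v a \<otimes>\<^bsub>VA\<^esub> pure w a"
proof -
  have "frag_of (v + w, a) - (frag_of (v, a) + frag_of (w, a)) \<in> tensor_relations sc A"
    unfolding tensor_relations_def using assms by (auto simp: diff_diff_eq[symmetric])
  then show ?thesis
    unfolding pure_tensor_def using assms
    by (subst mult_VA) (simp_all add: coset_eqI frag_of_F F.m_closed[unfolded mult_F, OF frag_of_F frag_of_F])
qed

lemma pure_add_right:
  assumes "a \<in> carrier A" "b \<in> carrier A" shows "pure v (a \<oplus> b) = pure v a \<otimes>\<^bsub>VA\<^esub> pure v b"
proof -
  have "frag_of (v, a \<oplus> b) - (frag_of (v, a) + frag_of (v, b)) \<in> tensor_relations sc A"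
    unfolding tensor_relations_def using assms by (auto simp: diff_diff_eq[symmetric])
  then show ?thesis
    unfolding pure_tensor_def using assms
    by (subst mult_VA) (simp_all add: coset_eqI frag_of_F F.m_closed[unfolded mult_F, OF frag_of_F frag_of_F])
qed

lemma pure_scale:
  assumes "a \<in> carrier A" shows "pure (sc c v) a = pure v (c \<odot> a)"
proof -
  have "frag_of (sc c v, a) - frag_of (v, c \<odot> a) \<in> tensor_relations sc A"
    unfolding tensor_relations_def using assms by auto
  then show ?thesis
    unfolding pure_tensor_def using assms by (intro coset_eqI frag_of_F) auto
qed

lemma pure_zero [simp]: "pure v \<zero> = \<one>\<^bsub>VA\<^esub>"
  using pure_add_right[of \<zero> \<zero> v] by (simp add: VA.l_cancel_one' pure_in)

lemma pure_zero_left [simp]: "a \<in> carrier A \<Longrightarrow> pure 0 a = \<one>\<^bsub>VA\<^esub>"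
  using pure_add_left[of a 0 0] by (simp add: VA.l_cancel_one' pure_in)

text \<open>Pulled back to the free group on pairs, \<open>f\<close> and \<open>g\<close> are
  homomorphisms that agree on the generators.\<close>

lemma hom_VA_eqI:
  assumes "group C" "f \<in> hom VA C" "g \<in> hom VA C"
    and eq: "\<And>v a. a \<in> carrier A \<Longrightarrow> f (pure v a) = g (pure v a)" and t: "t \<in> carrier VA"
  shows "f t = g t"
proof -
  obtain x where x: "x \<in> carrier F" "t = K #>\<^bsub>F\<^esub> x" using t by (auto simp: carrier_VA)
  have "(f \<circ> (\<lambda>x. K #>\<^bsub>F\<^esub> x)) x = (g \<circ> (\<lambda>x. K #>\<^bsub>F\<^esub> x)) x"
  proof (rule hom_free_Abelian_group_eqI[of _ "UNIV \<times> carrier A" C])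
    show "f \<circ> (\<lambda>x. K #>\<^bsub>F\<^esub> x) \<in> hom (free_Abelian_group (UNIV \<times> carrier A)) C"
      "g \<circ> (\<lambda>x. K #>\<^bsub>F\<^esub> x) \<in> hom (free_Abelian_group (UNIV \<times> carrier A)) C"
      using hom_compose[OF quotient_hom assms(2)] hom_compose[OF quotient_hom assms(3)]
      unfolding tensor_free_def[symmetric] by blast+
    show "(f \<circ> (\<lambda>x. K #>\<^bsub>F\<^esub> x)) (frag_of p) = (g \<circ> (\<lambda>x. K #>\<^bsub>F\<^esub> x)) (frag_of p)"
      if "p \<in> UNIV \<times> carrier A" for p
      using that eq by (cases p) (auto simp: pure_tensor_def)
  qed (use x assms in \<open>simp_all add: tensor_free_def\<close>)
  with x show ?thesis by simp
qed

text \<open>The condition under which a map on pairs descends to the tensor product. The target is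
  an arbitrary structure written multiplicatively, since \<open>tensor_group\<close> is treated as
  an abelian group and \<open>add_monoid A\<close> also occurs as a target.\<close>

definition balanced :: "('v \<Rightarrow> 'r \<Rightarrow> 'c) \<Rightarrow> ('c, 'd) monoid_scheme \<Rightarrow> bool" where
  "balanced h C \<longleftrightarrow>
     (\<forall>v. \<forall>a\<in>carrier A. h v a \<in> carrier C) \<and>
     (\<forall>v w. \<forall>a\<in>carrier A. h (v + w) a = h v a \<otimes>\<^bsub>C\<^esub> h w a) \<and>
     (\<forall>v. \<forall>a\<in>carrier A. \<forall>b\<in>carrier A. h v (a \<oplus> b) = h v a \<otimes>\<^bsub>C\<^esub> h v b) \<and>
     (\<forall>c v. \<forall>a\<in>carrier A. h (sc c v) a = h v (c \<odot> a))"

text \<open>Extend \<open>h\<close> to the free group, check that each of the three kinds of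
  relation goes to the unit, and factor through the quotient.\<close>

lemma tensor_universal:
  assumes C: "comm_group C" and h: "balanced h C"
  obtains g where "g \<in> hom VA C" "\<And>v a. a \<in> carrier A \<Longrightarrow> g (pure v a) = h v a"
proof -
  interpret C: comm_group C by fact
  have "(\<lambda>(v, a). h v a) ` (UNIV \<times> carrier A) \<subseteq> carrier C" using h by (auto simp: balanced_def)
  then obtain k where k: "k \<in> hom F C"
      and k_frag: "\<And>p. p \<in> UNIV \<times> carrier A \<Longrightarrow> k (frag_of p) = (\<lambda>(v, a). h v a) p"
    unfolding tensor_free_def by (rule C.free_Abelian_group_universal) blast
  interpret k: group_hom F C k using k F.is_group C.is_group by (simp add: group_hom_def group_hom_axioms_def)
  have k_frag': "k (frag_of (v, a)) = h v a" if "a \<in> carrier A" for v a using k_frag[of "(v, a)"] that by simp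
  have k_diff: "k (x - y) = k x \<otimes>\<^bsub>C\<^esub> inv\<^bsub>C\<^esub> k y" if "x \<in> carrier F" "y \<in> carrier F" for x y
    using that k.hom_mult[of x "inv\<^bsub>F\<^esub> y"] k.hom_inv[of y] by (metis diff_F F.inv_closed)
  have "tensor_relations sc A \<subseteq> kernel F C k"
  proof
    fix x assume x: "x \<in> tensor_relations sc A"
    then have "x \<in> carrier F" using relations_in_F by blast
    moreover have "k x = \<one>\<^bsub>C\<^esub>"
    proof -
      have hC: "h v a \<in> carrier C" if "a \<in> carrier A" for v a using h that by (simp add: balanced_def)
      from x consider
        v w a where "x = frag_of (v + w, a) - frag_of (v, a) - frag_of (w, a)" "a \<in> carrier A"
        | v a b where "x = frag_of (v, a \<oplus> b) - frag_of (v, a) - frag_of (v, b)" "a \<in> carrier A" "b \<in> carrier A"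
        | c v a where "x = frag_of (sc c v, a) - frag_of (v, c \<odot> a)" "a \<in> carrier A"
        unfolding tensor_relations_def by blast
      then show ?thesis
      proof cases
        case 1
        then show ?thesis using h hC
          by (simp add: k_diff k_frag' diff_in_F frag_of_F balanced_def commutator_trivial[OF C])
      next
        case 2
        then show ?thesis using h hC
          by (simp add: k_diff k_frag' diff_in_F frag_of_F balanced_def commutator_trivial[OF C])
      next
        case 3
        then show ?thesis using h hC by (simp add: k_diff k_frag' frag_of_F balanced_def)
      qed
    qed
    ultimately show "x \<in> kernel F C k" by (simp add: kernel_def)
  qed
  then have "K \<subseteq> kernel F C k"
    unfolding tensor_kernel_def by (rule F.generate_subgroup_incl[OF _ k.subgroup_kernel])
  then obtain g where g: "g \<in> hom (F Mod K) C" "\<And>x. x \<in> carrier F \<Longrightarrow> g (K #>\<^bsub>F\<^esub> x) = k x"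
    using k.FactGroup_universal_kernel[OF normal_K] by blast
  show thesis
    by (rule that[of g]) (use g in \<open>simp_all add: tensor_group_def pure_tensor_def frag_of_F k_frag'\<close>)
qed

end

lemma scalar_extensionI: "vector_space sc \<Longrightarrow> comm_algebra A \<Longrightarrow> scalar_extension A sc"
  by (simp add: scalar_extension_def comm_algebra_type_def scalar_extension_axioms_def)

text \<open>\<open>tensor_map\<close> is a union over all representatives of a class. The universal
  property yields a homomorphism \<open>g\<close> with the prescribed values on pure tensors, and
  every representative of \<open>t\<close> contributes exactly the coset \<open>g t\<close>.\<close>

lemma tensor_map_pure:
  assumes "scalar_extension A sc" "scalar_extension A' sc"
    and h: "\<And>v a. a \<in> carrier A \<Longrightarrow> snd (h (v, a)) \<in> carrier A'"
    and bal: "scalar_extension.balanced A sc (\<lambda>v a. pure_tensor sc A' (fst (h (v, a))) (snd (h (v, a)))) (tensor_group sc A')"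
  shows "tensor_map sc A' h \<in> hom (tensor_group sc A) (tensor_group sc A')" (is ?hom)
    and "a \<in> carrier A \<Longrightarrow> tensor_map sc A' h (pure_tensor sc A v a) = pure_tensor sc A' (fst (h (v, a))) (snd (h (v, a)))"
proof -
  interpret A: scalar_extension A sc by fact
  interpret A': scalar_extension A' sc by fact
  obtain g where g: "g \<in> hom A.VA A'.VA"
      and g_pure: "\<And>v a. a \<in> carrier A \<Longrightarrow> g (A.pure v a) = A'.pure (fst (h (v, a))) (snd (h (v, a)))"
    using A.tensor_universal[OF A'.VA.comm_group_axioms bal] by blast
  let ?e = "frag_extend (\<lambda>p. frag_of (h p))"
  have h_in: "h p \<in> UNIV \<times> carrier A'" if "p \<in> UNIV \<times> carrier A" for p
    using h[of "snd p" "fst p"] that by (cases "h p") auto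
  have e_in: "?e y \<in> carrier A'.F" if "y \<in> carrier A.F" for y
  proof -
    have "Poly_Mapping.keys (?e y) \<subseteq> (\<Union>p\<in>Poly_Mapping.keys y. Poly_Mapping.keys (frag_of (h p)))"
      by (rule keys_frag_extend)
    also have "\<dots> \<subseteq> UNIV \<times> carrier A'"
    proof
      fix q assume "q \<in> (\<Union>p\<in>Poly_Mapping.keys y. Poly_Mapping.keys (frag_of (h p)))"
      then obtain p where "p \<in> Poly_Mapping.keys y" "q = h p" by auto
      moreover from this that have "p \<in> UNIV \<times> carrier A" by (auto simp: tensor_free_def)
      ultimately show "q \<in> UNIV \<times> carrier A'" using h_in by blast
    qed
    finally show ?thesis by (simp add: tensor_free_def)
  qed
  have e_hom: "(\<lambda>y. A'.K #>\<^bsub>A'.F\<^esub> ?e y) \<in> hom A.F A'.VA"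
    by (rule homI) (auto simp: A'.carrier_VA A'.mult_VA e_in frag_extend_add)
  have eq: "A'.K #>\<^bsub>A'.F\<^esub> ?e y = g (A.K #>\<^bsub>A.F\<^esub> y)" if y: "y \<in> carrier A.F" for y
  proof -
    have "(\<lambda>y. A'.K #>\<^bsub>A'.F\<^esub> ?e y) y = (g \<circ> (\<lambda>x. A.K #>\<^bsub>A.F\<^esub> x)) y"
    proof (rule hom_free_Abelian_group_eqI[of _ "UNIV \<times> carrier A" A'.VA])
      show "(\<lambda>y. A'.K #>\<^bsub>A'.F\<^esub> ?e y) \<in> hom (free_Abelian_group (UNIV \<times> carrier A)) A'.VA"
        "g \<circ> (\<lambda>x. A.K #>\<^bsub>A.F\<^esub> x) \<in> hom (free_Abelian_group (UNIV \<times> carrier A)) A'.VA"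
        using e_hom hom_compose[OF A.quotient_hom g] unfolding tensor_free_def[of A, symmetric] by blast+
      show "A'.K #>\<^bsub>A'.F\<^esub> ?e (frag_of p) = (g \<circ> (\<lambda>x. A.K #>\<^bsub>A.F\<^esub> x)) (frag_of p)"
        if "p \<in> UNIV \<times> carrier A" for p
        using that g_pure[of "snd p" "fst p"] by (auto simp: pure_tensor_def)
    qed (use y A'.VA.is_group in \<open>simp_all add: tensor_free_def\<close>)
    then show ?thesis by simp
  qed
  have map_eq: "tensor_map sc A' h t = g t" if t: "t \<in> carrier A.VA" for t
  proof -
    obtain x where x: "x \<in> carrier A.F" "t = A.K #>\<^bsub>A.F\<^esub> x" using t by (auto simp: A.carrier_VA)
    have "A'.K #>\<^bsub>A'.F\<^esub> ?e y = g t" if y: "y \<in> t" for y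
    proof -
      have "y \<in> carrier A.F"
        using y x A.F.r_coset_subset_G[OF subgroup.subset[OF A.subgroup_K]] by blast
      moreover have "A.K #>\<^bsub>A.F\<^esub> y = t"
        using y x A.F.repr_independence[OF _ x(1) A.subgroup_K] by simp
      ultimately show ?thesis using eq by simp
    qed
    \<comment> \<open>With a representative at hand, the union of these equal cosets is nonvacuous
      and equals \<open>g t\<close>.\<close>
    moreover have "x \<in> t" using x A.F.rcos_self[OF _ A.subgroup_K] by simp
    ultimately show ?thesis unfolding tensor_map_def by blast
  qed
  show ?hom using A.VA.hom_eq[OF g, of "tensor_map sc A' h"] map_eq by simp
  show "tensor_map sc A' h (A.pure v a) = A'.pure (fst (h (v, a))) (snd (h (v, a)))" if "a \<in> carrier A"
    using that map_eq g_pure by simp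
qed

section \<open>Scalar multiplication, endomorphisms and base change on the tensor product\<close>

context scalar_extension
begin

lemma
  assumes r: "r \<in> carrier A"
  shows tensor_smult_hom: "tensor_smult sc A r \<in> hom VA VA"
    and tensor_smult_pure: "a \<in> carrier A \<Longrightarrow> tensor_smult sc A r (pure v a) = pure v (r \<otimes> a)"
proof -
  have "balanced (\<lambda>v a. pure (fst ((\<lambda>(v, a). (v, r \<otimes> a)) (v, a))) (snd ((\<lambda>(v, a). (v, r \<otimes> a)) (v, a)))) VA"
    using r by (auto simp: balanced_def pure_add_left pure_add_right pure_scale r_distr smult_mult_right)
  note * = tensor_map_pure[OF scalar_extension_axioms scalar_extension_axioms _ this]
  show "tensor_smult sc A r \<in> hom VA VA" unfolding tensor_smult_def using r by (intro *) auto
  show "tensor_smult sc A r (pure v a) = pure v (r \<otimes> a)" if "a \<in> carrier A"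
    using *(2)[OF _ that, of v] r by (simp add: tensor_smult_def)
qed

lemma
  assumes X: "Vector_Spaces.linear sc sc X"
  shows tensor_endo_hom: "tensor_endo sc A X \<in> hom VA VA"
    and tensor_endo_pure: "a \<in> carrier A \<Longrightarrow> tensor_endo sc A X (pure v a) = pure (X v) a"
proof -
  have "X (v + w) = X v + X w" "X (sc c v) = sc c (X v)" for v w c
    using X by (simp_all add: Vector_Spaces.linear_iff)
  then have "balanced (\<lambda>v a. pure (fst ((\<lambda>(v, a). (X v, a)) (v, a))) (snd ((\<lambda>(v, a). (X v, a)) (v, a)))) VA"
    by (auto simp: balanced_def pure_add_left pure_add_right pure_scale)
  note * = tensor_map_pure[OF scalar_extension_axioms scalar_extension_axioms _ this]
  show "tensor_endo sc A X \<in> hom VA VA" unfolding tensor_endo_def by (intro *) auto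
  show "tensor_endo sc A X (pure v a) = pure (X v) a" if "a \<in> carrier A"
    using *(2)[OF _ that, of v] by (simp add: tensor_endo_def)
qed

lemma
  assumes A': "comm_algebra A'" and \<phi>: "\<phi> \<in> alg_homs A A'"
  shows tensor_base_change_hom: "tensor_base_change sc A' \<phi> \<in> hom VA (tensor_group sc A')"
    and tensor_base_change_pure:
      "a \<in> carrier A \<Longrightarrow> tensor_base_change sc A' \<phi> (pure v a) = pure_tensor sc A' v (\<phi> a)"
proof -
  interpret A': scalar_extension A' sc by (rule scalar_extensionI[OF vector_space A'])
  have \<phi>': "\<phi> a \<in> carrier A'" "\<phi> (a \<oplus> b) = \<phi> a \<oplus>\<^bsub>A'\<^esub> \<phi> b" "\<phi> (c \<odot> a) = c \<odot>\<^bsub>A'\<^esub> \<phi> a"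
    if "a \<in> carrier A" "b \<in> carrier A" for a b c
    using \<phi> that by (auto simp: alg_homs_def ring_hom_def)
  have "balanced (\<lambda>v a. A'.pure (fst ((\<lambda>(v, a). (v, \<phi> a)) (v, a))) (snd ((\<lambda>(v, a). (v, \<phi> a)) (v, a)))) A'.VA"
    by (auto simp: balanced_def A'.pure_add_left A'.pure_add_right A'.pure_scale \<phi>')
  note * = tensor_map_pure[OF scalar_extension_axioms A'.scalar_extension_axioms _ this]
  show "tensor_base_change sc A' \<phi> \<in> hom VA A'.VA" unfolding tensor_base_change_def using \<phi>' by (intro *) auto
  show "tensor_base_change sc A' \<phi> (pure v a) = A'.pure v (\<phi> a)" if "a \<in> carrier A"
    using *(2)[OF _ that, of v] \<phi>' by (simp add: tensor_base_change_def)
qed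

end

section \<open>The diagonal group scheme\<close>

locale diagonal_scheme = scalar_extension A sc
  for A :: "('f::field, 'r) module" (structure) and sc :: "'f \<Rightarrow> 'v::ab_group_add \<Rightarrow> 'v" +
  fixes n :: nat and u :: "nat \<Rightarrow> 'v" and X :: "'v \<Rightarrow> 'v" and c :: "nat \<Rightarrow> 'f"
    and G :: "'g monoid" and d :: "nat \<Rightarrow> 'g"
  assumes eigenbasis: "eigenbasis sc n u X c"
    and d_inj: "inj_on d {1..n}"
    and d_in: "d ` {1..n} \<subseteq> carrier G"
begin

abbreviation "J \<equiv> {1..n}"
abbreviation "\<Gamma> \<equiv> eigenbasis.lines_grading sc n u d"
abbreviation "co \<equiv> finite_indexed_basis.coord sc n u"

lemma fib: "finite_indexed_basis sc n u"
  by (rule eigenbasis.axioms(1)[OF eigenbasis])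

lemma mod: "Modules.module sc"
  using vector_space by (simp add: module_iff_vector_space)

lemma hom_VA_basis_eqI:
  assumes C: "group C" and f: "f \<in> hom VA C" and g: "g \<in> hom VA C"
    and eq: "\<And>j a. j \<in> J \<Longrightarrow> a \<in> carrier A \<Longrightarrow> f (pure (u j) a) = g (pure (u j) a)"
    and t: "t \<in> carrier VA"
  shows "f t = g t"
proof (rule hom_VA_eqI[OF C f g _ t])
  fix v a assume "a \<in> carrier A"
  interpret f: group_hom VA C f using f C VA.is_group by (simp add: group_hom_def group_hom_axioms_def)
  interpret g: group_hom VA C g using g C VA.is_group by (simp add: group_hom_def group_hom_axioms_def)
  have "v \<in> Modules.module.span sc (u ` J)"
    using finite_indexed_basis.span_u[OF fib] by simp
  \<comment> \<open>All \<open>a\<close> are treated at once, because closure under scaling moves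
    the scalar from \<open>v\<close> into the algebra entry.\<close>
  then have "\<forall>a\<in>carrier A. f (pure v a) = g (pure v a)"
  proof (rule Modules.module.span_induct[OF mod])
    show "Modules.module.subspace sc {v. \<forall>a\<in>carrier A. f (pure v a) = g (pure v a)}"
      by (auto simp: Modules.module.subspace_def[OF mod] pure_add_left pure_scale)
  qed (use eq in auto)
  with \<open>a \<in> carrier A\<close> show "f (pure v a) = g (pure v a)" by blast
qed

text \<open>The \<open>j\<close>-th coordinate induces a homomorphism from the tensor product to the
  additive group of \<open>A\<close>, which returns \<open>a\<close> on \<open>pure (u j) a\<close>.
  This makes the factors of a diagonal map unique.\<close>

lemma pure_u_cancel:
  assumes j: "j \<in> J" and a: "a \<in> carrier A" and b: "b \<in> carrier A" and eq: "pure (u j) a = pure (u j) b"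
  shows "a = b"
proof -
  have "balanced (\<lambda>v a. co j v \<odot> a) (add_monoid A)"
    by (auto simp: balanced_def finite_indexed_basis.coord_add[OF fib] finite_indexed_basis.coord_scale[OF fib]
      smult_add_left smult_add_right smult_smult smult_left_commute)
  then obtain g where "g \<in> hom VA (add_monoid A)" "\<And>v a. a \<in> carrier A \<Longrightarrow> g (pure v a) = co j v \<odot> a"
    using tensor_universal[OF a_comm_group] by blast
  then have "co j (u j) \<odot> a = co j (u j) \<odot> b" using eq a b by metis
  then show ?thesis using finite_indexed_basis.coord_u[OF fib j j] a b by simp
qed

definition scales_by :: "(('v, 'r) tensor \<Rightarrow> ('v, 'r) tensor) \<Rightarrow> (nat \<Rightarrow> 'r) \<Rightarrow> bool" where
  "scales_by f r \<longleftrightarrow> (\<forall>j\<in>J. \<forall>a\<in>carrier A. f (pure (u j) a) = pure (u j) (r j \<otimes> a))"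

lemma scales_by_exists:
  assumes r: "\<And>j. j \<in> J \<Longrightarrow> r j \<in> carrier A"
  obtains f where "f \<in> hom VA VA" "scales_by f r"
proof -
  \<comment> \<open>The intended diagonal map, written on a general \<open>v\<close> through its
    coordinates; once balanced, it descends to the tensor product.\<close>
  define h where "h v a = finprod VA (\<lambda>j. pure (u j) (r j \<otimes> (co j v \<odot> a))) J" for v a
  have "balanced h VA"
    unfolding balanced_def
  proof (intro conjI allI ballI)
    fix v w a b k assume a: "a \<in> carrier A" and b: "b \<in> carrier A"
    show "h v a \<in> carrier VA" unfolding h_def using r a by (intro VA.finprod_closed) auto
    have "h (v + w) a = finprod VA (\<lambda>j. pure (u j) (r j \<otimes> (co j v \<odot> a)) \<otimes>\<^bsub>VA\<^esub> pure (u j) (r j \<otimes> (co j w \<odot> a))) J"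
      unfolding h_def using r a
      by (intro VA.finprod_cong') (auto simp: finite_indexed_basis.coord_add[OF fib] smult_add_left r_distr pure_add_right)
    also have "\<dots> = h v a \<otimes>\<^bsub>VA\<^esub> h w a"
      unfolding h_def using r a by (intro VA.finprod_multf) auto
    finally show "h (v + w) a = h v a \<otimes>\<^bsub>VA\<^esub> h w a" .
    have "h v (a \<oplus> b) = finprod VA (\<lambda>j. pure (u j) (r j \<otimes> (co j v \<odot> a)) \<otimes>\<^bsub>VA\<^esub> pure (u j) (r j \<otimes> (co j v \<odot> b))) J"
      unfolding h_def using r a b
      by (intro VA.finprod_cong') (auto simp: smult_add_right r_distr pure_add_right)
    also have "\<dots> = h v a \<otimes>\<^bsub>VA\<^esub> h v b"
      unfolding h_def using r a b by (intro VA.finprod_multf) auto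
    finally show "h v (a \<oplus> b) = h v a \<otimes>\<^bsub>VA\<^esub> h v b" .
    show "h (sc k v) a = h v (k \<odot> a)"
      unfolding h_def using r a
      by (intro VA.finprod_cong') (auto simp: finite_indexed_basis.coord_scale[OF fib] smult_smult smult_left_commute)
  qed
  then obtain f where f: "f \<in> hom VA VA" "\<And>v a. a \<in> carrier A \<Longrightarrow> f (pure v a) = h v a"
    using tensor_universal[OF VA.comm_group_axioms] by blast
  have "f (pure (u k) a) = pure (u k) (r k \<otimes> a)" if k: "k \<in> J" and a: "a \<in> carrier A" for k a
  proof -
    have "h (u k) a = finprod VA (\<lambda>j. if k = j then pure (u j) (r j \<otimes> a) else \<one>\<^bsub>VA\<^esub>) J"
      unfolding h_def
    proof (intro VA.finprod_cong' refl)
      fix j assume j: "j \<in> J"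
      show "pure (u j) (r j \<otimes> (co j (u k) \<odot> a)) = (if k = j then pure (u j) (r j \<otimes> a) else \<one>\<^bsub>VA\<^esub>)"
        using r[OF j] a by (simp add: finite_indexed_basis.coord_u[OF fib k j])
    qed (use r a in auto)
    also have "\<dots> = pure (u k) (r k \<otimes> a)"
      using k r a by (intro VA.finprod_singleton) auto
    finally show ?thesis using f(2)[OF a] by simp
  qed
  then show thesis using that[OF f(1)] by (simp add: scales_by_def)
qed

lemma scales_by_eqI:
  assumes "f \<in> hom VA VA" "scales_by f r" "g \<in> hom VA VA" "scales_by g r'" "\<And>j. j \<in> J \<Longrightarrow> r j = r' j"
    and "t \<in> carrier VA"
  shows "f t = g t"
  by (rule hom_VA_basis_eqI[OF VA.is_group assms(1,3) _ assms(6)]) (use assms in \<open>simp add: scales_by_def\<close>)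

lemma scales_by_comp:
  assumes f: "scales_by f r" and g: "scales_by g r'"
    and r: "\<And>j. j \<in> J \<Longrightarrow> r j \<in> carrier A" "\<And>j. j \<in> J \<Longrightarrow> r' j \<in> carrier A"
  shows "scales_by (f \<circ> g) (\<lambda>j. r j \<otimes> r' j)"
  using f g r by (auto simp: scales_by_def m_assoc)

lemma tensor_subspace_incl: "v \<in> W \<Longrightarrow> a \<in> carrier A \<Longrightarrow> pure v a \<in> tensor_subspace sc A W"
  unfolding tensor_subspace_def by (rule generate.incl) blast

lemma tensor_subspace_hom_eq:
  assumes "f \<in> hom VA VA" "g \<in> hom VA VA" "t \<in> tensor_subspace sc A W"
    and "\<And>v a. v \<in> W \<Longrightarrow> a \<in> carrier A \<Longrightarrow> f (pure v a) = g (pure v a)"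
  shows "f t = g t"
  by (rule hom_generate_eqI[OF VA.is_group VA.is_group assms(1,2) _ _ assms(3)[unfolded tensor_subspace_def]])
    (use assms(4) in auto)

lemma tensor_subspace_carrier: "t \<in> tensor_subspace sc A W \<Longrightarrow> t \<in> carrier VA"
  unfolding tensor_subspace_def by (erule VA.generate_in_carrier[rotated]) auto

lemma u_in_line: "j \<in> J \<Longrightarrow> u j \<in> \<Gamma> (d j)"
  by (rule Modules.module.span_base[OF mod]) auto

text \<open>\<open>u j\<close> lies in the component of degree \<open>d j\<close>, on which a
  diagonal automorphism acts by a unit.\<close>

lemma Diag_scales_by:
  assumes f: "f \<in> carrier (Diag sc X G \<Gamma> A)"
  obtains r where "r \<in> carrier (unit_families J)" "scales_by f r"
proof -
  have "\<exists>r\<in>Units A. \<forall>a\<in>carrier A. f (pure (u j) a) = pure (u j) (r \<otimes> a)" if j: "j \<in> J" for j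
  proof -
    have "d j \<in> carrier G" using d_in j by blast
    then obtain r where r: "r \<in> Units A" "\<forall>t\<in>tensor_subspace sc A (\<Gamma> (d j)). f t = tensor_smult sc A r t"
      using f by (auto simp: Diag_def)
    then have "f (pure (u j) a) = pure (u j) (r \<otimes> a)" if "a \<in> carrier A" for a
      using tensor_subspace_incl[OF u_in_line[OF j] that] tensor_smult_pure[OF _ that] by auto
    with r show ?thesis by blast
  qed
  then obtain r where r: "\<And>j. j \<in> J \<Longrightarrow> r j \<in> Units A"
      "\<And>j a. j \<in> J \<Longrightarrow> a \<in> carrier A \<Longrightarrow> f (pure (u j) a) = pure (u j) (r j \<otimes> a)" by metis
  have "restrict r J \<in> carrier (unit_families J)" using r(1) by (auto simp: units_of_carrier)
  moreover have "scales_by f (restrict r J)" using r(2) by (simp add: scales_by_def)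
  ultimately show thesis by (rule that)
qed

text \<open>The inverse units give the inverse map. Compatibility with scalars and with
  \<open>X\<close> is checked on the tensors of basis vectors, where all maps involved act by
  multiplication.\<close>

lemma scales_by_in_Diag:
  assumes r: "r \<in> carrier (unit_families J)"
  obtains f where "f \<in> carrier (Diag sc X G \<Gamma> A)" "scales_by f r"
proof -
  have rU: "r j \<in> Units A" if "j \<in> J" for j using r that by (auto simp: units_of_carrier)
  then have rA: "r j \<in> carrier A" "inv r j \<in> carrier A" if "j \<in> J" for j using that by auto
  obtain f where f: "f \<in> hom VA VA" "scales_by f r" using scales_by_exists[of r] rA(1) by blast
  obtain g where g: "g \<in> hom VA VA" "scales_by g (\<lambda>j. inv r j)"
    using scales_by_exists[of "\<lambda>j. inv r j"] rA(2) by blast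
  have id: "id \<in> hom VA VA" "scales_by id (\<lambda>j. \<one>)" by (auto simp: scales_by_def intro: homI)
  have fg: "f (g t) = t" if "t \<in> carrier VA" for t
    using scales_by_eqI[OF hom_compose[OF g(1) f(1)] scales_by_comp[OF f(2) g(2)] id _ that] rA rU by simp
  have gf: "g (f t) = t" if "t \<in> carrier VA" for t
    using scales_by_eqI[OF hom_compose[OF f(1) g(1)] scales_by_comp[OF g(2) f(2)] id _ that] rA rU by simp
  have f_in: "f t \<in> carrier VA" and g_in: "g t \<in> carrier VA" if "t \<in> carrier VA" for t
    using f(1) g(1) that by (auto simp: hom_def)
  note X_lin = eigenbasis.linear_X[OF eigenbasis] and X_u = eigenbasis.eigenvector[OF eigenbasis]
  \<comment> \<open>Elements of \<open>AutoGroup\<close> are extensional, so the map is cut down to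
    the carrier of the tensor product.\<close>
  define f' where "f' = restrict f (carrier VA)"
  have f'_eq: "f' t = f t" if "t \<in> carrier VA" for t using that by (simp add: f'_def)
  have "f' \<in> hom VA VA" using VA.hom_eq[OF f(1), of f'] f'_eq by simp
  moreover have "f' \<in> Bij (carrier VA)"
  proof -
    have "bij_betw f' (carrier VA) (carrier VA)"
      by (rule bij_betw_byWitness[where f' = g]) (auto simp: f'_eq fg gf f_in g_in)
    then show ?thesis by (simp add: Bij_def f'_def)
  qed
  moreover have "f' (tensor_smult sc A a t) = tensor_smult sc A a (f' t)"
    if a: "a \<in> carrier A" and t: "t \<in> carrier VA" for a t
  proof -
    have "(f \<circ> tensor_smult sc A a) t = (tensor_smult sc A a \<circ> f) t"
    proof (rule hom_VA_basis_eqI[OF VA.is_group hom_compose[OF tensor_smult_hom[OF a] f(1)]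
            hom_compose[OF f(1) tensor_smult_hom[OF a]] _ t])
      fix j b assume "j \<in> J" "b \<in> carrier A"
      then show "(f \<circ> tensor_smult sc A a) (pure (u j) b) = (tensor_smult sc A a \<circ> f) (pure (u j) b)"
        using a rA(1)[of j] f(2) by (simp add: tensor_smult_pure scales_by_def m_lcomm)
    qed
    then show ?thesis using t hom_in_carrier[OF tensor_smult_hom[OF a] t] by (simp add: f'_eq)
  qed
  moreover have "f' (tensor_endo sc A X t) = tensor_endo sc A X (f' t)" if t: "t \<in> carrier VA" for t
  proof -
    have "(f \<circ> tensor_endo sc A X) t = (tensor_endo sc A X \<circ> f) t"
    proof (rule hom_VA_basis_eqI[OF VA.is_group hom_compose[OF tensor_endo_hom[OF X_lin] f(1)]
            hom_compose[OF f(1) tensor_endo_hom[OF X_lin]] _ t])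
      fix j b assume "j \<in> J" "b \<in> carrier A"
      then show "(f \<circ> tensor_endo sc A X) (pure (u j) b) = (tensor_endo sc A X \<circ> f) (pure (u j) b)"
        using rA(1)[of j] f(2)
        by (simp add: tensor_endo_pure[OF X_lin] X_u scales_by_def pure_scale smult_mult_right)
    qed
    then show ?thesis using t hom_in_carrier[OF tensor_endo_hom[OF X_lin] t] by (simp add: f'_eq)
  qed
  moreover have "\<exists>a\<in>Units A. \<forall>t\<in>tensor_subspace sc A (\<Gamma> g). f' t = tensor_smult sc A a t"
    if g: "g \<in> carrier G" for g
  proof (cases "g \<in> d ` J")
    case True
    then obtain j where j: "j \<in> J" "g = d j" by blast
    have line: "\<Gamma> g = Modules.module.span sc {u j}"
      unfolding j(2) by (rule eigenbasis.lines_grading_degree[OF eigenbasis d_inj j(1)])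
    have "f t = tensor_smult sc A (r j) t" if "t \<in> tensor_subspace sc A (\<Gamma> g)" for t
    proof (rule tensor_subspace_hom_eq[OF f(1) tensor_smult_hom[OF rA(1)[OF j(1)]] that])
      fix v a assume v: "v \<in> \<Gamma> g" and a: "a \<in> carrier A"
      obtain k where "v = sc k (u j)"
        using v unfolding line by (rule finite_indexed_basis.span_lineE[OF fib])
      then show "f (pure v a) = tensor_smult sc A (r j) (pure v a)"
        using a j f(2) rA(1)[OF j(1)] by (simp add: pure_scale tensor_smult_pure scales_by_def)
    qed
    then show ?thesis using rU[OF j(1)] f'_eq[OF tensor_subspace_carrier] by auto
  next
    case False
    then have zero: "\<Gamma> g = {0}" by (rule eigenbasis.lines_grading_empty[OF eigenbasis])
    \<comment> \<open>A degree without basis vector still has to be given a unit; its part of the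
      tensor product is trivial, so 1 serves.\<close>
    have "f t = tensor_smult sc A \<one> t" if "t \<in> tensor_subspace sc A (\<Gamma> g)" for t
    proof (rule tensor_subspace_hom_eq[OF f(1) tensor_smult_hom[OF one_closed] that])
      fix v a assume "v \<in> \<Gamma> g" and "a \<in> carrier A"
      then show "f (pure v a) = tensor_smult sc A \<one> (pure v a)"
        using hom_one[OF f(1) VA.is_group VA.is_group] hom_one[OF tensor_smult_hom[OF one_closed] VA.is_group VA.is_group]
        unfolding zero by simp
    qed
    then show ?thesis using f'_eq[OF tensor_subspace_carrier] by (intro bexI[of _ \<one>]) auto
  qed
  ultimately have "f' \<in> carrier (Diag sc X G \<Gamma> A)" by (simp add: Diag_def AutoGroup_def auto_def)
  moreover have "scales_by f' r" using f(2) by (simp add: scales_by_def f'_eq)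
  ultimately show thesis by (rule that)
qed

text \<open>Well defined on diagonal maps by \<open>pure_u_cancel\<close>; evaluating at the tensor
  with 1 isolates the factor itself.\<close>

definition scale_factors :: "(('v, 'r) tensor \<Rightarrow> ('v, 'r) tensor) \<Rightarrow> nat \<Rightarrow> 'r" where
  "scale_factors f = (\<lambda>j\<in>J. THE a. a \<in> carrier A \<and> f (pure (u j) \<one>) = pure (u j) a)"

lemma scale_factors_eqI:
  assumes r: "r \<in> carrier (unit_families J)" and f: "scales_by f r"
  shows "scale_factors f = r"
proof (rule extensionalityI[of _ J])
  fix j assume j: "j \<in> J"
  have rj: "r j \<in> carrier A" using r j by (auto simp: units_of_carrier)
  then have eq: "f (pure (u j) \<one>) = pure (u j) (r j)" using f j by (simp add: scales_by_def)
  have "(THE a. a \<in> carrier A \<and> f (pure (u j) \<one>) = pure (u j) a) = r j"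
    by (rule the_equality) (use rj eq pure_u_cancel[OF j] in auto)
  then show "scale_factors f j = r j" using j by (simp add: scale_factors_def)
qed (use r in \<open>auto simp: scale_factors_def PiE_def\<close>)

lemma scale_factors_in:
  assumes "f \<in> carrier (Diag sc X G \<Gamma> A)"
  shows "scale_factors f \<in> carrier (unit_families J)"
proof -
  obtain r where r: "r \<in> carrier (unit_families J)" "scales_by f r" by (rule Diag_scales_by[OF assms])
  then show ?thesis by (simp only: scale_factors_eqI)
qed

lemma Diag_mult:
  assumes "f \<in> carrier (Diag sc X G \<Gamma> A)" "g \<in> carrier (Diag sc X G \<Gamma> A)"
  shows "f \<otimes>\<^bsub>Diag sc X G \<Gamma> A\<^esub> g = compose (carrier VA) f g"
  using assms by (simp add: Diag_def AutoGroup_def auto_def BijGroup_def)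

lemma Diag_hom: "f \<in> carrier (Diag sc X G \<Gamma> A) \<Longrightarrow> f \<in> hom VA VA"
  by (simp add: Diag_def AutoGroup_def auto_def)

text \<open>Composition multiplies the factors, and a diagonal map is determined by its values on
  the tensors of basis vectors.\<close>

lemma scale_factors_iso: "scale_factors \<in> iso (Diag sc X G \<Gamma> A) (unit_families J)"
proof (intro isoI homI)
  show "scale_factors f \<in> carrier (unit_families J)" if "f \<in> carrier (Diag sc X G \<Gamma> A)" for f
    by (rule scale_factors_in[OF that])
  show "scale_factors (f \<otimes>\<^bsub>Diag sc X G \<Gamma> A\<^esub> g) = scale_factors f \<otimes>\<^bsub>unit_families J\<^esub> scale_factors g"
    if f: "f \<in> carrier (Diag sc X G \<Gamma> A)" and g: "g \<in> carrier (Diag sc X G \<Gamma> A)" for f g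
  proof -
    obtain r where r: "r \<in> carrier (unit_families J)" "scales_by f r" by (rule Diag_scales_by[OF f])
    obtain r' where r': "r' \<in> carrier (unit_families J)" "scales_by g r'" by (rule Diag_scales_by[OF g])
    have A: "r j \<in> carrier A" "r' j \<in> carrier A" if "j \<in> J" for j
      using r(1) r'(1) that by (auto simp: units_of_carrier)
    have "scales_by (compose (carrier VA) f g) (\<lambda>j\<in>J. r j \<otimes> r' j)"
      using scales_by_comp[OF r(2) r'(2) A] by (simp add: scales_by_def compose_def)
    moreover have "(\<lambda>j\<in>J. r j \<otimes> r' j) \<in> carrier (unit_families J)"
      using r(1) r'(1) by (auto simp: units_of_carrier)
    ultimately have "scale_factors (compose (carrier VA) f g) = (\<lambda>j\<in>J. r j \<otimes> r' j)"
      by (intro scale_factors_eqI)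
    then show ?thesis
      unfolding Diag_mult[OF f g] scale_factors_eqI[OF r] scale_factors_eqI[OF r'] by (simp add: units_of_mult)
  qed
  show "bij_betw scale_factors (carrier (Diag sc X G \<Gamma> A)) (carrier (unit_families J))"
  proof (rule bij_betwI')
    fix f g assume f: "f \<in> carrier (Diag sc X G \<Gamma> A)" and g: "g \<in> carrier (Diag sc X G \<Gamma> A)"
    show "scale_factors f = scale_factors g \<longleftrightarrow> f = g"
    proof
      assume eq: "scale_factors f = scale_factors g"
      obtain r where r: "r \<in> carrier (unit_families J)" "scales_by f r" by (rule Diag_scales_by[OF f])
      obtain r' where r': "r' \<in> carrier (unit_families J)" "scales_by g r'" by (rule Diag_scales_by[OF g])
      have "r = r'" using eq scale_factors_eqI[OF r] scale_factors_eqI[OF r'] by simp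
      have ext: "f \<in> extensional (carrier VA)" "g \<in> extensional (carrier VA)"
        using f g by (auto simp: Diag_def AutoGroup_def auto_def Bij_def)
      show "f = g"
        by (rule extensionalityI[OF ext])
          (rule scales_by_eqI[OF Diag_hom[OF f] r(2) Diag_hom[OF g] r'(2)], simp_all add: \<open>r = r'\<close>)
    qed simp
  next
    fix r assume r: "r \<in> carrier (unit_families J)"
    obtain f where f: "f \<in> carrier (Diag sc X G \<Gamma> A)" "scales_by f r" by (rule scales_by_in_Diag[OF r])
    show "\<exists>f\<in>carrier (Diag sc X G \<Gamma> A). r = scale_factors f"
      by (rule bexI[OF _ f(1)]) (rule scale_factors_eqI[OF r f(2), symmetric])
  qed (rule scale_factors_in)
qed

end

lemma generate_free_Abelian_group: "generate (free_Abelian_group J) (frag_of ` J) = carrier (free_Abelian_group J)"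
proof
  interpret comm_group "free_Abelian_group J" by (rule abelian_free_Abelian_group)
  have sub: "frag_of ` J \<subseteq> carrier (free_Abelian_group J)" by auto
  show "generate (free_Abelian_group J) (frag_of ` J) \<subseteq> carrier (free_Abelian_group J)"
    using generate_in_carrier[OF sub] by blast
  show "carrier (free_Abelian_group J) \<subseteq> generate (free_Abelian_group J) (frag_of ` J)"
  proof
    fix x assume "x \<in> carrier (free_Abelian_group J)"
    then have "Poly_Mapping.keys x \<subseteq> J" by simp
    then show "x \<in> generate (free_Abelian_group J) (frag_of ` J)"
    proof (rule free_Abelian_group_induct)
      show "0 \<in> generate (free_Abelian_group J) (frag_of ` J)"
        using generate.one[of "free_Abelian_group J" "frag_of ` J"] by simp
      fix x y :: "'a \<Rightarrow>\<^sub>0 int"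
      assume y: "Poly_Mapping.keys y \<subseteq> J" and *: "x \<in> generate (free_Abelian_group J) (frag_of ` J)"
        "y \<in> generate (free_Abelian_group J) (frag_of ` J)"
      have "x \<otimes>\<^bsub>free_Abelian_group J\<^esub> inv\<^bsub>free_Abelian_group J\<^esub> y \<in> generate (free_Abelian_group J) (frag_of ` J)"
        by (rule generate.eng[OF *(1) generate_m_inv_closed[OF sub *(2)]])
      then show "x - y \<in> generate (free_Abelian_group J) (frag_of ` J)" using y by simp
    qed (auto intro: generate.incl)
  qed
qed

section \<open>Naturality of the isomorphism in the algebra\<close>

context group_algebra_point
begin

lemma mult_FU_closed: "p \<in> carrier FU \<Longrightarrow> q \<in> carrier FU \<Longrightarrow> p \<otimes>\<^bsub>FU\<^esub> q \<in> carrier FU"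
  unfolding mult_FU by (intro sum_in_FU single_FU U.m_closed) (auto simp: carrier_FU)

lemma add_FU_closed: "p \<in> carrier FU \<Longrightarrow> q \<in> carrier FU \<Longrightarrow> p \<oplus>\<^bsub>FU\<^esub> q \<in> carrier FU"
  using keys_add[of p q] by (auto simp: carrier_FU add_FU)

lemma smult_FU_closed: "p \<in> carrier FU \<Longrightarrow> c \<odot>\<^bsub>FU\<^esub> p \<in> carrier FU"
  by (auto simp: carrier_FU smult_FU lookup_smult_map in_keys_iff subset_iff)

text \<open>The functor of points applied to an algebra homomorphism. The result has to be known as
  a point before \<open>torus_point_unique\<close> can identify it.\<close>

lemma point_compose:
  assumes \<alpha>: "\<alpha> \<in> carrier (group_algebra_points U A)" and \<phi>: "\<phi> \<in> alg_homs A A'"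
  shows "compose (carrier FU) \<phi> \<alpha> \<in> carrier (group_algebra_points U A')"
proof -
  have one: "\<one>\<^bsub>FU\<^esub> \<in> carrier FU" unfolding one_FU by (rule single_FU) simp
  have \<alpha>': "\<alpha> \<in> alg_homs FU A" using \<alpha> by (simp add: group_algebra_points_def)
  then have in_A: "\<alpha> p \<in> carrier A" if "p \<in> carrier FU" for p
    using that by (auto simp: alg_homs_def ring_hom_def)
  show ?thesis
    using \<alpha>' \<phi> one in_A mult_FU_closed add_FU_closed smult_FU_closed
    by (auto simp: group_algebra_points_def alg_homs_def ring_hom_def compose_def Pi_iff)
qed

end

lemma alg_hom_Units:
  assumes "comm_algebra A" "comm_algebra A'" and \<phi>: "\<phi> \<in> alg_homs A A'" and r: "r \<in> Units A"
  shows "\<phi> r \<in> Units A'"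
proof -
  have "\<phi> \<in> ring_hom A A'" using \<phi> by (simp add: alg_homs_def)
  with r show ?thesis by (auto simp: Units_def ring_hom_def) (metis (no_types, lifting) PiE)
qed

text \<open>\<theta> passes through families of units: the scale factors of a diagonal map, then the
  point whose character takes these values. On all three sides an algebra homomorphism \<phi> acts
  by applying \<phi> to each unit.\<close>

lemma universal_group_lines:
  fixes sc :: "'f::field \<Rightarrow> 'v::ab_group_add \<Rightarrow> 'v"
  assumes eb: "eigenbasis sc n u X c" and "inj_on d {1..n}" "d ` {1..n} \<subseteq> carrier G"
  shows "universal_group TYPE('r) sc X G (eigenbasis.lines_grading sc n u d) (free_Abelian_group {1..n})"
proof -
  interpret eigenbasis sc n u X c by (fact eb)
  let ?J = "{1..n}" and ?Z = "free_Abelian_group {1..n}"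
  define SF where "SF A = diagonal_scheme.scale_factors A sc n u" for A :: "('f, 'r) module"
  define \<theta> where "\<theta> A = comm_algebra_type.torus_point A ?J \<circ> SF A" for A :: "('f, 'r) module"
  have ds: "diagonal_scheme A sc n u X c G d" if "comm_algebra A" for A :: "('f, 'r) module"
    using that assms eigenbasis_axioms vector_space_axioms
    by (intro diagonal_scheme.intro scalar_extensionI diagonal_scheme_axioms.intro)
  have cat: "comm_algebra_type A" if "comm_algebra A" for A :: "('f, 'r) module"
    using that by (simp add: comm_algebra_type_def)
  have "\<theta> A \<in> iso (Diag sc X G (lines_grading d) A) (group_algebra_points ?Z A)" if A: "comm_algebra A" for A :: "('f, 'r) module"
    unfolding \<theta>_def SF_def
    by (rule iso_set_trans[OF diagonal_scheme.scale_factors_iso[OF ds[OF A]] comm_algebra_type.torus_point_iso[OF cat[OF A]]])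
  moreover have "\<exists>f'\<in>carrier (Diag sc X G (lines_grading d) A').
      (\<forall>t\<in>carrier (tensor_group sc A). f' (tensor_base_change sc A' \<phi> t) = tensor_base_change sc A' \<phi> (f t)) \<and>
      \<theta> A' f' = compose (carrier (group_algebra ?Z :: ('f, (nat \<Rightarrow>\<^sub>0 int) \<Rightarrow>\<^sub>0 'f) module)) \<phi> (\<theta> A f)"
    if A: "comm_algebra A" and A': "comm_algebra A'" and \<phi>: "\<phi> \<in> alg_homs A A'"
      and f: "f \<in> carrier (Diag sc X G (lines_grading d) A)"
    for A A' :: "('f, 'r) module" and \<phi> f
  proof -
    note dsA = ds[OF A] and dsA' = ds[OF A']
    note seA = diagonal_scheme.axioms(1)[OF dsA] and seA' = diagonal_scheme.axioms(1)[OF dsA']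
    note catA = cat[OF A] and catA' = cat[OF A']
    have \<phi>_ring: "\<phi> \<in> ring_hom A A'" using \<phi> by (simp add: alg_homs_def)
    obtain r where r: "r \<in> carrier (product_group ?J (\<lambda>_. units_of A))"
        and fr: "diagonal_scheme.scales_by A sc n u f r"
      by (rule diagonal_scheme.Diag_scales_by[OF dsA f])
    \<comment> \<open>The base change of \<open>f\<close> is the diagonal map whose factors are the
      images of the factors of \<open>f\<close>.\<close>
    define r' where "r' = (\<lambda>j\<in>?J. \<phi> (r j))"
    have rU: "r j \<in> Units A" if "j \<in> ?J" for j using r that by (auto simp: units_of_carrier)
    have r': "r' \<in> carrier (product_group ?J (\<lambda>_. units_of A'))"
      using alg_hom_Units[OF A A' \<phi> rU] by (auto simp: r'_def units_of_carrier)
    obtain f' where f': "f' \<in> carrier (Diag sc X G (lines_grading d) A')"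
        and fr': "diagonal_scheme.scales_by A' sc n u f' r'"
      by (rule diagonal_scheme.scales_by_in_Diag[OF dsA' r'])
    have bc: "f' (tensor_base_change sc A' \<phi> t) = tensor_base_change sc A' \<phi> (f t)"
      if t: "t \<in> carrier (tensor_group sc A)" for t
    proof -
      have bc_hom: "tensor_base_change sc A' \<phi> \<in> hom (tensor_group sc A) (tensor_group sc A')"
        by (rule scalar_extension.tensor_base_change_hom[OF seA A' \<phi>])
      note bc_pure = scalar_extension.tensor_base_change_pure[OF seA A' \<phi>]
      interpret M: comm_group "tensor_group sc A'" by (rule scalar_extension.comm_group_VA[OF seA'])
      have "(f' \<circ> tensor_base_change sc A' \<phi>) t = (tensor_base_change sc A' \<phi> \<circ> f) t"
      proof (rule diagonal_scheme.hom_VA_basis_eqI[OF dsA M.is_group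
            hom_compose[OF bc_hom diagonal_scheme.Diag_hom[OF dsA' f']]
            hom_compose[OF diagonal_scheme.Diag_hom[OF dsA f] bc_hom] _ t])
        \<comment> \<open>Both composites send this tensor to that of \<open>u j\<close> with
          \<open>\<phi> (r j \<otimes> a)\<close>.\<close>
        fix j a assume j: "j \<in> ?J" and a: "a \<in> carrier A"
        have rj: "r j \<in> carrier A" using rU[OF j] by (simp add: Units_def)
        have "r j \<otimes>\<^bsub>A\<^esub> a \<in> carrier A"
          using comm_algebra_type.comm_algebra[OF catA] rj a
          by (simp add: comm_algebra_def algebra_def cring_def ring_def monoid.m_closed)
        then show "(f' \<circ> tensor_base_change sc A' \<phi>) (pure_tensor sc A (u j) a) =
            (tensor_base_change sc A' \<phi> \<circ> f) (pure_tensor sc A (u j) a)"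
          using fr fr' j a rj ring_hom_closed[OF \<phi>_ring a] ring_hom_mult[OF \<phi>_ring rj a]
          by (simp add: diagonal_scheme.scales_by_def[OF dsA] diagonal_scheme.scales_by_def[OF dsA'] bc_pure r'_def)
      qed
      then show ?thesis by simp
    qed
    have gap: "group_algebra_point A ?Z"
      by (rule comm_algebra_type.group_algebra_point[OF catA])
    let ?\<alpha> = "comm_algebra_type.torus_point A ?J r"
    have \<alpha>: "?\<alpha> \<in> carrier (group_algebra_points ?Z A)"
      by (rule comm_algebra_type.torus_point_in[OF catA r])
    have "compose (carrier (group_algebra ?Z :: ('f, (nat \<Rightarrow>\<^sub>0 int) \<Rightarrow>\<^sub>0 'f) module)) \<phi> ?\<alpha> =
        comm_algebra_type.torus_point A' ?J r'"
    \<comment> \<open>Both points take the value \<open>\<phi> (r j)\<close> on the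
      \<open>j\<close>-th canonical generator.\<close>
    proof (rule comm_algebra_type.torus_point_unique[OF catA' r' group_algebra_point.point_compose[OF gap \<alpha> \<phi>]])
      fix j assume j: "j \<in> ?J"
      have "Poly_Mapping.single (frag_of j) 1 \<in> carrier (group_algebra ?Z :: ('f, (nat \<Rightarrow>\<^sub>0 int) \<Rightarrow>\<^sub>0 'f) module)"
        by (rule group_algebra_point.single_FU[OF gap]) (use j in simp)
      then show "compose (carrier (group_algebra ?Z :: ('f, (nat \<Rightarrow>\<^sub>0 int) \<Rightarrow>\<^sub>0 'f) module)) \<phi> ?\<alpha>
          (Poly_Mapping.single (frag_of j) 1) = r' j"
        using j comm_algebra_type.torus_point_frag_of[OF catA r j] by (simp add: compose_def r'_def)
    qed
    then have "\<theta> A' f' = compose (carrier (group_algebra ?Z :: ('f, (nat \<Rightarrow>\<^sub>0 int) \<Rightarrow>\<^sub>0 'f) module)) \<phi> (\<theta> A f)"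
      using diagonal_scheme.scale_factors_eqI[OF dsA r fr] diagonal_scheme.scale_factors_eqI[OF dsA' r' fr']
      by (simp add: \<theta>_def SF_def)
    with f' bc show ?thesis by blast
  qed
  ultimately have "Diag_isomorphic TYPE('r) sc X G (lines_grading d) ?Z"
    unfolding Diag_isomorphic_def by blast
  moreover have "\<exists>S\<subseteq>carrier ?Z. finite S \<and> generate ?Z S = carrier ?Z"
    by (rule exI[of _ "frag_of ` ?J"]) (auto simp: generate_free_Abelian_group simp del: carrier_free_Abelian_group_iff)
  ultimately show ?thesis
    unfolding universal_group_def using abelian_free_Abelian_group by blast
qed

section \<open>Classification\<close>

theorem mainTheorem14:
  fixes scale :: "'f::alg_closed_field \<Rightarrow> 'v::ab_group_add \<Rightarrow> 'v"
    and B :: "'v set"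
    and X :: "'v \<Rightarrow> 'v"
    and s :: nat
    and i :: 'f
  assumes "CHAR('f) \<noteq> 2"
    and "finite_dimensional_vector_space scale B"
    and "vector_space.dim scale (UNIV :: 'v set) = 2 * s"
    and "one_fold_cross_product scale X"
    and "i ^ 2 = - 1"
  shows "let Vplus = {x. X x = scale i x};
             Vminus = {x. X x = - scale i x};
             Zn = free_Abelian_group {1..2 * s}
         in
    (\<exists>v w. indexed_basis scale s v Vplus \<and> indexed_basis scale s w Vminus) \<and>
    (\<forall>v w. indexed_basis scale s v Vplus \<and> indexed_basis scale s w Vminus \<longrightarrow>
       (let \<Gamma> = bases_grading scale s v w in
          fine_grading TYPE('h) scale X Zn \<Gamma> \<and>
          (\<forall>(G :: 'g monoid) \<Delta>. fine_grading TYPE(nat) scale X G \<Delta> \<longrightarrow>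
             equivalent_gradings scale X G \<Delta> Zn \<Gamma>) \<and>
          universal_group TYPE('r) scale X Zn \<Gamma> Zn \<and>
          Weyl_group scale X Zn \<Gamma> \<cong> sym_group s \<times>\<times> sym_group s))"
proof -
  interpret finite_dimensional_vector_space scale B by (fact assms(2))
  interpret cross_product_space scale B X s i
    by unfold_locales (use assms in auto)
  have eig: "{x. X x = scale i x} = eigenspace i" "{x. X x = - scale i x} = eigenspace (- i)"
    by (simp_all add: eigenspace_def)
  have "universal_group TYPE('r) scale X (free_Abelian_group {1..2 * s}) (bases_grading scale s v w) (free_Abelian_group {1..2 * s})"
    and "Weyl_group scale X (free_Abelian_group {1..2 * s}) (bases_grading scale s v w) \<cong> sym_group s \<times>\<times> sym_group s"
    if v: "indexed_basis scale s v (eigenspace i)" and w: "indexed_basis scale s w (eigenspace (- i))" for v w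
  proof -
    interpret u: eigenbasis scale "2 * s" "merge_bases s v w" X eigenvalue by (rule eigenbasis_merge[OF v w])
    have d: "inj_on frag_of {1..2 * s}" "frag_of ` {1..2 * s} \<subseteq> carrier (free_Abelian_group {1..2 * s})"
      by (auto simp: inj_on_def frag_of_eq)
    show "universal_group TYPE('r) scale X (free_Abelian_group {1..2 * s}) (bases_grading scale s v w) (free_Abelian_group {1..2 * s})"
      unfolding bases_grading_eq_lines[abs_def] by (rule universal_group_lines[OF u.eigenbasis_axioms d])
    \<comment> \<open>Unfolds \<open>eigenvalue\<close> into the case distinction that
      \<open>two_eigenvalue_basis\<close> has in its place, with \<open>a = i\<close> and
      \<open>b = - i\<close>.\<close>
    have "eigenbasis scale (2 * s) (merge_bases s v w) X (\<lambda>j. if j \<le> s then i else - i)"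
      using u.eigenbasis_axioms unfolding eigenvalue_def[abs_def] .
    then have "two_eigenvalue_basis scale s (merge_bases s v w) X i (- i)"
      using i_neq_minus_i by (simp add: two_eigenvalue_basis_def two_eigenvalue_basis_axioms_def)
    then show "Weyl_group scale X (free_Abelian_group {1..2 * s}) (bases_grading scale s v w) \<cong> sym_group s \<times>\<times> sym_group s"
      unfolding bases_grading_eq_lines[abs_def] by (rule two_eigenvalue_basis.Weyl_group_lines[OF _ d])
  qed
  then show ?thesis
    using exists_indexed_basis_eigenspace[of i] exists_indexed_basis_eigenspace[of "- i"]
      fine_bases_grading fine_equivalent_bases_grading
    unfolding Let_def eig by blast
qed

end
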